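(* Let $w(x,y)=R(|x-y|)$ for all $x,y\in[0,1]$, where $R:[0,1]\to(0,1]$ is $\mathcal{C}^1$ with $R'(x)<0$ for all $x\in(0,1)$. For each $N$ let $G^{(N)}\sim w$ and let $\hat\sigma^{(N)}$ be the output of the spectral seriation algorithm with input $G^{(N)}$. (i) For every $\varepsilon\in(0,1)$ and $\eta\in(0,1/3)$ there exist $C=C(w)>0$ and $N_0=N_0(w,\varepsilon,\eta)$ such that for all $N\ge N_0$, $\mathbb{P}(\|\hat\sigma^{(N)}-\mathrm{id}_N\|_1\le CN^{2-\eta})>1-\varepsilon$. (ii) Let $\tilde\sigma^{(N)}$ be the output of the post-processing algorithm with input $G^{(N)}$ and parameters $\alpha=0.05$, $\beta=0.31$. Then for every $\gamma>1$ and $\epsilon>0$ there exist $\delta=\delta(w,\gamma,\epsilon)>0$ and $N_0=N_0(w,\gamma,\epsilon)$ such that for all $N\ge N_0$, $\mathbb{P}(\|\tilde\sigma^{(N)}-\mathrm{id}_N\|_\infty\le\epsilon\sqrt{N(\log N)^\gamma})>1-\varepsilon_\gamma(N)^\delta$.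
   Context: Random graph $G\sim w$ on $V=\{v_1,\dots,v_N\}$, $v_i=i/N$: edges $\{v_i,v_j\}$, $i<j$, present independently with probability $w(v_i,v_j)$. For a finite set $S$ and $f:S\to\mathbb{R}$, $\sigma_f(s)=|\{s'\in S: f(s')\le f(s)\}|$ (ties broken arbitrarily to get a bijection $S\to[|S|]$); for an ordering $\sigma:S\to[|S|]$, $\mathrm{rev}(\sigma)=|S|+1-\sigma$. Spectral seriation algorithm: given a graph with adjacency matrix $A$, take an eigenvector $\phi$ of its Laplacian $D-A$ ($D$ diagonal degree matrix) for the second-smallest eigenvalue and output $\sigma_\phi$. Subroutine (input $G$, disjoint $T,S\subset V$, $\alpha,\beta$): (1) $\hat\sigma_T$ = spectral seriation of the induced subgraph $G|_T$; (2) $R=\{u\in T:\hat\sigma_T(u)\ge(1-\alpha)|T|\}$, $L=\{u\in T:\hat\sigma_T(u)\le\alpha|T|\}$; (3) for $v\in S$, $\psi_R(v)=|T|^{-1}|\{u\in R:\{u,v\}\in E\}|$, $\psi_L(v)=|T|^{-1}|\{u\in L:\{u,v\}\in E\}|$; (4) $c_R=\inf\{c\ge0:|\{v\in S:\psi_R(v)\le c\}|\ge(1-\beta)|S|\}$, $c_L$ analogously with $\psi_L$; (5) define antisymmetric $\hat F:S^2\to\{-1,0,1\}$ ($\hat F(v,u)=-\hat F(u,v)$, $\hat F(u,u)=0$) by, for $u<v$: $\hat F(u,v)=1-2\cdot\mathbf{1}[\psi_R(u)>\psi_R(v)]$ if $\psi_R(u),\psi_R(v)<c_R$; otherwise $1-2\cdot\mathbf{1}[\psi_L(u)<\psi_L(v)]$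 if $\psi_L(u),\psi_L(v)<c_L$; otherwise $1$ if $\psi_R(u)<c_R$; otherwise $-1$; (6) $\hat f(v)=\sum_{u\in S}\hat F(u,v)$; (7) output $\sigma_{\hat f}:S\to[|S|]$. A partition $(S_1,S_2,S_3)$ of $V$ is good if $n\le|S_3|\le|S_2|\le|S_1|\le n+1$, $n=\lfloor N/3\rfloor$. Orderings $\sigma_1:S_1\to[|S_1|]$, $\sigma_2:S_2\to[|S_2|]$ are aligned if $\max_{i\in S_1\cap S_2}|\sigma_1(i)/|S_1|-\sigma_2(i)/|S_2||\le\max_{i\in S_1\cap S_2}|\mathrm{rev}(\sigma_1)(i)/|S_1|-\sigma_2(i)/|S_2||$ (aligned if $S_1\cap S_2=\emptyset$). The merged ordering of $(\sigma_1,\sigma_2,\sigma_3)$ on a good partition is $\sigma:[N]\to[N]$ with $\sigma^{-1}(3k+j)=N\sigma_j^{-1}(k+1)$ for $k\in\{0,\dots,n\}$, $j\in\{1,2,3\}$, $3k+j\le N$. Post-processing algorithm (input $G$, $\alpha,\beta$): choose uniformly at random a good partition $(S_1,S_2,S_3)$ and independently another $(S_1',S_2',S_3')$; run the subroutine on $(T,S)=(S_3,S_1),(S_1,S_2),(S_2,S_3)$ to get $\hat\sigma_1,\hat\sigma_2,\hat\sigma_3$, and on $(S_1',S_2')$ to get $\hat\sigma_{\mathrm{ref}}$; replace each $\hat\sigma_j$ by $\mathrm{rev}(\hat\sigma_j)$ if it is not aligned with $\hat\sigma_{\mathrm{ref}}$; output the merged ordering of $(\hat\sigma_1,\hat\sigma_2,\hat\sigma_3)$.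 Distances are symmetrized under reversal: for a permutation $\sigma$ of $[N]$, $\|\sigma-\mathrm{id}_N\|_p:=\min(\|\sigma-\mathrm{id}_N\|_p,\|\mathrm{rev}(\sigma)-\mathrm{id}_N\|_p)$ for $p\in\{1,\infty\}$, with $\mathrm{rev}(\sigma)(i)=N+1-\sigma(i)$. $\varepsilon_\gamma(N)=\exp(-(\log N)^\gamma)$. *)

theory Defs
  imports "HOL-Analysis.Analysis" "HOL-Probability.Product_PMF" "HOL-Library.Multiset"
    "Jordan_Normal_Form.Char_Poly"
begin

text \<open>Vertices v_i = i/N are represented by their indices i in {1..N}.
  A graph sample is a function on pairs (i,j), 1 <= i < j <= N, true iff the edge is present.\<close>

definition adj :: "(nat \<times> nat \<Rightarrow> bool) \<Rightarrow> nat \<Rightarrow> nat \<Rightarrow> bool" where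
  "adj G i j = (i \<noteq> j \<and> (if i < j then G (i, j) else G (j, i)))"

definition graph_pmf :: "(real \<Rightarrow> real \<Rightarrow> real) \<Rightarrow> nat \<Rightarrow> (nat \<times> nat \<Rightarrow> bool) pmf" where
  "graph_pmf w N = Pi_pmf {(i, j). 1 \<le> i \<and> i < j \<and> j \<le> N} False
      (\<lambda>(i, j). bernoulli_pmf (w (real i / real N) (real j / real N)))"

text \<open>sigma_f with ties broken arbitrarily: all bijections S -> {1..|S|} with
  |{s'. f s' < f s}| < sigma s <= |{s'. f s' <= f s}|.\<close>
definition rank_orderings :: "nat set \<Rightarrow> (nat \<Rightarrow> real) \<Rightarrow> (nat \<Rightarrow> nat) set" where
  "rank_orderings S f = {\<sigma>. bij_betw \<sigma> S {1..card S} \<and>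
     (\<forall>s\<in>S. card {s'\<in>S. f s' < f s} < \<sigma> s \<and> \<sigma> s \<le> card {s'\<in>S. f s' \<le> f s})}"

definition lap_mat :: "(nat \<times> nat \<Rightarrow> bool) \<Rightarrow> nat set \<Rightarrow> real mat" where
  "lap_mat G T = (let ts = sorted_list_of_set T in
     mat (card T) (card T) (\<lambda>(a, b). if a = b then real (card {u\<in>T. adj G (ts ! a) u})
                                     else if adj G (ts ! a) (ts ! b) then -1 else 0))"

definition lambda2 :: "(nat \<times> nat \<Rightarrow> bool) \<Rightarrow> nat set \<Rightarrow> real" where
  "lambda2 G T = sorted_list_of_multiset (proots (char_poly (lap_mat G T))) ! 1"

definition spectral_outputs :: "(nat \<times> nat \<Rightarrow> bool) \<Rightarrow> nat set \<Rightarrow> (nat \<Rightarrow> nat) set" where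
  "spectral_outputs G T = {\<sigma>. \<exists>v \<phi>. eigenvector (lap_mat G T) v (lambda2 G T) \<and>
      (\<forall>i<card T. \<phi> (sorted_list_of_set T ! i) = v $ i) \<and> \<sigma> \<in> rank_orderings T \<phi>}"

definition psi :: "(nat \<times> nat \<Rightarrow> bool) \<Rightarrow> nat set \<Rightarrow> nat set \<Rightarrow> nat \<Rightarrow> real" where
  "psi G T A v = real (card {u\<in>A. adj G u v}) / real (card T)"

definition cthr :: "(nat \<Rightarrow> real) \<Rightarrow> nat set \<Rightarrow> real \<Rightarrow> real" where
  "cthr p S \<beta> = Inf {c. c \<ge> 0 \<and> real (card {v\<in>S. p v \<le> c}) \<ge> (1 - \<beta>) * real (card S)}"

definition Fhat0 :: "(nat \<Rightarrow> real) \<Rightarrow> (nat \<Rightarrow> real) \<Rightarrow> real \<Rightarrow> real \<Rightarrow> nat \<Rightarrow> nat \<Rightarrow> int" where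
  "Fhat0 pR pL cR cL u v =
     (if pR u < cR \<and> pR v < cR then 1 - 2 * (if pR u > pR v then 1 else 0)
      else if pL u < cL \<and> pL v < cL then 1 - 2 * (if pL u < pL v then 1 else 0)
      else if pR u < cR then 1 else -1)"

definition Fhat :: "(nat \<Rightarrow> real) \<Rightarrow> (nat \<Rightarrow> real) \<Rightarrow> real \<Rightarrow> real \<Rightarrow> nat \<Rightarrow> nat \<Rightarrow> int" where
  "Fhat pR pL cR cL u v =
     (if u < v then Fhat0 pR pL cR cL u v
      else if v < u then - Fhat0 pR pL cR cL v u else 0)"

definition fhat :: "(nat \<times> nat \<Rightarrow> bool) \<Rightarrow> nat set \<Rightarrow> nat set \<Rightarrow> real \<Rightarrow> real \<Rightarrow> (nat \<Rightarrow> nat) \<Rightarrow> nat \<Rightarrow> int" where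
  "fhat G T S \<alpha> \<beta> \<sigma>T v =
     (let R = {u\<in>T. real (\<sigma>T u) \<ge> (1 - \<alpha>) * real (card T)};
          L = {u\<in>T. real (\<sigma>T u) \<le> \<alpha> * real (card T)};
          pR = psi G T R; pL = psi G T L;
          cR = cthr pR S \<beta>; cL = cthr pL S \<beta>
      in \<Sum>u\<in>S. Fhat pR pL cR cL u v)"

definition subroutine_outputs :: "(nat \<times> nat \<Rightarrow> bool) \<Rightarrow> nat set \<Rightarrow> nat set \<Rightarrow> real \<Rightarrow> real \<Rightarrow> (nat \<Rightarrow> nat) set" where
  "subroutine_outputs G T S \<alpha> \<beta> = {\<sigma>. \<exists>\<sigma>T\<in>spectral_outputs G T.
       \<sigma> \<in> rank_orderings S (\<lambda>v. real_of_int (fhat G T S \<alpha> \<beta> \<sigma>T v))}"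

definition rev_ord :: "nat set \<Rightarrow> (nat \<Rightarrow> nat) \<Rightarrow> nat \<Rightarrow> nat" where
  "rev_ord S \<sigma> = (\<lambda>i. card S + 1 - \<sigma> i)"

definition aligned :: "nat set \<Rightarrow> (nat \<Rightarrow> nat) \<Rightarrow> nat set \<Rightarrow> (nat \<Rightarrow> nat) \<Rightarrow> bool" where
  "aligned S1 \<sigma>1 S2 \<sigma>2 = (S1 \<inter> S2 = {} \<or>
     Max ((\<lambda>i. \<bar>real (\<sigma>1 i) / real (card S1) - real (\<sigma>2 i) / real (card S2)\<bar>) ` (S1 \<inter> S2))
     \<le> Max ((\<lambda>i. \<bar>real (rev_ord S1 \<sigma>1 i) / real (card S1) - real (\<sigma>2 i) / real (card S2)\<bar>) ` (S1 \<inter> S2)))"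

definition align_to :: "nat set \<Rightarrow> (nat \<Rightarrow> nat) \<Rightarrow> nat set \<Rightarrow> (nat \<Rightarrow> nat) \<Rightarrow> nat \<Rightarrow> nat" where
  "align_to S \<sigma> Sr \<sigma>r = (if aligned S \<sigma> Sr \<sigma>r then \<sigma> else rev_ord S \<sigma>)"

definition good_partitions :: "nat \<Rightarrow> (nat set \<times> nat set \<times> nat set) set" where
  "good_partitions N = {(S1, S2, S3). S1 \<union> S2 \<union> S3 = {1..N} \<and> S1 \<inter> S2 = {} \<and> S1 \<inter> S3 = {}
      \<and> S2 \<inter> S3 = {} \<and> N div 3 \<le> card S3 \<and> card S3 \<le> card S2 \<and> card S2 \<le> card S1
      \<and> card S1 \<le> N div 3 + 1}"

text \<open>Merged ordering: sigma^{-1}(3k+j) = N sigma_j^{-1}(k+1), i.e. the vertex of S_j with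
  rank k+1 is sent to position 3k+j.\<close>
definition merged :: "nat set \<Rightarrow> nat set \<Rightarrow> nat set \<Rightarrow> (nat \<Rightarrow> nat) \<Rightarrow> (nat \<Rightarrow> nat) \<Rightarrow> (nat \<Rightarrow> nat) \<Rightarrow> nat \<Rightarrow> nat" where
  "merged S1 S2 S3 \<sigma>1 \<sigma>2 \<sigma>3 i =
     (if i \<in> S1 then 3 * (\<sigma>1 i - 1) + 1
      else if i \<in> S2 then 3 * (\<sigma>2 i - 1) + 2
      else 3 * (\<sigma>3 i - 1) + 3)"

definition pp_outputs :: "(nat \<times> nat \<Rightarrow> bool) \<Rightarrow> real \<Rightarrow> real \<Rightarrow>
    nat set \<times> nat set \<times> nat set \<Rightarrow> nat set \<times> nat set \<times> nat set \<Rightarrow> (nat \<Rightarrow> nat) set" where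
  "pp_outputs G \<alpha> \<beta> P P' = (case P of (S1, S2, S3) \<Rightarrow> case P' of (S1', S2', S3') \<Rightarrow>
     {merged S1 S2 S3 (align_to S1 \<sigma>1 S2' \<sigma>r) (align_to S2 \<sigma>2 S2' \<sigma>r) (align_to S3 \<sigma>3 S2' \<sigma>r)
       | \<sigma>1 \<sigma>2 \<sigma>3 \<sigma>r. \<sigma>1 \<in> subroutine_outputs G S3 S1 \<alpha> \<beta> \<and> \<sigma>2 \<in> subroutine_outputs G S1 S2 \<alpha> \<beta>
          \<and> \<sigma>3 \<in> subroutine_outputs G S2 S3 \<alpha> \<beta> \<and> \<sigma>r \<in> subroutine_outputs G S1' S2' \<alpha> \<beta>})"

definition dist1 :: "nat \<Rightarrow> (nat \<Rightarrow> nat) \<Rightarrow> real" where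
  "dist1 N \<sigma> = min (\<Sum>i=1..N. \<bar>real (\<sigma> i) - real i\<bar>)
                    (\<Sum>i=1..N. \<bar>real (N + 1 - \<sigma> i) - real i\<bar>)"

definition distinf :: "nat \<Rightarrow> (nat \<Rightarrow> nat) \<Rightarrow> real" where
  "distinf N \<sigma> = min (Max ((\<lambda>i. \<bar>real (\<sigma> i) - real i\<bar>) ` {1..N}))
                      (Max ((\<lambda>i. \<bar>real (N + 1 - \<sigma> i) - real i\<bar>) ` {1..N}))"

definition eps_gamma :: "real \<Rightarrow> nat \<Rightarrow> real" where
  "eps_gamma \<gamma> N = exp (- (ln (real N) powr \<gamma>))"

end

theory Submission
  imports Defs "HOL-Probability.Hoeffding" "HOL-Real_Asymp.Real_Asymp"
begin

text \<open>Everything is finite-dimensional. For an equidistributed vertex set T with n points x_k, let L be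
  the expected Laplacian and \<mu> its smallest eigenvalue on mean-zero vectors. A test function supported
  near the two ends shows that \<mu> stays below all degrees by a multiple of n. The increments of an
  eigenvector satisfy an equation with a nonnegative kernel, because R decreases; hence a minimiser u
  can be chosen monotone, its increments are comparable to those of x, and a Doeblin-type
  minorization of the kernel gives a spectral gap of order n.

  Let B be slightly larger than the square root of N. With high probability the noise matrix has row sums
  at most B, maps u to a vector with entries at most B, and its square has off-diagonal entries at most
  B; each of these is an instance of Hoeffding's inequality. The last property bounds the operator norm
  by o(n), so the Fiedler vector v of the sampled graph is close to u in l2. The eigenvector equation
  then upgrades this to a uniform error of order B/n: the diagonal part is at least a multiple of n,
  and the off-diagonal part is controlled by Cauchy-Schwarz. So the ranks of v are already correct up
  to O(B).

  Consequently the two end blocks that the subroutine calls R and L differ from fixed sets by O(B) vertices, whatever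
  the tie-breaking, and no conditioning on the graph on T is needed: comparing \<psi>_R and \<psi>_L with their
  means for the fixed sets yields ranks that are correct up to O(B) as well.\<close>

section \<open>Weighted graph Laplacians and Rayleigh quotients\<close>

text \<open>The second eigenvector of the expected Laplacian depends on the vertex set
  \<open>T\<close> but not on the sampled edges, and partitions are drawn independently of the
  graph. So it can serve as a fixed weight vector in Hoeffding's inequality, and only polynomially
  many events with tail exp (- B^2 / (2 N)) have to be excluded. For B of order sqrt (N (ln
  N)^\<gamma>) the tail beats every power of N precisely because \<gamma> > 1. The bound on the
  squared noise gives an operator norm of order sqrt (n B), much larger than the true order sqrt n,
  but anything o(n) is enough. The number 0.31 comes from overlapping ranges. Expected edge counts
  into the right block order a vertex left of 0.7 correctly against everything to its right, those
  into the left block a vertex right of 0.3 against everything to its left. The quantiles cut near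
  0.69 and 0.31, so two vertices lie both in the first range, both in the second, or near opposite
  ends. Ties and the choice of an eigenvector make the outputs sets, so each estimate is proved for
  all admissible outputs at once.\<close>

definition ip :: "nat \<Rightarrow> (nat \<Rightarrow> real) \<Rightarrow> (nat \<Rightarrow> real) \<Rightarrow> real" where
  "ip n f g = (\<Sum>k<n. f k * g k)"

definition wlap :: "nat \<Rightarrow> (nat \<Rightarrow> nat \<Rightarrow> real) \<Rightarrow> (nat \<Rightarrow> real) \<Rightarrow> nat \<Rightarrow> real" where
  "wlap n W v k = (\<Sum>l<n. W k l * (v k - v l))"

definition symw :: "nat \<Rightarrow> (nat \<Rightarrow> nat \<Rightarrow> real) \<Rightarrow> bool" where
  "symw n W \<longleftrightarrow> (\<forall>k<n. \<forall>l<n. W k l = W l k)"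

definition orth :: "nat \<Rightarrow> (nat \<Rightarrow> real) set \<Rightarrow> (nat \<Rightarrow> real) \<Rightarrow> bool" where
  "orth n C v \<longleftrightarrow> (\<forall>c\<in>C. ip n v c = 0)"

text \<open>The facts about the expected Laplacian that the perturbation argument consumes, in units
  of n: room \<open>c0\<close> between \<mu> and the degrees, room \<gamma> between \<mu> and the
  rest of the spectrum on mean-zero vectors, and a lower bound \<open>c'\<close> on the mass of
  \<open>u\<close>, whose entries are normalised to at most 1.\<close>

definition fiedler :: "nat \<Rightarrow> (nat \<Rightarrow> nat \<Rightarrow> real) \<Rightarrow> real \<Rightarrow> real \<Rightarrow> real \<Rightarrow> (nat \<Rightarrow> real) \<Rightarrow> real \<Rightarrow> bool" where
  "fiedler n W c0 \<gamma> c' u \<mu> \<longleftrightarrow> (\<Sum>k<n. u k) = 0 \<and> (\<forall>k<n. wlap n W u k = \<mu> * u k) \<and> (\<forall>k<n. \<bar>u k\<bar> \<le> 1) \<and>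
     (\<forall>k<n. \<mu> + c0 * real n \<le> (\<Sum>l<n. W k l)) \<and>
     (\<forall>h. (\<Sum>k<n. h k) = 0 \<longrightarrow> ip n u h = 0 \<longrightarrow> (\<mu> + \<gamma> * real n) * ip n h h \<le> ip n (wlap n W h) h) \<and>
     c' * real n \<le> ip n u u"

lemma fiedlerD:
  assumes "fiedler n W c0 \<gamma> c' u \<mu>"
  shows "(\<Sum>k<n. u k) = 0" "k < n \<Longrightarrow> wlap n W u k = \<mu> * u k" "k < n \<Longrightarrow> \<bar>u k\<bar> \<le> 1"
    "k < n \<Longrightarrow> \<mu> + c0 * real n \<le> (\<Sum>l<n. W k l)"
    "(\<Sum>k<n. h k) = 0 \<Longrightarrow> ip n u h = 0 \<Longrightarrow> (\<mu> + \<gamma> * real n) * ip n h h \<le> ip n (wlap n W h) h"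
    "c' * real n \<le> ip n u u"
  using assms by (auto simp: fiedler_def)

lemma ip_commute: "ip n f g = ip n g f"
  by (simp add: ip_def mult.commute)

lemma ip_add_left: "ip n (\<lambda>k. f k + g k) h = ip n f h + ip n g h"
  by (simp add: ip_def algebra_simps sum.distrib)

lemma ip_diff_left: "ip n (\<lambda>k. f k - g k) h = ip n f h - ip n g h"
  by (simp add: ip_def algebra_simps sum_subtractf)

lemma ip_scale_left: "ip n (\<lambda>k. c * f k) h = c * ip n f h"
  by (simp add: ip_def algebra_simps sum_distrib_left)

lemma ip_add_right: "ip n h (\<lambda>k. f k + g k) = ip n h f + ip n h g"
  by (simp add: ip_def algebra_simps sum.distrib)

lemma ip_diff_right: "ip n h (\<lambda>k. f k - g k) = ip n h f - ip n h g"
  by (simp add: ip_def algebra_simps sum_subtractf)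

lemma ip_scale_right: "ip n h (\<lambda>k. c * f k) = c * ip n h f"
  by (simp add: ip_def algebra_simps sum_distrib_left)

lemmas ip_simps = ip_add_left ip_diff_left ip_scale_left ip_add_right ip_diff_right ip_scale_right

lemma ip_nonneg: "0 \<le> ip n f f"
  by (simp add: ip_def sum_nonneg)

lemma ip_self_eq_0: "ip n f f = 0 \<longleftrightarrow> (\<forall>k<n. f k = 0)"
  by (auto simp: ip_def sum_nonneg_eq_0_iff)

lemma ip_cong: "(\<And>k. k < n \<Longrightarrow> f k = f' k) \<Longrightarrow> (\<And>k. k < n \<Longrightarrow> g k = g' k) \<Longrightarrow> ip n f g = ip n f' g'"
  by (simp add: ip_def)

lemma ip_Cauchy: "\<bar>ip n f g\<bar> \<le> sqrt (ip n f f) * sqrt (ip n g g)"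
proof -
  have "(ip n f g)\<^sup>2 \<le> ip n f f * ip n g g"
    using Cauchy_Schwarz_ineq_sum[of f g "{..<n}"] by (simp add: ip_def power2_eq_square)
  from real_sqrt_le_mono[OF this] show ?thesis by (simp add: real_sqrt_mult)
qed

lemma wlap_add: "wlap n W (\<lambda>k. f k + g k) k = wlap n W f k + wlap n W g k"
  by (simp add: wlap_def algebra_simps flip: sum.distrib)

lemma wlap_diff: "wlap n W (\<lambda>k. f k - g k) k = wlap n W f k - wlap n W g k"
  by (simp add: wlap_def algebra_simps flip: sum_subtractf)

lemma wlap_scale: "wlap n W (\<lambda>k. c * f k) k = c * wlap n W f k"
  by (simp add: wlap_def algebra_simps sum_distrib_left)

lemma wlap_const: "wlap n W (\<lambda>k. c) k = 0"
  by (simp add: wlap_def)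

text \<open>The Dirichlet form: averaging the sum with its copy under exchange of \<open>k\<close>
  and \<open>l\<close> completes the factor \<open>h k\<close> to a difference.\<close>

lemma wlap_form:
  assumes "symw n W"
  shows "2 * ip n (wlap n W f) h = (\<Sum>k<n. \<Sum>l<n. W k l * (f k - f l) * (h k - h l))"
proof -
  have a: "ip n (wlap n W f) h = (\<Sum>k<n. \<Sum>l<n. W k l * (f k - f l) * h k)"
    by (simp add: ip_def wlap_def sum_distrib_right)
  have "(\<Sum>k<n. \<Sum>l<n. W k l * (f k - f l) * h k) = (\<Sum>l<n. \<Sum>k<n. W k l * (f k - f l) * h k)"
    by (rule sum.swap)
  also have "\<dots> = (\<Sum>k<n. \<Sum>l<n. W k l * (f l - f k) * h l)"
    using assms by (intro sum.cong refl) (auto simp: symw_def)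
  finally have b: "ip n (wlap n W f) h = (\<Sum>k<n. \<Sum>l<n. W k l * (f l - f k) * h l)"
    using a by simp
  have "2 * ip n (wlap n W f) h = (\<Sum>k<n. \<Sum>l<n. W k l * (f k - f l) * h k) + (\<Sum>k<n. \<Sum>l<n. W k l * (f l - f k) * h l)"
    using a b by simp
  also have "\<dots> = (\<Sum>k<n. \<Sum>l<n. W k l * (f k - f l) * (h k - h l))"
    by (simp add: algebra_simps flip: sum.distrib)
  finally show ?thesis .
qed

lemma wlap_self_adjoint:
  assumes "symw n W"
  shows "ip n (wlap n W f) h = ip n f (wlap n W h)"
proof -
  have "2 * ip n (wlap n W f) h = 2 * ip n (wlap n W h) f"
    unfolding wlap_form[OF assms] by (intro sum.cong refl) (simp add: algebra_simps)
  then show ?thesis by (simp add: ip_commute)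
qed

lemma wlap_mean_zero: "symw n W \<Longrightarrow> (\<Sum>k<n. wlap n W f k) = 0"
  using wlap_self_adjoint[of n W f "\<lambda>_. 1"] by (simp add: ip_def wlap_const)

text \<open>The form \<open>B\<close> of L - \<mu> is nonnegative on the orthogonal complement of
  \<open>C\<close> and at most 0 at \<open>h\<close>. The residual \<open>r\<close> stays in that
  complement because the elements of \<open>C\<close> are eigenvectors and L is self-adjoint, and a
  small step from \<open>h\<close> against \<open>r\<close> would make the form negative unless
  \<open>r\<close> vanishes.\<close>

lemma rayleigh_minimizer_eigen:
  assumes sym: "symw n W"
    and inv: "\<And>c. c \<in> C \<Longrightarrow> \<exists>r. \<forall>k<n. wlap n W c k = r * c k"
    and min: "\<And>z. orth n C z \<Longrightarrow> \<mu> * ip n z z \<le> ip n (wlap n W z) z"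
    and h: "orth n C h" "ip n (wlap n W h) h \<le> \<mu> * ip n h h"
    and k: "k < n"
  shows "wlap n W h k = \<mu> * h k"
proof -
  define B where "B f g = ip n (wlap n W f) g - \<mu> * ip n f g" for f g
  define r where "r k = wlap n W h k - \<mu> * h k" for k
  have r: "orth n C r"
    unfolding orth_def
  proof
    fix c assume c: "c \<in> C"
    obtain \<rho> where \<rho>: "\<forall>k<n. wlap n W c k = \<rho> * c k" using inv[OF c] by blast
    have "ip n r c = ip n (wlap n W h) c - \<mu> * ip n h c"
      by (simp add: r_def[abs_def] ip_simps)
    also have "ip n (wlap n W h) c = ip n h (\<lambda>k. \<rho> * c k)"
      unfolding wlap_self_adjoint[OF sym] by (rule ip_cong) (use \<rho> in auto)
    also have "\<dots> = \<rho> * ip n h c" by (simp add: ip_simps)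
    finally show "ip n r c = 0" using h(1) c by (simp add: orth_def)
  qed
  have Bhr: "B h r = ip n r r"
    by (simp add: B_def r_def[abs_def] ip_simps)
  have Bhh: "B h h \<le> 0" using h(2) by (simp add: B_def)
  have pos: "0 \<le> B h h + 2 * t * B h r + t\<^sup>2 * B r r" for t
  proof -
    let ?z = "\<lambda>k. h k + t * r k"
    have "orth n C ?z" using h(1) r by (simp add: orth_def ip_simps)
    then have "0 \<le> B ?z ?z" using min by (simp add: B_def)
    also have "wlap n W ?z = (\<lambda>k. wlap n W h k + t * wlap n W r k)"
      by (rule ext) (simp add: wlap_add wlap_scale)
    then have "B ?z ?z = B h h + 2 * t * B h r + t\<^sup>2 * B r r + t * (B r h - B h r)"
      by (simp add: B_def ip_simps ip_commute algebra_simps power2_eq_square)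
    also have "B r h = B h r"
      using wlap_self_adjoint[OF sym, of r h] by (simp add: B_def ip_commute)
    finally show ?thesis by simp
  qed
  have "B h r = 0"
  proof (rule ccontr)
    assume "B h r \<noteq> 0"
    then have p: "B h r > 0" using Bhr ip_nonneg[of n r] by simp
    \<comment> \<open>The step t = - B h r / q minimises 2 t (B h r) + t^2 q; replacing
      \<open>B r r\<close> by a positive upper bound \<open>q\<close> avoids a distinction on its
      sign.\<close>
    define q where "q = \<bar>B r r\<bar> + 1"
    have q: "q > 0" "B r r \<le> q" by (auto simp: q_def)
    have "0 \<le> 2 * (- (B h r / q)) * B h r + (- (B h r / q))\<^sup>2 * q"
    proof -
      have "(- (B h r / q))\<^sup>2 * B r r \<le> (- (B h r / q))\<^sup>2 * q"
        by (rule mult_left_mono) (use q in auto)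
      then show ?thesis using pos[of "- (B h r / q)"] Bhh by linarith
    qed
    also have "\<dots> = - (B h r)\<^sup>2 / q" using q by (simp add: power2_eq_square field_simps)
    finally have "(B h r)\<^sup>2 / q \<le> 0" by simp
    moreover have "(B h r)\<^sup>2 / q > 0" using p q by simp
    ultimately show False by linarith
  qed
  then have "ip n r r = 0" using Bhr by simp
  then show ?thesis using k by (simp add: ip_self_eq_0 r_def)
qed

text \<open>Vectors are functions on all naturals, so entries from \<open>n\<close> on are set to 0.
  The set is then closed in a product of intervals [-1, 1], which is compact by Tychonoff.\<close>

lemma compact_unit_sphere_functions:
  fixes C :: "(nat \<Rightarrow> real) set"
  shows "compact {v. (\<forall>k\<ge>n. v k = 0) \<and> ip n v v = 1 \<and> orth n C v}"
proof -
  define K :: "(nat \<Rightarrow> real) set" where "K = PiE UNIV (\<lambda>_. {-1..1})"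
  have "compactin (product_topology (\<lambda>i::nat. euclidean :: real topology) UNIV) K"
    unfolding K_def compactin_PiE by auto
  then have K: "compact K"
    by (simp add: euclidean_product_topology)
  let ?S = "{v. (\<forall>k\<ge>n. v k = 0) \<and> ip n v v = 1 \<and> orth n C v}"
  have c: "continuous_on UNIV (\<lambda>v::nat \<Rightarrow> real. v k)" for k
    by (rule continuous_on_product_coordinates)
  have cip: "continuous_on UNIV (\<lambda>v::nat \<Rightarrow> real. ip n v v)" 
    unfolding ip_def by (intro continuous_intros c)
  have cip': "continuous_on UNIV (\<lambda>v::nat \<Rightarrow> real. ip n v c)" for c
    unfolding ip_def by (intro continuous_intros c)
  have 1: "closed {v::nat \<Rightarrow> real. v k = 0}" for k
    using continuous_closed_preimage_constant[OF c closed_UNIV, of k 0] by (simp add: Collect_conj_eq)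
  have 2: "closed {v::nat \<Rightarrow> real. ip n v v = 1}"
    using continuous_closed_preimage_constant[OF cip closed_UNIV, of 1] by simp
  have 3: "closed {v::nat \<Rightarrow> real. ip n v c = 0}" for c
    using continuous_closed_preimage_constant[OF cip' closed_UNIV, of c 0] by simp
  have "?S = (\<Inter>k\<in>{n..}. {v. v k = 0}) \<inter> {v. ip n v v = 1} \<inter> (\<Inter>c\<in>C. {v. ip n v c = 0})"
    by (auto simp: orth_def)
  moreover have "closed ((\<Inter>k\<in>{n..}. {v::nat \<Rightarrow> real. v k = 0}) \<inter> {v. ip n v v = 1} \<inter> (\<Inter>c\<in>C. {v. ip n v c = 0}))"
    by (intro closed_Int closed_INT ballI 1 2 3)
  ultimately have "closed ?S" by simp
  moreover have "?S \<subseteq> K"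
  proof
    fix v assume v: "v \<in> ?S"
    have "\<bar>v k\<bar> \<le> 1" for k
    proof (cases "k < n")
      case True
      have "v k * v k \<le> ip n v v" unfolding ip_def
        by (rule member_le_sum[where f="\<lambda>k. v k * v k"]) (use True in auto)
      then have "(v k)\<^sup>2 \<le> 1\<^sup>2" using v by (simp add: power2_eq_square)
      then show ?thesis by (metis abs_le_square_iff abs_one)
    next
      case False then show ?thesis using v by simp
    qed
    then show "v \<in> K" by (auto simp: K_def abs_le_iff intro: minus_le_iff[THEN iffD1])
  qed
  ultimately show ?thesis using compact_Int_closed[OF K, of ?S] by (simp add: inf.absorb2)
qed

text \<open>With \<open>C\<close> consisting of the constant 1 this produces the second eigenpair of
  a Laplacian, with 1 and \<open>u\<close> the one after it, without diagonalising. The vector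
  \<open>z\<close> guarantees that the unit sphere of the complement is nonempty.\<close>

lemma rayleigh_minimizer_exists:
  assumes sym: "symw n W"
    and inv: "\<And>c. c \<in> C \<Longrightarrow> \<exists>r. \<forall>k<n. wlap n W c k = r * c k"
    and z: "orth n C z" "ip n z z > 0"
  obtains v \<mu> where "orth n C v" "ip n v v = 1" "\<And>k. k < n \<Longrightarrow> wlap n W v k = \<mu> * v k"
    "\<And>h. orth n C h \<Longrightarrow> \<mu> * ip n h h \<le> ip n (wlap n W h) h"
proof -
  let ?S = "{v. (\<forall>k\<ge>n. v k = 0) \<and> ip n v v = 1 \<and> orth n C v}"
  have normal: "\<exists>s. (\<lambda>k. if k < n then s * h k else 0) \<in> ?S \<and> s\<^sup>2 * ip n h h = 1"
    if h: "orth n C h" "ip n h h > 0" for h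
  proof -
    define s where "s = 1 / sqrt (ip n h h)"
    let ?v = "\<lambda>k. if k < n then s * h k else 0"
    have s: "s\<^sup>2 * ip n h h = 1" using h(2) by (simp add: s_def power_divide)
    have e: "ip n ?v c = s * ip n h c" for c
      using ip_cong[of n ?v "\<lambda>k. s * h k" c c] by (simp add: ip_simps)
    have "ip n ?v ?v = ip n (\<lambda>k. s * h k) (\<lambda>k. s * h k)" by (rule ip_cong) auto
    then have "ip n ?v ?v = 1" using s by (simp add: ip_simps power2_eq_square)
    then have "?v \<in> ?S" using h e by (auto simp: orth_def)
    then show ?thesis using s by blast
  qed
  have ne: "?S \<noteq> {}" using normal[OF z] by (metis (no_types, lifting) empty_iff)
  have cc: "continuous_on UNIV (\<lambda>v::nat \<Rightarrow> real. v k)" for k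
    by (rule continuous_on_product_coordinates)
  have "continuous_on UNIV (\<lambda>v. ip n (wlap n W v) v)"
    unfolding ip_def wlap_def by (intro continuous_intros cc)
  then have "continuous_on ?S (\<lambda>v. ip n (wlap n W v) v)" by (rule continuous_on_subset) simp
  from continuous_attains_inf[OF compact_unit_sphere_functions ne this]
  obtain v where v: "v \<in> ?S" and vmin: "\<And>y. y \<in> ?S \<Longrightarrow> ip n (wlap n W v) v \<le> ip n (wlap n W y) y"
    by blast
  define \<mu> where "\<mu> = ip n (wlap n W v) v"
  have min: "\<mu> * ip n h h \<le> ip n (wlap n W h) h" if h: "orth n C h" for h
  proof (cases "ip n h h > 0")
    case True
    from normal[OF h this] obtain s where
      s: "(\<lambda>k. if k < n then s * h k else 0) \<in> ?S" "s\<^sup>2 * ip n h h = 1" by blast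
    let ?v = "\<lambda>k. if k < n then s * h k else 0"
    have s2: "s\<^sup>2 > 0" using s(2) by (cases "s = 0") auto
    have wv: "wlap n W ?v k = s * wlap n W h k" if "k < n" for k
      using that by (simp add: wlap_def sum_distrib_left algebra_simps)
    have "ip n (wlap n W ?v) ?v = ip n (\<lambda>k. s * wlap n W h k) (\<lambda>k. s * h k)"
      by (rule ip_cong) (auto simp: wv)
    then have e: "ip n (wlap n W ?v) ?v = s\<^sup>2 * ip n (wlap n W h) h"
      by (simp add: ip_simps power2_eq_square)
    have "\<mu> * (s\<^sup>2 * ip n h h) \<le> s\<^sup>2 * ip n (wlap n W h) h"
      using vmin[OF s(1)] e s(2) \<mu>_def by simp
    then show ?thesis using s2 by (simp add: algebra_simps mult_le_cancel_left_pos)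
  next
    case False
    then have "ip n h h = 0" using ip_nonneg[of n h] by linarith
    then have h0: "\<And>k. k < n \<Longrightarrow> h k = 0" by (simp add: ip_self_eq_0)
    have "ip n (wlap n W h) h = 0" unfolding ip_def by (simp add: h0)
    then show ?thesis using \<open>ip n h h = 0\<close> by simp
  qed
  have "wlap n W v k = \<mu> * v k" if "k < n" for k
    using v by (intro rayleigh_minimizer_eigen[OF sym inv min _ _ that]) (auto simp: \<mu>_def)
  then show thesis using that v min by blast
qed

section \<open>The second smallest root of the characteristic polynomial\<close>

definition gen_lap :: "nat \<Rightarrow> (nat \<Rightarrow> nat \<Rightarrow> real) \<Rightarrow> real mat" where
  "gen_lap n A = mat n n (\<lambda>(a, b). (if a = b then (\<Sum>l<n. A a l) else 0) - A a b)"

lemma gen_lap_carrier [simp]: "gen_lap n A \<in> carrier_mat n n" "dim_row (gen_lap n A) = n" "dim_col (gen_lap n A) = n"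
  by (auto simp: gen_lap_def)

lemma gen_lap_mult_vec:
  assumes "v \<in> carrier_vec n" "k < n"
  shows "(gen_lap n A *\<^sub>v v) $ k = wlap n A (\<lambda>i. v $ i) k"
proof -
  have "(gen_lap n A *\<^sub>v v) $ k = (\<Sum>b<n. ((if k = b then (\<Sum>l<n. A k l) else 0) - A k b) * v $ b)"
    using assms by (simp add: gen_lap_def scalar_prod_def atLeast0LessThan)
  also have "\<dots> = (\<Sum>b<n. (if k = b then (\<Sum>l<n. A k l) * v $ b else 0)) - (\<Sum>b<n. A k b * v $ b)"
    by (simp add: left_diff_distrib sum_subtractf if_distrib[of "\<lambda>x. x * _"] cong: if_cong)
  also have "\<dots> = wlap n A (\<lambda>i. v $ i) k"
    using assms by (simp add: wlap_def right_diff_distrib sum_subtractf sum_distrib_right)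
  finally show ?thesis .
qed

lemma gen_lap_eigenvalue_iff:
  "eigenvector (gen_lap n A) v r \<longleftrightarrow> v \<in> carrier_vec n \<and> v \<noteq> 0\<^sub>v n \<and> (\<forall>k<n. wlap n A (\<lambda>i. v $ i) k = r * v $ k)"
proof -
  have "gen_lap n A *\<^sub>v v = r \<cdot>\<^sub>v v \<longleftrightarrow> (\<forall>k<n. wlap n A (\<lambda>i. v $ i) k = r * v $ k)" if "v \<in> carrier_vec n"
  proof -
    have "gen_lap n A *\<^sub>v v = r \<cdot>\<^sub>v v \<longleftrightarrow> (\<forall>k<n. (gen_lap n A *\<^sub>v v) $ k = (r \<cdot>\<^sub>v v) $ k)"
      using that by (auto simp: vec_eq_iff)
    then show ?thesis using that gen_lap_mult_vec[OF that] by auto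
  qed
  then show ?thesis by (auto simp: eigenvector_def)
qed

lemma vec_nonzero_ip: "v \<in> carrier_vec n \<Longrightarrow> v \<noteq> 0\<^sub>v n \<Longrightarrow> ip n (\<lambda>i. v $ i) (\<lambda>i. v $ i) > 0"
proof -
  assume v: "v \<in> carrier_vec n" "v \<noteq> 0\<^sub>v n"
  then obtain k where k: "k < n" "v $ k \<noteq> 0" by (auto simp: vec_eq_iff)
  then have "ip n (\<lambda>i. v $ i) (\<lambda>i. v $ i) \<noteq> 0" by (auto simp: ip_self_eq_0)
  then show ?thesis using ip_nonneg[of n "\<lambda>i. v $ i"] by linarith
qed

lemma pCons_0_sum: "(\<Sum>i\<in>I. [:f i:]) = [:\<Sum>i\<in>I. f i:]"
  by (induction I rule: infinite_finite_induct) auto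

text \<open>Adding all rows of x I - L to the first one turns that row into (x,\<dots>,x), since the columns
  of L sum to 0. A double root 0 would therefore give a mean-zero kernel vector.\<close>
lemma order_0_char_poly_gen_lap:
  assumes n: "n > 0" and sym: "symw n A"
    and pd: "\<And>h. (\<Sum>k<n. h k) = 0 \<Longrightarrow> ip n h h > 0 \<Longrightarrow> ip n (wlap n A h) h > 0"
  shows "order 0 (char_poly (gen_lap n A)) = 1"
proof -
  let ?L = "gen_lap n A"
  define X :: "real poly" where "X = [:0, 1:]"
  define Q where "Q = char_poly_matrix ?L"
  \<comment> \<open>\<open>E\<close> adds all rows to the first one, \<open>D\<close> takes the
    common factor X out of that row, and \<open>M\<close> is what remains, with first row 1. Both
    \<open>E\<close> and \<open>D\<close> are upper triangular, so their determinants 1 and X can be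
    read off.\<close>
  define E :: "real poly mat" where "E = mat n n (\<lambda>(i, j). if i = 0 \<or> i = j then 1 else 0)"
  define D :: "real poly mat" where "D = mat n n (\<lambda>(i, j). if i = j then (if i = 0 then X else 1) else 0)"
  define M :: "real poly mat" where "M = mat n n (\<lambda>(i, j). if i = 0 then 1 else Q $$ (i, j))"
  have Qc: "Q \<in> carrier_mat n n" by (simp add: Q_def)
  have Qij: "Q $$ (i, j) = (if i = j then X else 0) - [:?L $$ (i, j):]" if "i < n" "j < n" for i j
    using that by (simp add: Q_def char_poly_matrix_def X_def gen_lap_def)
  have colsum: "(\<Sum>i<n. ?L $$ (i, j)) = 0" if "j < n" for j
  proof -
    have "(\<Sum>i<n. ?L $$ (i, j)) = (\<Sum>i<n. (if i = j then (\<Sum>l<n. A i l) else 0)) - (\<Sum>i<n. A i j)"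
      using that by (simp add: gen_lap_def sum_subtractf)
    also have "(\<Sum>i<n. A i j) = (\<Sum>i<n. A j i)"
      using sym that by (intro sum.cong) (auto simp: symw_def)
    finally show ?thesis using that by simp
  qed
  have colQ: "(\<Sum>i<n. Q $$ (i, j)) = X" if j: "j < n" for j
  proof -
    have "(\<Sum>i<n. Q $$ (i, j)) = (\<Sum>i<n. if i = j then X else 0) - (\<Sum>i<n. [:?L $$ (i, j):])"
      using j by (simp add: Qij sum_subtractf)
    also have "(\<Sum>i<n. [:?L $$ (i, j):]) = [:\<Sum>i<n. ?L $$ (i, j):]"
      by (rule pCons_0_sum)
    finally show ?thesis using colsum[OF j] j by simp
  qed
  have "E * Q = D * M"
  proof (rule eq_matI)
    fix i j assume ij: "i < dim_row (D * M)" "j < dim_col (D * M)"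
    then have ij: "i < n" "j < n" by (auto simp: D_def M_def)
    have l: "(E * Q) $$ (i, j) = (\<Sum>k<n. (if i = 0 \<or> i = k then 1 else 0) * Q $$ (k, j))"
      using ij Qc by (simp add: E_def scalar_prod_def atLeast0LessThan)
    have r: "(D * M) $$ (i, j) = (\<Sum>k<n. (if i = k then (if i = 0 then X else 1) else 0) * (if k = 0 then 1 else Q $$ (k, j)))"
      using ij Qc by (simp add: D_def M_def scalar_prod_def atLeast0LessThan)
    also have "\<dots> = (\<Sum>k<n. (if i = k then (if i = 0 then X else 1) * (if k = 0 then 1 else Q $$ (k, j)) else 0))"
      by (intro sum.cong) auto
    also have "\<dots> = (if i = 0 then X else 1) * (if i = 0 then 1 else Q $$ (i, j))"
      using ij by simp
    finally have r: "(D * M) $$ (i, j) = (if i = 0 then X else Q $$ (i, j))" by simp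
    show "(E * Q) $$ (i, j) = (D * M) $$ (i, j)"
    proof (cases "i = 0")
      case True then show ?thesis using l r colQ ij by simp
    next
      case False
      then have "(E * Q) $$ (i, j) = (\<Sum>k<n. if i = k then Q $$ (k, j) else 0)"
        unfolding l by (intro sum.cong) auto
      then show ?thesis using r False ij by simp
    qed
  qed (use Qc in \<open>auto simp: E_def D_def M_def\<close>)
  moreover have "E \<in> carrier_mat n n" "D \<in> carrier_mat n n" "M \<in> carrier_mat n n"
    by (auto simp: E_def D_def M_def)
  ultimately have "det E * det Q = det D * det M" using Qc by (metis det_mult)
  moreover have "det E = 1"
  proof -
    have "det E = prod_list (diag_mat E)"
      by (rule det_upper_triangular[of _ n]) (auto simp: upper_triangular_def E_def)
    also have "diag_mat E = replicate n 1"
      by (rule nth_equalityI) (auto simp: diag_mat_def E_def)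
    finally show ?thesis by simp
  qed
  moreover have "det D = X"
  proof -
    have "det D = prod_list (diag_mat D)"
      by (rule det_upper_triangular[of _ n]) (auto simp: upper_triangular_def D_def)
    also have "diag_mat D = X # replicate (n - 1) 1"
      using n by (intro nth_equalityI) (auto simp: diag_mat_def D_def nth_Cons split: nat.splits)
    finally show ?thesis by simp
  qed
  ultimately have cp: "char_poly ?L = X * det M" by (simp add: char_poly_def Q_def)
  have nz: "poly (det M) 0 \<noteq> 0"
  proof
    assume z: "poly (det M) 0 = 0"
    have h: "comm_ring_hom (\<lambda>p::real poly. poly p 0)" by unfold_locales auto
    let ?M0 = "map_mat (\<lambda>p. poly p 0) M"
    have "det ?M0 = 0" using z comm_ring_hom.hom_det[OF h, of M] by simp
    moreover have M0: "?M0 \<in> carrier_mat n n" by (simp add: M_def)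
    ultimately obtain v where v: "v \<in> carrier_vec n" "v \<noteq> 0\<^sub>v n" "?M0 *\<^sub>v v = 0\<^sub>v n"
      using det_0_iff_vec_prod_zero_field[OF M0] by blast
    have row: "(\<Sum>k<n. poly (M $$ (i, k)) 0 * v $ k) = 0" if "i < n" for i
    proof -
      have "(?M0 *\<^sub>v v) $ i = (\<Sum>k<n. poly (M $$ (i, k)) 0 * v $ k)"
        using that v(1) M0 by (simp add: M_def scalar_prod_def atLeast0LessThan)
      then show ?thesis using v(3) that by simp
    qed
    have s0: "(\<Sum>k<n. v $ k) = 0" using row[OF n] n by (simp add: M_def)
    let ?w = "\<lambda>i. v $ i"
    have w0: "wlap n A ?w i = 0" if i: "i < n" "i \<noteq> 0" for i
    proof -
      have "poly (M $$ (i, k)) 0 = - (?L $$ (i, k))" if "k < n" for k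
        using that i Qij by (simp add: M_def X_def)
      then have "(\<Sum>k<n. - (?L $$ (i, k)) * v $ k) = 0" using row[OF i(1)] by simp
      then have "(\<Sum>k<n. ?L $$ (i, k) * v $ k) = 0" by (simp add: sum_negf)
      moreover have "(?L *\<^sub>v v) $ i = (\<Sum>k<n. ?L $$ (i, k) * v $ k)"
        using i v(1) by (simp add: scalar_prod_def atLeast0LessThan)
      ultimately show ?thesis using gen_lap_mult_vec[OF v(1) i(1)] by simp
    qed
    \<comment> \<open>Row 0 of \<open>M\<close> says that \<open>v\<close> has mean zero and no
      longer records equation 0 of L v = 0. That equation is recovered from the others because the
      entries of L v sum to 0.\<close>
    have "(\<Sum>i<n. wlap n A ?w i) = wlap n A ?w 0 + (\<Sum>i\<in>{..<n} - {0}. wlap n A ?w i)"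
      using n by (intro sum.remove) auto
    then have "wlap n A ?w 0 = 0" using wlap_mean_zero[OF sym, of ?w] w0 by simp
    then have "ip n (wlap n A ?w) ?w = 0"
      unfolding ip_def using w0 by (intro sum.neutral) (metis lessThan_iff mult_zero_left)
    then show False using pd[OF s0 vec_nonzero_ip[OF v(1,2)]] by simp
  qed
  then have "det M \<noteq> 0" by auto
  moreover have "order 0 X = 1" unfolding X_def
    by (metis neg_0_equal_iff_equal order_linear' diff_zero minus_zero)
  moreover have "order 0 (det M) = 0" using nz by (simp add: order_root)
  ultimately show ?thesis unfolding cp X_def
    by (subst order_mult) (auto simp: X_def)
qed

text \<open>Since 0 occurs exactly once and nothing lies below it, index 1 skips precisely the zero
  and hits the smallest positive entry.\<close>

lemma second_smallest_nth:
  fixes xs :: "real list"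
  assumes "sorted xs" "\<And>x. x \<in> set xs \<Longrightarrow> 0 \<le> x" "count (mset xs) 0 = 1" "b \<in> set xs" "b > 0"
  shows "xs ! 1 \<in> set xs \<and> 0 < xs ! 1 \<and> xs ! 1 \<le> b"
proof (cases xs)
  case Nil then show ?thesis using assms by simp
next
  case (Cons x ys)
  have "0 \<in> set xs" using assms(3) by (metis count_eq_zero_iff set_mset_mset zero_neq_one)
  then have "x \<le> 0" "0 \<le> x" using assms(1,2) Cons by auto
  then have x: "x = 0" by simp
  then have ys: "0 \<notin> set ys" "b \<in> set ys" using assms(3-5) Cons by (auto simp: count_eq_zero_iff)
  then obtain y zs where y: "ys = y # zs" by (cases ys) auto
  then have "y \<le> b" using assms(1) Cons ys by auto
  moreover have "0 < y" using ys y assms(2)[of y] Cons by (auto simp: less_le)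
  ultimately show ?thesis using Cons y by simp
qed

text \<open>The minimiser over mean-zero vectors is an eigenvector for some m > 0, hence a root; as
  0 is a simple root and no root is negative, the entry at index 1 lies in (0, m], and m is below
  every Rayleigh quotient. Positivity and this upper bound are all that the perturbation argument
  asks of the sampled eigenvalue.\<close>

lemma second_eigenvalue_gen_lap:
  assumes n: "n > 1" and sym: "symw n A" and nonneg: "\<And>k l. 0 \<le> A k l"
    and pd: "\<And>h. (\<Sum>k<n. h k) = 0 \<Longrightarrow> ip n h h > 0 \<Longrightarrow> ip n (wlap n A h) h > 0"
  defines "r \<equiv> sorted_list_of_multiset (proots (char_poly (gen_lap n A))) ! 1"
  shows "0 < r" and "(\<Sum>k<n. u k) = 0 \<Longrightarrow> r * ip n u u \<le> ip n (wlap n A u) u"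
proof -
  let ?p = "char_poly (gen_lap n A)"
  let ?xs = "sorted_list_of_multiset (proots ?p)"
  have p0: "?p \<noteq> 0"
    using degree_monic_char_poly[of "gen_lap n A" n] n by auto
  have eig: "x \<in> set ?xs \<longleftrightarrow> eigenvalue (gen_lap n A) x" for x
    using eigenvalue_root_char_poly[of "gen_lap n A" n x] p0 by simp
  have o: "orth n {\<lambda>_. 1} h \<longleftrightarrow> (\<Sum>k<n. h k) = 0" for h
    by (simp add: orth_def ip_def)
  let ?z = "\<lambda>k::nat. if k = 0 then 1 else if k = 1 then -1 else (0::real)"
  have z0: "(\<Sum>k<n. ?z k) = 0"
  proof -
    have "(\<Sum>k<n. ?z k) = (\<Sum>k\<in>{0,1}. ?z k)"
      using n by (intro sum.mono_neutral_right) auto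
    then show ?thesis by simp
  qed
  have "ip n ?z ?z \<noteq> 0" unfolding ip_self_eq_0 using n by (auto intro!: exI[of _ 0])
  then have zp: "ip n ?z ?z > 0" using ip_nonneg[of n ?z] by linarith
  have z0': "orth n {\<lambda>_. 1} ?z" using z0 o by blast
  have cinv: "\<exists>r. \<forall>k<n. wlap n A c k = r * c k" if "c \<in> {\<lambda>_. 1}" for c
    using that by (auto simp: wlap_const intro: exI[of _ 0])
  obtain v m where v: "orth n {\<lambda>_. 1} v" "ip n v v = 1" "\<And>k. k < n \<Longrightarrow> wlap n A v k = m * v k"
    "\<And>h. orth n {\<lambda>_. 1} h \<Longrightarrow> m * ip n h h \<le> ip n (wlap n A h) h"
    using rayleigh_minimizer_exists[OF sym cinv z0' zp] by blast
  have "ip n (wlap n A v) v = ip n (\<lambda>k. m * v k) v"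
    by (rule ip_cong) (use v in auto)
  then have m: "m > 0" using pd[of v] v(1,2) o by (simp add: ip_simps)
  have "eigenvector (gen_lap n A) (vec n v) m"
  proof -
    have "vec n v \<noteq> 0\<^sub>v n"
    proof
      assume "vec n v = 0\<^sub>v n"
      then have "\<forall>k<n. v k = 0" by (metis index_vec index_zero_vec(1))
      then have "ip n v v = 0" by (simp add: ip_self_eq_0)
      then show False using v(2) by simp
    qed
    moreover have "wlap n A (\<lambda>i. vec n v $ i) k = wlap n A v k" if "k < n" for k
      using that by (simp add: wlap_def)
    ultimately show ?thesis unfolding gen_lap_eigenvalue_iff using v(3) by auto
  qed
  then have mset: "m \<in> set ?xs" unfolding eig eigenvalue_def by blast
  have nn: "0 \<le> x" if x: "x \<in> set ?xs" for x
  proof -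
    obtain w where w: "eigenvector (gen_lap n A) w x" using x unfolding eig eigenvalue_def by blast
    let ?w = "\<lambda>i. w $ i"
    have w': "w \<in> carrier_vec n" "w \<noteq> 0\<^sub>v n" "\<forall>k<n. wlap n A ?w k = x * ?w k"
      using w by (auto simp: gen_lap_eigenvalue_iff)
    have "ip n (wlap n A ?w) ?w = ip n (\<lambda>k. x * ?w k) ?w"
      by (rule ip_cong) (use w' in auto)
    then have "ip n (wlap n A ?w) ?w = x * ip n ?w ?w" by (simp add: ip_simps)
    moreover have "0 \<le> 2 * ip n (wlap n A ?w) ?w"
      unfolding wlap_form[OF sym] using nonneg
      by (intro sum_nonneg) (auto simp: mult.assoc simp flip: power2_eq_square)
    ultimately show ?thesis using vec_nonzero_ip[OF w'(1,2)] by (simp add: zero_le_mult_iff)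
  qed
  have "count (mset ?xs) 0 = 1"
    using order_0_char_poly_gen_lap[OF _ sym pd] n p0 by simp
  from second_smallest_nth[OF _ nn this mset m]
  have r: "0 < r" "r \<le> m" by (auto simp: r_def)
  then show "0 < r" by simp
  show "r * ip n u u \<le> ip n (wlap n A u) u" if "(\<Sum>k<n. u k) = 0"
  proof -
    have "r * ip n u u \<le> m * ip n u u" using r ip_nonneg by (intro mult_right_mono) auto
    then show ?thesis using v(4)[of u] that o by simp
  qed
qed

section \<open>The expected Laplacian\<close>

text \<open>\<open>R_slope\<close> asks for a definite slope only away from 0 and 1, since the
  derivative of R may vanish at either end. Arguments that use it must keep all distances inside
  [\<theta>, 1 - \<theta>].\<close>

locale profile =
  fixes R :: "real \<Rightarrow> real" and C1 :: real
  assumes R_pos: "0 \<le> t \<Longrightarrow> t \<le> 1 \<Longrightarrow> 0 < R t"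
    and R_le_1: "0 \<le> t \<Longrightarrow> t \<le> 1 \<Longrightarrow> R t \<le> 1"
    and C1_pos: "0 < C1"
    and R_lip: "0 \<le> a \<Longrightarrow> a \<le> b \<Longrightarrow> b \<le> 1 \<Longrightarrow> R a - R b \<le> C1 * (b - a)"
    and R_less: "0 \<le> a \<Longrightarrow> a < b \<Longrightarrow> b \<le> 1 \<Longrightarrow> R b < R a"
    and R_slope: "0 < \<theta> \<Longrightarrow> \<exists>m>0. \<forall>a b. \<theta> \<le> a \<and> a \<le> b \<and> b \<le> 1 - \<theta> \<longrightarrow> m * (b - a) \<le> R a - R b"

text \<open>Models the positions of the vertices of a set in increasing order. The tolerance \<eta>
  will be a small constant rather than o(1), so that all spectral constants are uniform in
  \<open>n\<close>.\<close>

definition points :: "nat \<Rightarrow> (nat \<Rightarrow> real) \<Rightarrow> real \<Rightarrow> bool" where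
  "points n x \<eta> \<longleftrightarrow> (\<forall>k<n. 0 \<le> x k \<and> x k \<le> 1 \<and> \<bar>x k - real k / real n\<bar> \<le> \<eta>) \<and>
     (\<forall>k<n. \<forall>l<n. k < l \<longrightarrow> x k < x l)"

definition kern :: "(real \<Rightarrow> real) \<Rightarrow> (nat \<Rightarrow> real) \<Rightarrow> nat \<Rightarrow> nat \<Rightarrow> real" where
  "kern R x k l = R \<bar>x k - x l\<bar>"

lemma symw_kern: "symw n (kern R x)"
  by (simp add: symw_def kern_def abs_minus_commute)

lemma sum_lessThan_split:
  fixes g :: "nat \<Rightarrow> real"
  assumes "k < n"
  shows "(\<Sum>i<n. g i) = (\<Sum>i<Suc k. g i) + (\<Sum>i\<in>{Suc k..<n}. g i)"
proof -
  have "{..<n} = {..<Suc k} \<union> {Suc k..<n}" using assms by auto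
  then have "sum g {..<n} = sum g ({..<Suc k} \<union> {Suc k..<n})" by (rule arg_cong)
  also have "\<dots> = (\<Sum>i<Suc k. g i) + (\<Sum>i\<in>{Suc k..<n}. g i)"
    by (rule sum.union_disjoint) auto
  finally show ?thesis .
qed

section \<open>Degrees of the expected graph and their distance from \<mu>\<close>

context profile
begin

lemma R_mono: "0 \<le> a \<Longrightarrow> a \<le> b \<Longrightarrow> b \<le> 1 \<Longrightarrow> R b \<le> R a"
  using R_less[of a b] by (cases "a = b") auto

lemma R_lip_abs: 
  assumes "0 \<le> a" "a \<le> 1" "0 \<le> b" "b \<le> 1"
  shows "\<bar>R a - R b\<bar> \<le> C1 * \<bar>a - b\<bar>"
proof (cases "a \<le> b")
  case True
  then show ?thesis using R_lip[of a b] R_mono[of a b] assms by (simp add: abs_if)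
next
  case False
  then show ?thesis using R_lip[of b a] R_mono[of b a] assms by (simp add: abs_if)
qed

text \<open>Splitting at \<open>k\<close> collects the distances to the left and to the right;
  distance 0 is then counted twice, hence the final \<open>- R 0\<close>.\<close>

lemma grid_degree:
  assumes "k < n"
  shows "(\<Sum>l<n. R \<bar>real k / real n - real l / real n\<bar>) =
    (\<Sum>i<Suc k. R (real i / real n)) + (\<Sum>i<n - k. R (real i / real n)) - R 0"
proof -
  let ?r = "\<lambda>i. R (real i / real n)"
  have e: "R \<bar>real k / real n - real l / real n\<bar> = ?r (if l \<le> k then k - l else l - k)" for l
  proof -
    have "\<bar>real k / real n - real l / real n\<bar> = \<bar>real k - real l\<bar> / real n"
      by (simp flip: diff_divide_distrib)
    then show ?thesis by (auto simp: of_nat_diff)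
  qed
  have "(\<Sum>l<n. R \<bar>real k / real n - real l / real n\<bar>) = (\<Sum>l<n. ?r (if l \<le> k then k - l else l - k))"
    unfolding e ..
  also have "\<dots> = (\<Sum>l<Suc k. ?r (if l \<le> k then k - l else l - k)) + (\<Sum>l\<in>{Suc k..<n}. ?r (if l \<le> k then k - l else l - k))"
  by (rule sum_lessThan_split[OF assms])
  also have "(\<Sum>l<Suc k. ?r (if l \<le> k then k - l else l - k)) = (\<Sum>l<Suc k. ?r (Suc k - Suc l))"
    by (intro sum.cong) auto
  also have "\<dots> = (\<Sum>i<Suc k. ?r i)" by (rule sum.nat_diff_reindex)
  also have "(\<Sum>l\<in>{Suc k..<n}. ?r (if l \<le> k then k - l else l - k)) = (\<Sum>l\<in>{Suc k..<n}. ?r (l - k))"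
    by (intro sum.cong) auto
  also have "\<dots> = (\<Sum>i\<in>{1..<n - k}. ?r i)"
    by (rule sum.reindex_bij_witness[of _ "\<lambda>i. i + k" "\<lambda>l. l - k"]) auto
  also have "\<dots> = (\<Sum>i<n - k. ?r i) - R 0"
  proof -
    have "{..<n - k} = insert 0 {1..<n - k}" using assms by auto
    then have "sum ?r {..<n - k} = sum ?r (insert 0 {1..<n - k})" by (rule arg_cong)
    also have "\<dots> = ?r 0 + sum ?r {1..<n - k}" by (rule sum.insert) auto
    finally show ?thesis by simp
  qed
  finally show ?thesis by simp
qed

text \<open>A step inwards from \<open>j\<close> replaces the distance n - 1 - j by j + 1 and so
  gains at most R 0 - R 1. The end vertex sees the largest distances and has the least degree; the
  last claim is reflection.\<close>

lemma grid_degree_bounds: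
  assumes "k < n"
  defines "D \<equiv> \<lambda>k. (\<Sum>i<Suc k. R (real i / real n)) + (\<Sum>i<n - k. R (real i / real n)) - R 0"
  shows "D 0 \<le> D k" "D k \<le> D 0 + real k * (R 0 - R 1)" "D (n - 1 - k) = D k"
proof -
  let ?r = "\<lambda>i. R (real i / real n)"
  have n: "n > 0" using assms by simp
  have sp: "(\<Sum>i<n. ?r i) = (\<Sum>i<Suc k. ?r i) + (\<Sum>i<n - k - 1. ?r (i + Suc k))"
  proof -
    have "(\<Sum>i<n. ?r i) = (\<Sum>i<Suc k. ?r i) + (\<Sum>i\<in>{Suc k..<n}. ?r i)"
    by (rule sum_lessThan_split[OF assms(1)])
    also have "(\<Sum>i\<in>{Suc k..<n}. ?r i) = (\<Sum>i<n - k - 1. ?r (i + Suc k))"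
      by (rule sum.reindex_bij_witness[of _ "\<lambda>i. i + Suc k" "\<lambda>l. l - Suc k"]) auto
    finally show ?thesis .
  qed
  have s2: "(\<Sum>i<n - k. ?r i) = R 0 + (\<Sum>i<n - k - 1. ?r (Suc i))"
  proof -
    obtain p where "n - k = Suc p" using assms(1) by (metis Suc_diff_Suc)
    then show ?thesis by (simp add: sum.lessThan_Suc_shift del: sum.lessThan_Suc)
  qed
  have "(\<Sum>i<n - k - 1. ?r (i + Suc k)) \<le> (\<Sum>i<n - k - 1. ?r (Suc i))"
    using assms by (intro sum_mono R_mono) (auto simp: field_simps)
  then show "D 0 \<le> D k" using sp s2 by (simp add: D_def)
  have "D j \<le> D 0 + real j * (R 0 - R 1)" if "j \<le> k" for j
    using that
  proof (induction j)
    case 0 then show ?case by simp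
  next
    case (Suc j)
    have j: "Suc j < n" using Suc assms by simp
    have "(\<Sum>i<n - j. ?r i) = (\<Sum>i<n - Suc j. ?r i) + ?r (n - Suc j)"
    proof -
      have "n - j = Suc (n - Suc j)" using j by simp
      then show ?thesis by (simp only: sum.lessThan_Suc)
    qed
    then have "D (Suc j) = D j + ?r (Suc j) - ?r (n - Suc j)" by (simp add: D_def)
    moreover have "?r (Suc j) \<le> R 0" "R 1 \<le> ?r (n - Suc j)"
      using j n by (auto intro!: R_mono simp: field_simps)
    ultimately show ?case using Suc by (simp add: algebra_simps)
  qed
  then show "D k \<le> D 0 + real k * (R 0 - R 1)" by simp
  show "D (n - 1 - k) = D k"
  proof -
    have "Suc (n - 1 - k) = n - k" "n - (n - 1 - k) = Suc k" using assms(1) by auto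
    then show ?thesis unfolding D_def by (simp only: add.commute)
  qed
qed

lemma sum_pairs_sq: "(\<Sum>k<n. \<Sum>l<n. (f k - f l)\<^sup>2) = 2 * (real n * ip n f f - (\<Sum>k<n. f k)\<^sup>2)"
  for f :: "nat \<Rightarrow> real"
proof -
  have "(\<Sum>k<n. \<Sum>l<n. (f k - f l)\<^sup>2) = (\<Sum>k<n. \<Sum>l<n. f k * f k) + (\<Sum>k<n. \<Sum>l<n. f l * f l) - 2 * (\<Sum>k<n. \<Sum>l<n. f k * f l)"
    by (simp add: power2_diff sum.distrib sum_subtractf power2_eq_square sum_distrib_left algebra_simps)
  also have "(\<Sum>k<n. \<Sum>l<n. f k * f l) = (\<Sum>k<n. f k)\<^sup>2"
    by (simp add: power2_eq_square sum_product)
  finally show ?thesis by (simp add: ip_def sum_distrib_left algebra_simps)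
qed

text \<open>Moves a Rayleigh quotient from the regular grid to the actual points: an entrywise error
  \<delta> changes the form by at most \<delta> times the form of the complete graph.\<close>

lemma wlap_form_perturb:
  assumes "symw n V" "symw n W" "\<And>k l. k < n \<Longrightarrow> l < n \<Longrightarrow> \<bar>V k l - W k l\<bar> \<le> \<delta>" "\<delta> \<ge> 0"
  shows "ip n (wlap n V f) f \<le> ip n (wlap n W f) f + \<delta> * real n * ip n f f"
proof -
  have "2 * ip n (wlap n V f) f - 2 * ip n (wlap n W f) f
      = (\<Sum>k<n. \<Sum>l<n. (V k l - W k l) * (f k - f l)\<^sup>2)"
    unfolding wlap_form[OF assms(1)] wlap_form[OF assms(2)]
    by (simp add: algebra_simps power2_eq_square flip: sum_subtractf)
  also have "\<dots> \<le> (\<Sum>k<n. \<Sum>l<n. \<delta> * (f k - f l)\<^sup>2)"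
  proof (intro sum_mono mult_right_mono)
    fix k l assume "k \<in> {..<n}" "l \<in> {..<n}"
    then show "V k l - W k l \<le> \<delta>" using assms(3)[of k l] by simp
  qed simp
  also have "\<dots> = \<delta> * (2 * (real n * ip n f f - (\<Sum>k<n. f k)\<^sup>2))"
    by (simp add: sum_pairs_sq flip: sum_distrib_left)
  also have "\<dots> \<le> \<delta> * (2 * (real n * ip n f f))"
    using assms(4) by (intro mult_left_mono) auto
  finally show ?thesis by (simp add: algebra_simps)
qed

text \<open>The factor 3/4 in the hypothesis beats the loss of at most m/2 (R 0 - R 1) that comes from the
  degrees of the first m points being larger than that of the first point.\<close>
lemma test_function_rayleigh:
  assumes m: "0 < m" "2 * m \<le> n" and e: "real m \<le> e * real n" "e \<le> 1 / 4"
    and gain: "3 / 4 * (R 0 - R 1) \<le> R e - R (1 - 2 * e)"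
  defines "W \<equiv> kern R (\<lambda>k. real k / real n)"
    and "f \<equiv> \<lambda>k. if k < m then 1 else if n - m \<le> k then -1 else (0::real)"
    and "D0 \<equiv> (\<Sum>i<n. R (real i / real n))"
  shows "(\<Sum>k<n. f k) = 0" "ip n f f = 2 * real m"
    "ip n (wlap n W f) f \<le> (D0 - real m * (R 0 - R 1) / 4) * ip n f f"
proof -
  have n: "n > 0" using m by simp
  define A where "A = {..<m}"
  define B where "B = {n - m..<n}"
  have AB: "A \<inter> B = {}" "A \<union> B \<subseteq> {..<n}" "card A = m" "card B = m" "finite A" "finite B"
    using m by (auto simp: A_def B_def)
  have sumf: "(\<Sum>k<n. g k * f k) = (\<Sum>k\<in>A. g k) - (\<Sum>k\<in>B. g k)" for g :: "nat \<Rightarrow> real"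
  proof -
    have "(\<Sum>k<n. g k * f k) = (\<Sum>k\<in>A \<union> B. g k * f k)"
      using AB(2) by (intro sum.mono_neutral_right) (auto simp: f_def A_def B_def)
    also have "\<dots> = (\<Sum>k\<in>A. g k * f k) + (\<Sum>k\<in>B. g k * f k)"
      using AB by (intro sum.union_disjoint) auto
    also have "(\<Sum>k\<in>A. g k * f k) = (\<Sum>k\<in>A. g k)" by (intro sum.cong) (auto simp: f_def A_def)
    also have "(\<Sum>k\<in>B. g k * f k) = - (\<Sum>k\<in>B. g k)"
      unfolding sum_negf[symmetric] using m by (intro sum.cong) (auto simp: f_def B_def)
    finally show ?thesis by simp
  qed
  show "(\<Sum>k<n. f k) = 0" using sumf[of "\<lambda>_. 1"] AB by simp
  show iff: "ip n f f = 2 * real m"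
  proof -
    have "ip n f f = (\<Sum>k\<in>A. f k) - (\<Sum>k\<in>B. f k)" unfolding ip_def by (rule sumf)
    also have "(\<Sum>k\<in>A. f k) = real m" using AB by (simp add: f_def A_def)
    also have "(\<Sum>k\<in>B. f k) = (\<Sum>k\<in>B. -1)" using m by (intro sum.cong) (auto simp: f_def B_def)
    finally show ?thesis using AB by simp
  qed
  define D where "D k = (\<Sum>i<Suc k. R (real i / real n)) + (\<Sum>i<n - k. R (real i / real n)) - R 0" for k
  have D0: "D0 = D 0" by (simp add: D_def D0_def)
  have wl: "wlap n W f k = D k * f k - ((\<Sum>l\<in>A. W k l) - (\<Sum>l\<in>B. W k l))" if "k < n" for k
  proof -
    have "wlap n W f k = (\<Sum>l<n. W k l) * f k - (\<Sum>l<n. W k l * f l)"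
      by (simp add: wlap_def right_diff_distrib sum_subtractf sum_distrib_right)
    also have "(\<Sum>l<n. W k l) = D k"
      unfolding W_def kern_def D_def by (rule grid_degree[OF that])
    finally show ?thesis by (simp add: sumf)
  qed
  have near: "R e \<le> W k l" if "k \<in> A \<and> l \<in> A \<or> k \<in> B \<and> l \<in> B" for k l
  proof -
    have "\<bar>real k - real l\<bar> \<le> real m" using that m by (auto simp: A_def B_def)
    then have "\<bar>real k - real l\<bar> \<le> e * real n" using e by simp
    then have "\<bar>real k / real n - real l / real n\<bar> \<le> e"
      using n by (simp add: field_simps flip: diff_divide_distrib)
    then show ?thesis unfolding W_def kern_def using e by (intro R_mono) auto
  qed
  have far: "W k l \<le> R (1 - 2 * e)" if "k \<in> A \<and> l \<in> B \<or> k \<in> B \<and> l \<in> A" for k l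
  proof -
    have kl: "k < n" "l < n" using that AB by auto
    have "real n - 2 * real m \<le> \<bar>real k - real l\<bar>" using that m by (auto simp: A_def B_def)
    then have "(1 - 2 * e) * real n \<le> \<bar>real k - real l\<bar>" using e by (simp add: algebra_simps)
    then have "1 - 2 * e \<le> \<bar>real k / real n - real l / real n\<bar>"
      using n by (simp add: field_simps flip: diff_divide_distrib)
    moreover have "\<bar>real k / real n - real l / real n\<bar> \<le> 1"
      using kl by (simp add: field_simps abs_le_iff flip: diff_divide_distrib)
    ultimately show ?thesis unfolding W_def kern_def using e by (intro R_mono) auto
  qed
  let ?\<Delta> = "R 0 - R 1"
  have \<Delta>: "?\<Delta> \<ge> 0" using R_less[of 0 1] by simp
  have bd: "wlap n W f k \<le> D0 + real k * ?\<Delta> - 3/4 * real m * ?\<Delta>" if k: "k \<in> A" for k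
  proof -
    have kn: "k < n" using k AB by auto
    have fk: "f k = 1" using k by (simp add: f_def A_def)
    have "real m * R e \<le> (\<Sum>l\<in>A. W k l)"
      using sum_bounded_below[of A "R e" "W k"] near k AB by simp
    moreover have "(\<Sum>l\<in>B. W k l) \<le> real m * R (1 - 2 * e)"
      using sum_bounded_above[of B "W k" "R (1 - 2 * e)"] far k AB by simp
    moreover have "real m * (3 / 4 * ?\<Delta>) \<le> real m * (R e - R (1 - 2 * e))"
      using gain by (intro mult_left_mono) auto
    moreover have "D k \<le> D0 + real k * ?\<Delta>"
      unfolding D0 D_def using grid_degree_bounds(2)[OF kn] by simp
    ultimately show ?thesis unfolding wl[OF kn] fk by (simp add: algebra_simps)
  qed
  have bd': "- wlap n W f k \<le> D0 + real (n - 1 - k) * ?\<Delta> - 3/4 * real m * ?\<Delta>" if k: "k \<in> B" for k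
  proof -
    have kn: "k < n" using k AB by auto
    have "n - m \<le> k" using k by (simp add: B_def)
    moreover from this have "m \<le> k" using m by linarith
    ultimately have fk: "f k = -1" by (simp add: f_def)
    have "real m * R e \<le> (\<Sum>l\<in>B. W k l)"
      using sum_bounded_below[of B "R e" "W k"] near k AB by simp
    moreover have "(\<Sum>l\<in>A. W k l) \<le> real m * R (1 - 2 * e)"
      using sum_bounded_above[of A "W k" "R (1 - 2 * e)"] far k AB by simp
    moreover have "real m * (3 / 4 * ?\<Delta>) \<le> real m * (R e - R (1 - 2 * e))"
      using gain by (intro mult_left_mono) auto
    moreover have "D k \<le> D0 + real (n - 1 - k) * ?\<Delta>"
    proof -
      have kn': "n - 1 - k < n" using n by simp
      have "D (n - 1 - k) = D k"
        unfolding D_def using grid_degree_bounds(3)[OF kn] by simp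
      then show ?thesis
        unfolding D0 using grid_degree_bounds(2)[OF kn'] by (simp add: D_def)
    qed
    ultimately show ?thesis unfolding wl[OF kn] fk by (simp add: algebra_simps)
  qed
  have tri: "(\<Sum>k<m. real k) \<le> real m * real m / 2"
    by (induction m) (auto simp: field_simps)
  have "(\<Sum>k\<in>A. wlap n W f k) \<le> (\<Sum>k\<in>A. D0 + real k * ?\<Delta> - 3/4 * real m * ?\<Delta>)"
    by (intro sum_mono bd)
  also have "\<dots> = real m * D0 + (\<Sum>k<m. real k) * ?\<Delta> - 3/4 * real m * real m * ?\<Delta>"
    using AB by (simp add: sum.distrib sum_subtractf sum_distrib_right A_def)
  finally have 1: "(\<Sum>k\<in>A. wlap n W f k) \<le> real m * D0 + (\<Sum>k<m. real k) * ?\<Delta> - 3/4 * real m * real m * ?\<Delta>" .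
  have "(\<Sum>k\<in>B. - wlap n W f k) \<le> (\<Sum>k\<in>B. D0 + real (n - 1 - k) * ?\<Delta> - 3/4 * real m * ?\<Delta>)"
    by (intro sum_mono bd')
  also have "\<dots> = real m * D0 + (\<Sum>k\<in>B. real (n - 1 - k)) * ?\<Delta> - 3/4 * real m * real m * ?\<Delta>"
    using AB by (simp add: sum.distrib sum_subtractf sum_distrib_right)
  also have "(\<Sum>k\<in>B. real (n - 1 - k)) = (\<Sum>k<m. real k)"
    using m by (intro sum.reindex_bij_witness[of _ "\<lambda>i. n - 1 - i" "\<lambda>i. n - 1 - i"]) (auto simp: B_def)
  finally have 2: "- (\<Sum>k\<in>B. wlap n W f k) \<le> real m * D0 + (\<Sum>k<m. real k) * ?\<Delta> - 3/4 * real m * real m * ?\<Delta>"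
    by (simp add: sum_negf)
  have "ip n (wlap n W f) f = (\<Sum>k\<in>A. wlap n W f k) - (\<Sum>k\<in>B. wlap n W f k)"
    unfolding ip_def by (rule sumf)
  also have "\<dots> \<le> 2 * (real m * D0 + (\<Sum>k<m. real k) * ?\<Delta> - 3/4 * real m * real m * ?\<Delta>)"
    using 1 2 by simp
  also have "\<dots> \<le> 2 * (real m * D0 + real m * real m / 2 * ?\<Delta> - 3/4 * real m * real m * ?\<Delta>)"
    using mult_right_mono[OF tri \<Delta>] by simp
  also have "\<dots> = (D0 - real m * ?\<Delta> / 4) * ip n f f"
    unfolding iff by (simp add: field_simps)
  finally show "ip n (wlap n W f) f \<le> (D0 - real m * ?\<Delta> / 4) * ip n f f" .
qed

text \<open>On the exact grid the least degree is the end degree \<open>D0\<close>, and the test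
  function pushes \<mu> below \<open>D0\<close> by order n. A tolerance in the points that is small
  but independent of n takes away only part of this.\<close>

lemma degree_gap:
  obtains \<eta>0 c0 n0 where "\<eta>0 > 0" "c0 > 0"
    "\<And>n x \<mu> k. n \<ge> n0 \<Longrightarrow> points n x \<eta>0 \<Longrightarrow> k < n \<Longrightarrow>
       (\<And>h. (\<Sum>k<n. h k) = 0 \<Longrightarrow> \<mu> * ip n h h \<le> ip n (wlap n (kern R x) h) h) \<Longrightarrow>
       \<mu> + c0 * real n \<le> (\<Sum>l<n. kern R x k l)"
proof -
  define d where "d = R 0 - R 1"
  have d: "d > 0" using R_less[of 0 1] by (simp add: d_def)
  \<comment> \<open>Replacing R 0 - R 1 by R e - R (1 - 2 e) loses at most C1 e + 2 C1 e, and this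
    \<open>e\<close> makes 3 C1 e at most d / 4.\<close>
  define e where "e = min (1/4) (d / (12 * C1))"
  have e: "0 < e" "e \<le> 1/4" "e \<le> d / (12 * C1)" using d C1_pos by (auto simp: e_def)
  have gain: "3 / 4 * (R 0 - R 1) \<le> R e - R (1 - 2 * e)"
  proof -
    have "R 0 - R e \<le> C1 * (e - 0)" using e by (intro R_lip) auto
    moreover have "R (1 - 2 * e) - R 1 \<le> C1 * (1 - (1 - 2 * e))" using e by (intro R_lip) auto
    moreover have "12 * C1 * e \<le> d" using e(3) C1_pos by (simp add: field_simps)
    ultimately show ?thesis by (simp add: d_def)
  qed
  \<comment> \<open>The tolerance costs e d n / 32 in the quadratic form and again in the degrees.
    Of the gain e d n / 8 of the test function there remains e d n / 16, which is \<open>c0\<close>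
    n.\<close>
  define \<eta>0 where "\<eta>0 = e * d / (64 * C1)"
  define c0 where "c0 = e * d / 16"
  define n0 where "n0 = nat \<lceil>2 / e\<rceil> + 1"
  show thesis
  proof (rule that[of \<eta>0 c0 n0])
    show "\<eta>0 > 0" "c0 > 0" using e d C1_pos by (auto simp: \<eta>0_def c0_def)
    fix n x \<mu> k
    assume n: "n \<ge> n0" and x: "points n x \<eta>0" and k: "k < n"
      and min: "\<And>h. (\<Sum>k<n. h k) = 0 \<Longrightarrow> \<mu> * ip n h h \<le> ip n (wlap n (kern R x) h) h"
    have n2: "2 / e \<le> real n" using n by (simp add: n0_def) linarith
    then have en: "2 \<le> e * real n" using e by (simp add: field_simps)
    define m where "m = nat \<lfloor>e * real n\<rfloor>"
    have m: "real m \<le> e * real n" "e * real n - 1 \<le> real m" using en by (auto simp: m_def) 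
    have m0: "0 < m" using en m by linarith
    have "real (2 * m) \<le> real n"
    proof -
      have "e * real n \<le> 1/4 * real n" using e by (intro mult_right_mono) auto
      then show ?thesis using m by simp
    qed
    then have m2: "2 * m \<le> n" by (simp only: of_nat_le_iff)
    let ?V = "kern R (\<lambda>k. real k / real n)" and ?W = "kern R x"
    define f where "f = (\<lambda>k. if k < m then 1 else if n - m \<le> k then -1 else (0::real))"
    define D0 where "D0 = (\<Sum>i<n. R (real i / real n))"
    note t = test_function_rayleigh[OF m0 m2 m(1) e(2) gain, folded f_def D0_def]
    define \<delta> where "\<delta> = 2 * C1 * \<eta>0"
    have \<delta>: "\<delta> \<ge> 0" "\<delta> = e * d / 32" using e d C1_pos by (auto simp: \<delta>_def \<eta>0_def)
    have VW: "\<bar>?W k l - ?V k l\<bar> \<le> \<delta>" if "k < n" "l < n" for k l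
    proof -
      have xx: "0 \<le> x k" "x k \<le> 1" "0 \<le> x l" "x l \<le> 1" "\<bar>x k - real k / real n\<bar> \<le> \<eta>0" "\<bar>x l - real l / real n\<bar> \<le> \<eta>0"
        using x that by (auto simp: points_def)
      have kk: "0 \<le> real k / real n" "real k / real n \<le> 1" "0 \<le> real l / real n" "real l / real n \<le> 1"
        using that by auto
      have "\<bar>?W k l - ?V k l\<bar> \<le> C1 * \<bar>\<bar>x k - x l\<bar> - \<bar>real k / real n - real l / real n\<bar>\<bar>"
        unfolding kern_def
      proof (rule R_lip_abs)
        show "\<bar>x k - x l\<bar> \<le> 1" using xx by linarith
        show "\<bar>real k / real n - real l / real n\<bar> \<le> 1" using kk by linarith
      qed auto
      also have "\<dots> \<le> C1 * (2 * \<eta>0)"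
        using xx C1_pos by (intro mult_left_mono) auto
      finally show ?thesis by (simp add: \<delta>_def)
    qed
    have fpos: "ip n f f > 0" using t(2) m0 by simp
    have "\<mu> * ip n f f \<le> ip n (wlap n ?W f) f" by (rule min[OF t(1)])
    also have "\<dots> \<le> ip n (wlap n ?V f) f + \<delta> * real n * ip n f f"
      by (rule wlap_form_perturb[OF symw_kern symw_kern VW \<delta>(1)])
    also have "\<dots> \<le> (D0 - real m * d / 4 + \<delta> * real n) * ip n f f"
      using t(3) by (simp add: d_def algebra_simps)
    finally have mu: "\<mu> \<le> D0 - real m * d / 4 + \<delta> * real n" using fpos by (simp only: mult_le_cancel_right_pos)
    have "e * real n / 2 \<le> real m" using m en by linarith
    then have "e * real n / 2 * d \<le> real m * d" using d by (intro mult_right_mono) auto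
    then have mu: "\<mu> \<le> D0 - e * d * real n / 8 + \<delta> * real n" using mu by (simp add: algebra_simps)
    have "D0 \<le> (\<Sum>l<n. ?V k l)"
      unfolding kern_def grid_degree[OF k] using grid_degree_bounds(1)[OF k] by (simp add: D0_def)
    also have "\<dots> \<le> (\<Sum>l<n. ?W k l + \<delta>)"
    proof (rule sum_mono)
      fix l assume "l \<in> {..<n}"
      then show "?V k l \<le> ?W k l + \<delta>" using VW[OF k, of l] by (simp add: abs_le_iff)
    qed
    also have "\<dots> = (\<Sum>l<n. ?W k l) + \<delta> * real n" by (simp add: sum.distrib)
    finally have "D0 - \<delta> * real n \<le> (\<Sum>l<n. ?W k l)" by simp
    with mu show "\<mu> + c0 * real n \<le> (\<Sum>l<n. ?W k l)"
      unfolding \<delta>(2) c0_def by (simp add: algebra_simps)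
  qed
qed

end

text \<open>Turns an eigenvector equation into one for the increments. Measuring the other values
  from \<open>v (Suc k)\<close> leaves the full degree of \<open>k\<close> as the coefficient of the
  increment.\<close>

lemma wlap_step:
  assumes "Suc k < n"
  shows "wlap n W v (Suc k) - wlap n W v k = (\<Sum>l<n. W k l) * (v (Suc k) - v k)
    - (\<Sum>l<n. (W (Suc k) l - W k l) * (v l - v (Suc k)))"
  unfolding wlap_def sum_distrib_right sum_subtractf[symmetric]
  by (intro sum.cong) (auto simp: algebra_simps)

definition nondecr :: "nat \<Rightarrow> (nat \<Rightarrow> real) \<Rightarrow> bool" where
  "nondecr n w \<longleftrightarrow> (\<forall>i j. i \<le> j \<longrightarrow> j < n \<longrightarrow> w i \<le> w j)"

lemma nondecrD: "nondecr n w \<Longrightarrow> i \<le> j \<Longrightarrow> j < n \<Longrightarrow> w i \<le> w j"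
  by (auto simp: nondecr_def)

lemma nondecrI_Suc:
  assumes "\<And>k. Suc k < n \<Longrightarrow> w k \<le> w (Suc k)"
  shows "nondecr n w"
  unfolding nondecr_def
proof (intro allI impI)
  fix i j :: nat assume "i \<le> j" "j < n"
  then show "w i \<le> w j"
  proof (induction j)
    case (Suc j)
    then show ?case using assms[of j] by (cases "i = Suc j") (auto intro: order_trans)
  qed simp
qed

section \<open>Increments of the kernel and a monotone minimiser\<close>

context profile
begin

lemma pointsD:
  assumes "points n x \<eta>"
  shows "k < n \<Longrightarrow> 0 \<le> x k" "k < n \<Longrightarrow> x k \<le> 1" "k < n \<Longrightarrow> \<bar>x k - real k / real n\<bar> \<le> \<eta>"
    "k \<le> l \<Longrightarrow> l < n \<Longrightarrow> x k \<le> x l" "k < l \<Longrightarrow> l < n \<Longrightarrow> x k < x l"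
proof -
  show "k \<le> l \<Longrightarrow> l < n \<Longrightarrow> x k \<le> x l" 
    using assms by (cases "k = l") (auto simp: points_def less_imp_le)
qed (use assms in \<open>auto simp: points_def\<close>)

lemma kern_diff_right:
  assumes "points n x \<eta>" "Suc k < n" "Suc k \<le> l" "l < n"
  shows "kern R x (Suc k) l - kern R x k l = R (x l - x (Suc k)) - R (x l - x k)"
    "0 \<le> kern R x (Suc k) l - kern R x k l"
proof -
  have "x k < x (Suc k)" "x (Suc k) \<le> x l" "0 \<le> x k" "x l \<le> 1" using assms pointsD[OF assms(1)] by auto
  then show "kern R x (Suc k) l - kern R x k l = R (x l - x (Suc k)) - R (x l - x k)"
    "0 \<le> kern R x (Suc k) l - kern R x k l"
    using R_mono[of "x l - x (Suc k)" "x l - x k"] by (auto simp: kern_def abs_if)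
qed

lemma kern_diff_left:
  assumes "points n x \<eta>" "Suc k < n" "l \<le> k"
  shows "kern R x (Suc k) l - kern R x k l = - (R (x k - x l) - R (x (Suc k) - x l))"
    "kern R x (Suc k) l - kern R x k l \<le> 0"
proof -
  have "x k < x (Suc k)" "x l \<le> x k" "0 \<le> x l" "x (Suc k) \<le> 1" using assms pointsD[OF assms(1)] by auto
  then show "kern R x (Suc k) l - kern R x k l = - (R (x k - x l) - R (x (Suc k) - x l))"
    "kern R x (Suc k) l - kern R x k l \<le> 0"
    using R_mono[of "x k - x l" "x (Suc k) - x l"] by (auto simp: kern_def abs_if)
qed

lemma kern_diff_abs:
  assumes "points n x \<eta>" "Suc k < n" "l < n"
  shows "\<bar>kern R x (Suc k) l - kern R x k l\<bar> \<le> C1 * (x (Suc k) - x k)"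
proof -
  have a: "0 \<le> x k" "x k \<le> 1" "0 \<le> x (Suc k)" "x (Suc k) \<le> 1" "0 \<le> x l" "x l \<le> 1" "x k < x (Suc k)"
    using assms pointsD[OF assms(1)] by auto
  have "\<bar>kern R x (Suc k) l - kern R x k l\<bar> \<le> C1 * \<bar>\<bar>x (Suc k) - x l\<bar> - \<bar>x k - x l\<bar>\<bar>"
    unfolding kern_def using a by (intro R_lip_abs) auto
  also have "\<dots> \<le> C1 * (x (Suc k) - x k)"
    using C1_pos a by (intro mult_left_mono) auto
  finally show ?thesis .
qed

text \<open>Both factors are nonnegative for l \<ge> Suc k and nonpositive for l \<le> k: a step to
  the right approaches the vertices on the right and leaves those on the left.\<close>

lemma kern_step_term_nonneg:
  assumes "points n x \<eta>" "Suc k < n" "l < n" "nondecr n w"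
  shows "0 \<le> (kern R x (Suc k) l - kern R x k l) * (w l - w (Suc k))"
proof (cases "Suc k \<le> l")
  case True
  then show ?thesis using kern_diff_right(2)[OF assms(1,2) True assms(3)] nondecrD[OF assms(4) True assms(3)] by simp
next
  case False
  then have l: "l \<le> k" by simp
  then show ?thesis using kern_diff_left(2)[OF assms(1,2) l] nondecrD[OF assms(4), of l "Suc k"] assms(2)
    by (intro mult_nonpos_nonpos) auto
qed

text \<open>Replacing the increments of a minimiser v by their absolute values gives a nondecreasing u for
  which L u - \<mu> u is nonincreasing; by Chebyshev's sum inequality u is a minimiser as well.\<close>
lemma monotone_minimizer:
  assumes x: "points n x \<eta>" and n: "1 < n"
    and deg: "\<And>\<mu> k. k < n \<Longrightarrow> (\<And>h. (\<Sum>k<n. h k) = 0 \<Longrightarrow> \<mu> * ip n h h \<le> ip n (wlap n (kern R x) h) h)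
      \<Longrightarrow> \<mu> \<le> (\<Sum>l<n. kern R x k l)"
  obtains u \<mu> where "(\<Sum>k<n. u k) = 0" "nondecr n u" "u (n - 1) - u 0 = 1"
    "\<And>k. k < n \<Longrightarrow> wlap n (kern R x) u k = \<mu> * u k"
    "\<And>h. (\<Sum>k<n. h k) = 0 \<Longrightarrow> \<mu> * ip n h h \<le> ip n (wlap n (kern R x) h) h"
proof -
  let ?W = "kern R x"
  have o: "orth n {\<lambda>_. 1} h \<longleftrightarrow> (\<Sum>k<n. h k) = 0" for h
    by (simp add: orth_def ip_def)
  let ?z = "\<lambda>k::nat. if k = 0 then 1 else if k = 1 then -1 else (0::real)"
  have "(\<Sum>k<n. ?z k) = (\<Sum>k\<in>{0,1}. ?z k)"
    using n by (intro sum.mono_neutral_right) auto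
  then have z0: "orth n {\<lambda>_. 1} ?z" unfolding o by simp
  have "ip n ?z ?z \<noteq> 0" unfolding ip_self_eq_0 using n by (auto intro!: exI[of _ 0])
  then have zp: "ip n ?z ?z > 0" using ip_nonneg[of n ?z] by linarith
  have cinv: "\<exists>r. \<forall>k<n. wlap n ?W c k = r * c k" if "c \<in> {\<lambda>_. 1}" for c
    using that by (auto simp: wlap_const intro: exI[of _ 0])
  obtain v \<mu> where v: "orth n {\<lambda>_. 1} v" "ip n v v = 1" "\<And>k. k < n \<Longrightarrow> wlap n ?W v k = \<mu> * v k"
    "\<And>h. orth n {\<lambda>_. 1} h \<Longrightarrow> \<mu> * ip n h h \<le> ip n (wlap n ?W h) h"
    using rayleigh_minimizer_exists[OF symw_kern cinv z0 zp] by blast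
  have min: "\<mu> * ip n h h \<le> ip n (wlap n ?W h) h" if "(\<Sum>k<n. h k) = 0" for h
    using v(4) o that by blast
  have dk: "\<mu> \<le> (\<Sum>l<n. ?W k l)" if "k < n" for k by (rule deg[OF that min])
  \<comment> \<open>\<open>s\<close> is the running total variation of \<open>v\<close>; subtracting
    its mean restores orthogonality to the constants.\<close>
  define s where "s k = (\<Sum>i<k. \<bar>v (Suc i) - v i\<bar>)" for k
  define mean where "mean = (\<Sum>k<n. s k) / real n"
  define u where "u k = s k - mean" for k
  have ustep: "u (Suc k) - u k = \<bar>v (Suc k) - v k\<bar>" for k by (simp add: u_def s_def)
  have usum: "(\<Sum>k<n. u k) = 0" using n by (simp add: u_def sum_subtractf mean_def)
  have umono: "u i \<le> u j" if "i \<le> j" for i j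
    by (rule lift_Suc_mono_le[OF _ that]) (simp add: u_def s_def)
  have vle: "\<bar>v j - v i\<bar> \<le> u j - u i" if "i \<le> j" for i j
    using that
  proof (induction j)
    case (Suc j)
    show ?case
    proof (cases "i = Suc j")
      case False
      then have "\<bar>v j - v i\<bar> \<le> u j - u i" using Suc by simp
      then show ?thesis using ustep[of j] by linarith
    qed simp
  qed simp
  have und: "nondecr n u" using umono by (simp add: nondecr_def)
  define q where "q k = wlap n ?W u k - \<mu> * u k" for k
  have qstep: "q (Suc k) \<le> q k" if k: "Suc k < n" for k
  proof -
    have kn: "k < n" using k by simp
    let ?S = "\<lambda>w. (\<Sum>l<n. (?W (Suc k) l - ?W k l) * (w l - w (Suc k)))"
    let ?d = "\<Sum>l<n. ?W k l"
    have "wlap n ?W v (Suc k) - wlap n ?W v k = ?d * (v (Suc k) - v k) - ?S v" by (rule wlap_step[OF k])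
    then have "?S v = (?d - \<mu>) * (v (Suc k) - v k)"
      using v(3)[OF k] v(3)[OF kn] by (simp add: algebra_simps)
    \<comment> \<open>The degree is at least \<mu>, so the coefficient passes through the absolute
      value.\<close>
    then have "(?d - \<mu>) * \<bar>v (Suc k) - v k\<bar> = \<bar>?S v\<bar>"
      using dk[OF kn] by (simp add: abs_mult)
    also have "\<dots> \<le> (\<Sum>l<n. \<bar>(?W (Suc k) l - ?W k l) * (v l - v (Suc k))\<bar>)" by (rule sum_abs)
    also have "\<dots> \<le> ?S u"
    proof (rule sum_mono)
      fix l assume "l \<in> {..<n}"
      then have l: "l < n" by simp
      have "\<bar>v l - v (Suc k)\<bar> \<le> \<bar>u l - u (Suc k)\<bar>"
        using vle[of l "Suc k"] vle[of "Suc k" l] by (cases "l \<le> Suc k") (auto simp: abs_minus_commute)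
      then have "\<bar>(?W (Suc k) l - ?W k l) * (v l - v (Suc k))\<bar> \<le> \<bar>(?W (Suc k) l - ?W k l) * (u l - u (Suc k))\<bar>"
        unfolding abs_mult by (rule mult_left_mono) simp
      then show "\<bar>(?W (Suc k) l - ?W k l) * (v l - v (Suc k))\<bar> \<le> (?W (Suc k) l - ?W k l) * (u l - u (Suc k))"
        using kern_step_term_nonneg[OF x k l und] by simp
    qed
    finally have "(?d - \<mu>) * (u (Suc k) - u k) \<le> ?S u" by (simp add: ustep)
    moreover have "wlap n ?W u (Suc k) - wlap n ?W u k = ?d * (u (Suc k) - u k) - ?S u" by (rule wlap_step[OF k])
    ultimately show ?thesis by (simp add: q_def algebra_simps)
  qed
  have qdec: "q j \<le> q i" if "i \<le> j" "j < n" for i j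
    using nondecrD[OF nondecrI_Suc[of n "\<lambda>k. - q k"] that] qstep by simp
  have "real n * (\<Sum>k=0..<n. u k * q k) \<le> (\<Sum>k=0..<n. u k) * (\<Sum>k=0..<n. q k)"
    by (rule Chebyshev_sum_upper) (auto intro: umono qdec)
  then have "real n * (\<Sum>k<n. u k * q k) \<le> 0" using usum by (simp add: atLeast0LessThan)
  then have "(\<Sum>k<n. u k * q k) \<le> 0" using n by (simp add: mult_le_0_iff)
  moreover have "(\<Sum>k<n. u k * q k) = ip n (wlap n ?W u) u - \<mu> * ip n u u"
    by (simp add: ip_def q_def sum_subtractf sum_distrib_left algebra_simps)
  ultimately have ule: "ip n (wlap n ?W u) u \<le> \<mu> * ip n u u" by simp
  have uo: "orth n {\<lambda>_. 1} u" using usum o by blast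
  have ueig: "wlap n ?W u k = \<mu> * u k" if "k < n" for k
    by (rule rayleigh_minimizer_eigen[OF symw_kern cinv v(4) uo ule that])
  have range: "u (n - 1) - u 0 > 0"
  proof (rule ccontr)
    assume "\<not> u (n - 1) - u 0 > 0"
    then have vc: "v k = v 0" if "k < n" for k
    proof -
      have "k \<le> n - 1" using that by simp
      then have "u k \<le> u (n - 1)" by (rule umono)
      then show ?thesis using vle[of 0 k] \<open>\<not> u (n - 1) - u 0 > 0\<close> by simp
    qed
    have c: "(\<Sum>k<n. v k) = (\<Sum>k<n. v 0)" "ip n v v = (\<Sum>k<n. v 0 * v 0)"
      unfolding ip_def by (rule sum.cong[OF refl], metis vc lessThan_iff)+
    have "(\<Sum>k<n. v k) = 0" using v(1) o by blast
    then have "v 0 = 0" using c(1) n by simp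
    then show False using c(2) v(2) by simp
  qed
  define r where "r = 1 / (u (n - 1) - u 0)"
  have r: "r > 0" "r * (u (n - 1) - u 0) = 1" using range by (auto simp: r_def)
  show thesis
  proof (rule that[of "\<lambda>k. r * u k" \<mu>])
    show "(\<Sum>k<n. r * u k) = 0" using usum by (simp flip: sum_distrib_left)
    show "nondecr n (\<lambda>k. r * u k)" using r umono by (auto simp: nondecr_def)
    show "r * u (n - 1) - r * u 0 = 1" using r by (simp add: algebra_simps)
    show "wlap n ?W (\<lambda>k. r * u k) k = \<mu> * (r * u k)" if "k < n" for k
      using ueig[OF that] by (simp add: wlap_scale)
  qed (rule min)
qed

end

section \<open>Minorization of the kernel and the spectral gap\<close>

context profile
begin

text \<open>The minorization behind the spectral gap: the indices a and b do not depend on k, since points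
  near one of the two ends of [0,1] act on each step k with weight comparable to its length.\<close>
lemma step_form_lower_bound:
  assumes \<theta>: "0 < \<theta>" "\<theta> \<le> 1/16"
  obtains \<kappa> n0 where "\<kappa> > 0"
    "\<And>n x \<eta>. n \<ge> n0 \<Longrightarrow> points n x \<eta> \<Longrightarrow> \<eta> \<le> \<theta> / 8 \<Longrightarrow> \<exists>a b. a \<le> b \<and> b < n \<and> x a \<le> 4 * \<theta> \<and> 1 - 4 * \<theta> \<le> x b \<and>
       (\<forall>w k. nondecr n w \<longrightarrow> Suc k < n \<longrightarrow> \<kappa> * real n * (x (Suc k) - x k) * (w b - w a)
          \<le> (\<Sum>l<n. (kern R x (Suc k) l - kern R x k l) * (w l - w (Suc k))))"
proof -
  obtain m where m: "m > 0" "\<And>a b. \<theta>/4 \<le> a \<Longrightarrow> a \<le> b \<Longrightarrow> b \<le> 1 - \<theta>/4 \<Longrightarrow> m * (b - a) \<le> R a - R b"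
    using R_slope[of "\<theta>/4"] \<theta> by auto
  \<comment> \<open>A block of at least \<theta> n / 2 indices will contribute, each of them at
    least m times the length of the step.\<close>
  define \<kappa> where "\<kappa> = m * \<theta> / 2"
  define n0 where "n0 = nat \<lceil>2 / \<theta>\<rceil> + 1"
  show thesis
  proof (rule that[of \<kappa> n0])
    show "\<kappa> > 0" using m \<theta> by (simp add: \<kappa>_def)
    fix n x \<eta> assume n: "n \<ge> n0" and x: "points n x \<eta>" and \<eta>: "\<eta> \<le> \<theta> / 8"
    have "2 / \<theta> \<le> real n" using n by (simp add: n0_def) linarith
    then have tn: "2 \<le> \<theta> * real n" using \<theta> by (simp add: field_simps)
    have n1: "n > 0" using tn by (cases n) auto
    define p where "p = nat \<lfloor>\<theta> * real n\<rfloor>"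
    have p: "real p \<le> \<theta> * real n" "\<theta> * real n - 1 \<le> real p" using tn by (auto simp: p_def)
    then have p2: "\<theta> * real n / 2 \<le> real p" using tn by linarith
    have pn: "\<theta> / 2 \<le> real p / real n" "real p / real n \<le> \<theta>" "1 / real n \<le> \<theta> / 2"
      using p p2 tn n1 by (auto simp: field_simps)
    have "\<theta> * real n \<le> 1/16 * real n" using \<theta> by (intro mult_right_mono) auto
    then have "real (16 * p) \<le> real n" using p by simp
    then have p16: "16 * p \<le> n" by (simp only: of_nat_le_iff)
    have p0: "p > 0" using p tn by linarith
    \<comment> \<open>The blocks \<open>{p..<2*p}\<close> and \<open>{n - 2*p..<n - p}\<close> keep
      about p indices from the ends, and \<open>a\<close> and \<open>b\<close> keep p indices from
      the blocks. So the distances from a low block vertex to a step after \<open>a\<close>, and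
      from a high one to a step before \<open>b\<close>, stay in [\<theta>/4, 1 - \<theta>/4], where
      R has slope at least m.\<close>
    define a where "a = 3 * p"
    define b where "b = n - 1 - 3 * p"
    have ab: "a \<le> b" "b < n" "a < n" using p16 p0 by (auto simp: a_def b_def)
    have xk: "\<bar>x k - real k / real n\<bar> \<le> \<theta> / 8" "0 \<le> x k" "x k \<le> 1" if "k < n" for k
      using pointsD(1-3)[OF x that] \<eta> by auto
    have xa: "x a \<le> 4 * \<theta>"
    proof -
      have "real a / real n = 3 * (real p / real n)" by (simp add: a_def)
      then have "real a / real n \<le> 3 * \<theta>" using pn by linarith
      then show ?thesis using xk(1)[OF ab(3)] \<theta> by linarith
    qed
    have xb: "1 - 4 * \<theta> \<le> x b"
    proof -
      have "real b = real n - 1 - 3 * real p" using p16 p0 by (simp add: b_def of_nat_diff)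
      then have "real b / real n = 1 - 1 / real n - 3 * (real p / real n)" using n1 by (simp add: diff_divide_distrib)
      then have "1 - 7/2 * \<theta> \<le> real b / real n" using pn by linarith
      then show ?thesis using xk(1)[OF ab(2)] \<theta> by linarith
    qed
    have main: "\<kappa> * real n * (x (Suc k) - x k) * (w b - w a)
          \<le> (\<Sum>l<n. (kern R x (Suc k) l - kern R x k l) * (w l - w (Suc k)))"
      if w: "nondecr n w" and k: "Suc k < n" for w k
    proof -
      let ?t = "\<lambda>l. (kern R x (Suc k) l - kern R x k l) * (w l - w (Suc k))"
      let ?\<delta> = "x (Suc k) - x k"
      have \<delta>: "?\<delta> > 0" using pointsD(5)[OF x, of k "Suc k"] k by simp
      have tnn: "0 \<le> ?t l" if "l < n" for l by (rule kern_step_term_nonneg[OF x k that w])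
      define lo where "lo = {p..<2*p}"
      define hi where "hi = {n - 2*p..<n - p}"
      have lh: "lo \<union> hi \<subseteq> {..<n}" "lo \<inter> hi = {}" "card lo = p" "card hi = p" "finite lo" "finite hi"
        using p16 p0 by (auto simp: lo_def hi_def)
      have top: "real p * (m * ?\<delta> * (w b - w (Suc k))) \<le> (\<Sum>l\<in>hi. ?t l)" if kb: "Suc k \<le> b"
      proof -
        have "m * ?\<delta> * (w b - w (Suc k)) \<le> ?t l" if l: "l \<in> hi" for l
        proof -
          have ln: "l < n" "b \<le> l" "Suc k \<le> l" using l kb p16 p0 by (auto simp: hi_def b_def)
          have wl: "w b \<le> w l" "w (Suc k) \<le> w b" using nondecrD[OF w] ln ab kb by auto
          have e1: "real p / real n \<le> real l / real n - real (Suc k) / real n"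
          proof -
            have "real p \<le> real l - real (Suc k)" using l kb p16 p0 by (auto simp: hi_def b_def)
            then show ?thesis using n1 by (simp add: divide_right_mono flip: diff_divide_distrib)
          qed
          have e2: "real l / real n \<le> 1 - real p / real n"
          proof -
            have "real l \<le> real n - real p" using l p16 p0 by (auto simp: hi_def)
            then show ?thesis using n1 by (simp add: field_simps)
          qed
          have "\<theta> / 4 \<le> x l - x (Suc k)" using e1 pn xk(1)[OF ln(1)] xk(1)[OF k] by linarith
          moreover have "x l - x k \<le> 1 - \<theta> / 4" using e2 pn xk(1)[OF ln(1)] xk(2)[of k] k by linarith
          ultimately have "m * ((x l - x k) - (x l - x (Suc k))) \<le> R (x l - x (Suc k)) - R (x l - x k)"
            using \<delta> by (intro m(2)) auto
          then have "m * ?\<delta> \<le> kern R x (Suc k) l - kern R x k l"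
            using kern_diff_right(1)[OF x k ln(3,1)] by simp
          then show ?thesis using wl m \<delta> kern_diff_right(2)[OF x k ln(3,1)] by (intro mult_mono) auto
        qed
        then show ?thesis using sum_bounded_below[of hi "m * ?\<delta> * (w b - w (Suc k))" ?t] lh by simp
      qed
      have bot: "real p * (m * ?\<delta> * (w (Suc k) - w a)) \<le> (\<Sum>l\<in>lo. ?t l)" if ka: "a \<le> k"
      proof -
        have "m * ?\<delta> * (w (Suc k) - w a) \<le> ?t l" if l: "l \<in> lo" for l
        proof -
          have ln: "l < n" "l \<le> a" "l \<le> k" "k < n" using l ka p16 p0 k by (auto simp: lo_def a_def)
          have wl: "w l \<le> w a" "w a \<le> w (Suc k)" using nondecrD[OF w] ln ab ka k by auto
          have e1: "real p / real n \<le> real k / real n - real l / real n"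
          proof -
            have "real p \<le> real k - real l" using l ka p16 p0 by (auto simp: lo_def a_def)
            then show ?thesis using n1 by (simp add: divide_right_mono flip: diff_divide_distrib)
          qed
          have e2: "real p / real n \<le> real l / real n"
            using l by (auto simp: lo_def divide_right_mono)
          have "\<theta> / 4 \<le> x k - x l" using e1 pn xk(1)[OF ln(1)] xk(1)[OF ln(4)] by linarith
          moreover have "x (Suc k) - x l \<le> 1 - \<theta> / 4" using e2 pn xk(1)[OF ln(1)] xk(3)[OF k] by linarith
          ultimately have "m * ((x (Suc k) - x l) - (x k - x l)) \<le> R (x k - x l) - R (x (Suc k) - x l)"
            using \<delta> by (intro m(2)) auto
          then have "m * ?\<delta> \<le> - (kern R x (Suc k) l - kern R x k l)"
            using kern_diff_left(1)[OF x k ln(3)] by simp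
          then have "m * ?\<delta> * (w (Suc k) - w a) \<le> - (kern R x (Suc k) l - kern R x k l) * (w (Suc k) - w l)"
            using wl m \<delta> kern_diff_left(2)[OF x k ln(3)] by (intro mult_mono) auto
          then show ?thesis by (simp add: algebra_simps)
        qed
        then show ?thesis using sum_bounded_below[of lo "m * ?\<delta> * (w (Suc k) - w a)" ?t] lh by simp
      qed
      have tot: "(\<Sum>l\<in>lo. ?t l) + (\<Sum>l\<in>hi. ?t l) \<le> (\<Sum>l<n. ?t l)"
      proof -
        have "(\<Sum>l\<in>lo. ?t l) + (\<Sum>l\<in>hi. ?t l) = (\<Sum>l\<in>lo \<union> hi. ?t l)"
          using lh by (simp add: sum.union_disjoint)
        also have "\<dots> \<le> (\<Sum>l<n. ?t l)" using lh tnn by (intro sum_mono2) auto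
        finally show ?thesis .
      qed
      have lo0: "0 \<le> (\<Sum>l\<in>lo. ?t l)" and hi0: "0 \<le> (\<Sum>l\<in>hi. ?t l)"
        using lh tnn by (auto intro!: sum_nonneg)
      have wab: "w a \<le> w b" using nondecrD[OF w ab(1,2)] .
      have "real p * (m * ?\<delta> * (w b - w a)) \<le> (\<Sum>l<n. ?t l)"
      proof -
        \<comment> \<open>Between \<open>a\<close> and \<open>b\<close> both blocks act and their
          contributions telescope to w b - w a. Outside, monotonicity of \<open>w\<close> lets the
          block on the far side supply the whole difference alone.\<close>
        consider "a \<le> k" "Suc k \<le> b" | "k < a" | "b < Suc k" by linarith
        then show ?thesis
        proof cases
          case 1
          have "real p * (m * ?\<delta> * (w b - w a)) = real p * (m * ?\<delta> * (w b - w (Suc k))) + real p * (m * ?\<delta> * (w (Suc k) - w a))"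
            by (simp add: algebra_simps)
          then show ?thesis using top[OF 1(2)] bot[OF 1(1)] tot by linarith
        next
          case 2
          then have "w (Suc k) \<le> w a" using nondecrD[OF w, of "Suc k" a] ab by simp
          then have "real p * (m * ?\<delta> * (w b - w a)) \<le> real p * (m * ?\<delta> * (w b - w (Suc k)))"
            using m \<delta> by (intro mult_left_mono) auto
          moreover have "Suc k \<le> b" using 2 ab by simp
          ultimately show ?thesis using top tot lo0 by linarith
        next
          case 3
          then have "w b \<le> w (Suc k)" using nondecrD[OF w, of b "Suc k"] k by simp
          then have "real p * (m * ?\<delta> * (w b - w a)) \<le> real p * (m * ?\<delta> * (w (Suc k) - w a))"
            using m \<delta> by (intro mult_left_mono) auto
          moreover have "a \<le> k" using 3 ab by simp
          ultimately show ?thesis using bot tot hi0 by linarith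
        qed
      qed
      moreover have "\<kappa> * real n * ?\<delta> * (w b - w a) \<le> real p * (m * ?\<delta> * (w b - w a))"
      proof -
        have "(\<theta> * real n / 2) * (m * ?\<delta> * (w b - w a)) \<le> real p * (m * ?\<delta> * (w b - w a))"
          using p2 m \<delta> wab by (intro mult_right_mono) auto
        moreover have "\<kappa> * real n * ?\<delta> * (w b - w a) = (\<theta> * real n / 2) * (m * ?\<delta> * (w b - w a))"
          by (simp add: \<kappa>_def)
        ultimately show ?thesis by (simp only:)
      qed
      ultimately show ?thesis by linarith
    qed
    show "\<exists>a b. a \<le> b \<and> b < n \<and> x a \<le> 4 * \<theta> \<and> 1 - 4 * \<theta> \<le> x b \<and>
       (\<forall>w k. nondecr n w \<longrightarrow> Suc k < n \<longrightarrow> \<kappa> * real n * (x (Suc k) - x k) * (w b - w a)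
          \<le> (\<Sum>l<n. (kern R x (Suc k) l - kern R x k l) * (w l - w (Suc k))))"
      using ab xa xb main by blast
  qed
qed

text \<open>Comparison with the complete graph of constant weight \<open>R 1\<close>, the smallest
  value of the kernel.\<close>

lemma kern_form_coercive:
  assumes x: "points n x \<eta>" and h: "(\<Sum>k<n. h k) = 0"
  shows "R 1 * real n * ip n h h \<le> ip n (wlap n (kern R x) h) h"
proof -
  have "(\<Sum>k<n. \<Sum>l<n. R 1 * (h k - h l)\<^sup>2) \<le> (\<Sum>k<n. \<Sum>l<n. kern R x k l * (h k - h l)\<^sup>2)"
  proof (intro sum_mono mult_right_mono)
    fix k l assume "k \<in> {..<n}" "l \<in> {..<n}"
    then show "R 1 \<le> kern R x k l" unfolding kern_def
      using pointsD(1,2)[OF x, of k] pointsD(1,2)[OF x, of l] by (intro R_mono) auto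
  qed simp
  also have "(\<Sum>k<n. \<Sum>l<n. R 1 * (h k - h l)\<^sup>2) = R 1 * (2 * (real n * ip n h h))"
    using h by (simp add: sum_pairs_sq flip: sum_distrib_left)
  also have "(\<Sum>k<n. \<Sum>l<n. kern R x k l * (h k - h l)\<^sup>2) = 2 * ip n (wlap n (kern R x) h) h"
    unfolding wlap_form[OF symw_kern] by (simp add: power2_eq_square algebra_simps)
  finally show ?thesis by (simp add: algebra_simps)
qed

text \<open>Spectral gap above \<mu>: if h is a further eigenvector with eigenvalue \<mu>2 and M, M' are the largest and
  smallest ratios of its increments to those of u, then M u - h and h - M' u are nondecreasing
  with a vanishing increment at the extremal steps, which bounds \<mu>2 - \<mu> from below.\<close>
theorem expected_spectrum:
  obtains \<eta>0 n0 c0 \<gamma> c c' where "\<eta>0 > 0" "c0 > 0" "\<gamma> > 0" "c > 0" "c' > 0"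
    "\<And>n x. n \<ge> n0 \<Longrightarrow> points n x \<eta>0 \<Longrightarrow> \<exists>u \<mu>. fiedler n (kern R x) c0 \<gamma> c' u \<mu> \<and>
       (\<forall>j k. j \<le> k \<longrightarrow> k < n \<longrightarrow> c * (x k - x j) \<le> u k - u j)"
proof -
  obtain \<eta>1 c0 n1 where \<eta>1: "\<eta>1 > 0" and c0: "c0 > 0" and
    deg: "\<And>n x \<mu> k. n \<ge> n1 \<Longrightarrow> points n x \<eta>1 \<Longrightarrow> k < n \<Longrightarrow>
       (\<And>h. (\<Sum>k<n. h k) = 0 \<Longrightarrow> \<mu> * ip n h h \<le> ip n (wlap n (kern R x) h) h) \<Longrightarrow>
       \<mu> + c0 * real n \<le> (\<Sum>l<n. kern R x k l)"
    using degree_gap by metis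
  \<comment> \<open>\<open>C2\<close> will bound increments of u by those of x. \<theta> is chosen
    so that u varies by at most 4 \<theta> C2 \<le> 1/4 over each end strip, which leaves u b - u a
    \<ge> 1/2 out of the total range 1.\<close>
  define C2 where "C2 = C1 / c0"
  have C2: "C2 > 0" using C1_pos c0 by (simp add: C2_def)
  define \<theta> where "\<theta> = min (1/16) (1 / (16 * C2))"
  have \<theta>: "0 < \<theta>" "\<theta> \<le> 1/16" "\<theta> \<le> 1 / (16 * C2)" using C2 by (auto simp: \<theta>_def)
  then have \<theta>C: "16 * (C2 * \<theta>) \<le> 1" using C2 by (simp add: field_simps)
  obtain \<kappa> n2 where \<kappa>: "\<kappa> > 0" and
    low: "\<And>n x \<eta>. n \<ge> n2 \<Longrightarrow> points n x \<eta> \<Longrightarrow> \<eta> \<le> \<theta> / 8 \<Longrightarrow> \<exists>a b. a \<le> b \<and> b < n \<and> x a \<le> 4 * \<theta> \<and> 1 - 4 * \<theta> \<le> x b \<and>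
       (\<forall>w k. nondecr n w \<longrightarrow> Suc k < n \<longrightarrow> \<kappa> * real n * (x (Suc k) - x k) * (w b - w a)
          \<le> (\<Sum>l<n. (kern R x (Suc k) l - kern R x k l) * (w l - w (Suc k))))"
    by (rule step_form_lower_bound[OF \<theta>(1,2)]) (rule that)
  define \<eta>0 where "\<eta>0 = min \<eta>1 (min (\<theta>/8) (1/16))"
  have \<eta>0: "0 < \<eta>0" "\<eta>0 \<le> \<eta>1" "\<eta>0 \<le> \<theta>/8" "\<eta>0 \<le> 1/16" using \<eta>1 \<theta> by (auto simp: \<eta>0_def)
  \<comment> \<open>\<open>c\<close> combines \<kappa> with u b - u a \<ge> 1/2 and degrees at most
    n; in \<gamma> a further division by \<open>C2\<close> passes from increments of x to increments
    of u.\<close>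
  define c where "c = \<kappa> / 2"
  define \<gamma> where "\<gamma> = \<kappa> / (2 * C2)"
  define c' where "c' = c\<^sup>2 / 128"
  define n0 where "n0 = max (max n1 n2) 10"
  show thesis
  proof (rule that[of \<eta>0 c0 \<gamma> c c' n0])
    show "\<eta>0 > 0" "c0 > 0" "\<gamma> > 0" "c > 0" "c' > 0"
      using \<eta>0 c0 C2 \<kappa> by (auto simp: \<gamma>_def c_def c'_def)
    fix n x assume n: "n \<ge> n0" and x: "points n x \<eta>0"
    have nn: "n \<ge> n1" "n \<ge> n2" "n \<ge> 10" using n by (auto simp: n0_def)
    then have n0: "real n > 0" "1 < n" by auto
    have x1: "points n x \<eta>1" using x \<eta>0(2) unfolding points_def by (meson order_trans)
    let ?W = "kern R x"
    obtain u \<mu> where u: "(\<Sum>k<n. u k) = 0" "nondecr n u" "u (n - 1) - u 0 = 1"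
      "\<And>k. k < n \<Longrightarrow> wlap n ?W u k = \<mu> * u k"
      "\<And>h. (\<Sum>k<n. h k) = 0 \<Longrightarrow> \<mu> * ip n h h \<le> ip n (wlap n ?W h) h"
    proof (rule monotone_minimizer[OF x n0(2)])
      fix \<mu> k assume "k < n" "\<And>h. (\<Sum>k<n. h k) = 0 \<Longrightarrow> \<mu> * ip n h h \<le> ip n (wlap n ?W h) h"
      from deg[OF nn(1) x1 this] have "\<mu> + c0 * real n \<le> (\<Sum>l<n. ?W k l)" .
      moreover have "0 \<le> c0 * real n" using c0 by simp
      ultimately show "\<mu> \<le> (\<Sum>l<n. ?W k l)" by linarith
    qed (rule that)
    have dk: "\<mu> + c0 * real n \<le> (\<Sum>l<n. ?W k l)" if "k < n" for k
      by (rule deg[OF nn(1) x1 that u(5)])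
    have dk1: "(\<Sum>l<n. ?W k l) \<le> real n" if "k < n" for k
    proof -
      have "(\<Sum>l<n. ?W k l) \<le> (\<Sum>l<n. 1)"
      proof (rule sum_mono)
        fix l assume "l \<in> {..<n}"
        then show "?W k l \<le> 1" unfolding kern_def
          using pointsD(1,2)[OF x, of k] pointsD(1,2)[OF x, of l] that by (intro R_le_1) auto
      qed
      then show ?thesis by simp
    qed
    have ipu: "ip n (wlap n ?W u) u = \<mu> * ip n u u"
      using ip_cong[of n "wlap n ?W u" "\<lambda>k. \<mu> * u k" u u] u(4) by (simp add: ip_simps)
    have u_ends: "u 0 \<le> 0" "0 \<le> u (n - 1)"
    proof -
      have "(\<Sum>k<n. u 0) \<le> (\<Sum>k<n. u k)" by (intro sum_mono nondecrD[OF u(2)]) auto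
      then show "u 0 \<le> 0" using u(1) n0 by (simp add: mult_le_0_iff)
      have "(\<Sum>k<n. u k) \<le> (\<Sum>k<n. u (n - 1))" using n0 by (intro sum_mono nondecrD[OF u(2)]) auto
      then show "0 \<le> u (n - 1)" using u(1) n0 by (simp add: zero_le_mult_iff)
    qed
    have ubnd: "u 0 \<le> u k" "u k \<le> u (n - 1)" if "k < n" for k
      using nondecrD[OF u(2), of 0 k] nondecrD[OF u(2), of k "n - 1"] that n0 by auto
    have uabs: "\<bar>u k\<bar> \<le> 1" if "k < n" for k
      using ubnd[OF that] u_ends u(3) by linarith
    have upos: "ip n u u > 0"
    proof -
      have "u 0 \<noteq> 0 \<or> u (n - 1) \<noteq> 0" using u(3) by linarith
      moreover have "0 < n" "n - 1 < n" using n0 by auto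
      ultimately have "ip n u u \<noteq> 0" unfolding ip_self_eq_0 by blast
      then show ?thesis using ip_nonneg[of n u] by linarith
    qed
    have mu0: "0 \<le> \<mu>"
    proof -
      have "0 \<le> R 1 * real n * ip n u u" using R_pos[of 1] upos by simp
      also have "\<dots> \<le> \<mu> * ip n u u" using kern_form_coercive[OF x u(1)] ipu by simp
      finally show ?thesis using upos by (simp add: zero_le_mult_iff)
    qed
    let ?S = "\<lambda>w k. (\<Sum>l<n. (?W (Suc k) l - ?W k l) * (w l - w (Suc k)))"
    have ustep: "((\<Sum>l<n. ?W k l) - \<mu>) * (u (Suc k) - u k) = ?S u k" if k: "Suc k < n" for k
    proof -
      have "wlap n ?W u (Suc k) - wlap n ?W u k = (\<Sum>l<n. ?W k l) * (u (Suc k) - u k) - ?S u k"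
        by (rule wlap_step[OF k])
      then show ?thesis using u(4)[OF k] u(4)[of k] k by (simp add: algebra_simps)
    qed
    have uup: "u (Suc k) - u k \<le> C2 * (x (Suc k) - x k)" if k: "Suc k < n" for k
    proof -
      have "c0 * real n * (u (Suc k) - u k) \<le> ((\<Sum>l<n. ?W k l) - \<mu>) * (u (Suc k) - u k)"
        using dk[of k] k nondecrD[OF u(2), of k "Suc k"] by (intro mult_right_mono) auto
      also have "\<dots> = ?S u k" by (rule ustep[OF k])
      also have "\<dots> \<le> (\<Sum>l<n. C1 * (x (Suc k) - x k) * 1)"
      proof (rule sum_mono)
        fix l assume "l \<in> {..<n}"
        then have l: "l < n" by simp
        have "(?W (Suc k) l - ?W k l) * (u l - u (Suc k)) \<le> \<bar>?W (Suc k) l - ?W k l\<bar> * \<bar>u l - u (Suc k)\<bar>"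
          by (metis abs_ge_self abs_mult)
        also have "\<dots> \<le> C1 * (x (Suc k) - x k) * 1"
        proof (intro mult_mono)
          show "\<bar>?W (Suc k) l - ?W k l\<bar> \<le> C1 * (x (Suc k) - x k)" by (rule kern_diff_abs[OF x k l])
          show "\<bar>u l - u (Suc k)\<bar> \<le> 1" using ubnd[OF l] ubnd[OF k] u(3) by linarith
          show "0 \<le> C1 * (x (Suc k) - x k)" using C1_pos pointsD(4)[OF x, of k "Suc k"] k by simp
        qed simp
        finally show "(?W (Suc k) l - ?W k l) * (u l - u (Suc k)) \<le> C1 * (x (Suc k) - x k) * 1" .
      qed
      also have "\<dots> = real n * (C1 * (x (Suc k) - x k))" by simp
      finally have "real n * (c0 * (u (Suc k) - u k)) \<le> real n * (C1 * (x (Suc k) - x k))"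
        by (simp add: algebra_simps)
      then have "c0 * (u (Suc k) - u k) \<le> C1 * (x (Suc k) - x k)"
        using n0 by (simp add: mult_le_cancel_left_pos)
      then show ?thesis unfolding C2_def using c0 by (simp add: field_simps)
    qed
    have uup': "u k - u j \<le> C2 * (x k - x j)" if "j \<le> k" "k < n" for j k
      using nondecrD[OF nondecrI_Suc[of n "\<lambda>k. C2 * x k - u k"] that] uup by (simp add: algebra_simps)
    obtain a b where ab: "a \<le> b" "b < n" "x a \<le> 4 * \<theta>" "1 - 4 * \<theta> \<le> x b"
      and sl: "\<And>w k. nondecr n w \<Longrightarrow> Suc k < n \<Longrightarrow> \<kappa> * real n * (x (Suc k) - x k) * (w b - w a) \<le> ?S w k"
      using low[OF nn(2) x \<eta>0(3)] by blast
    have uab: "1 / 2 \<le> u b - u a"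
    proof -
      have "u a - u 0 \<le> C2 * (x a - x 0)" using ab by (intro uup') auto
      also have "\<dots> \<le> C2 * (4 * \<theta>)" using C2 ab pointsD(1)[OF x, of 0] n0 by (intro mult_left_mono) auto
      finally have 1: "u a - u 0 \<le> 1/4" using \<theta>C by simp
      have "u (n - 1) - u b \<le> C2 * (x (n - 1) - x b)" using ab by (intro uup') auto
      also have "\<dots> \<le> C2 * (4 * \<theta>)" using C2 ab pointsD(2)[OF x, of "n - 1"] n0 by (intro mult_left_mono) auto
      finally have 2: "u (n - 1) - u b \<le> 1/4" using \<theta>C by simp
      show ?thesis using 1 2 u(3) by simp
    qed
    have ulow: "c * (x (Suc k) - x k) \<le> u (Suc k) - u k" if k: "Suc k < n" for k
    proof -
      have dx: "0 < x (Suc k) - x k" using pointsD(5)[OF x, of k "Suc k"] k by simp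
      have "\<kappa> * real n * (x (Suc k) - x k) * (1/2) \<le> \<kappa> * real n * (x (Suc k) - x k) * (u b - u a)"
        using uab \<kappa> dx by (intro mult_left_mono) auto
      also have "\<dots> \<le> ?S u k" by (rule sl[OF u(2) k])
      also have "\<dots> = ((\<Sum>l<n. ?W k l) - \<mu>) * (u (Suc k) - u k)" by (simp add: ustep[OF k])
      also have "\<dots> \<le> real n * (u (Suc k) - u k)"
        using dk1[of k] mu0 k nondecrD[OF u(2), of k "Suc k"] by (intro mult_right_mono) auto
      finally have "real n * (c * (x (Suc k) - x k)) \<le> real n * (u (Suc k) - u k)"
        by (simp add: c_def algebra_simps)
      then show ?thesis using n0 by (simp add: mult_le_cancel_left_pos)
    qed
    have c0': "c > 0" using \<kappa> by (simp add: c_def)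
    have ulow': "c * (x k - x j) \<le> u k - u j" if "j \<le> k" "k < n" for j k
      using nondecrD[OF nondecrI_Suc[of n "\<lambda>k. u k - c * x k"] that] ulow by (simp add: algebra_simps)
    have gpos: "0 < u (Suc k) - u k" if k: "Suc k < n" for k
    proof -
      have "0 < c * (x (Suc k) - x k)" using pointsD(5)[OF x, of k "Suc k"] k c0' by simp
      then show ?thesis using ulow[OF k] by linarith
    qed
    have gap: "(\<mu> + \<gamma> * real n) * ip n h h \<le> ip n (wlap n ?W h) h"
      if h: "(\<Sum>k<n. h k) = 0" "ip n u h = 0" for h
    proof (cases "ip n h h > 0")
      case False
      then have "ip n h h = 0" using ip_nonneg[of n h] by linarith
      moreover have "0 \<le> ip n (wlap n ?W h) h"
        using kern_form_coercive[OF x h(1)] \<open>ip n h h = 0\<close> by simp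
      ultimately show ?thesis by simp
    next
      case True
      have inv: "\<exists>r. \<forall>k<n. wlap n ?W f k = r * f k" if "f \<in> {\<lambda>_. 1, u}" for f
        using that u(4) by (auto simp: wlap_const intro: exI[of _ 0])
      have o: "orth n {\<lambda>_. 1, u} f \<longleftrightarrow> (\<Sum>k<n. f k) = 0 \<and> ip n u f = 0" for f
        by (simp add: orth_def ip_commute[of n f u]) (simp add: ip_def)
      have oh: "orth n {\<lambda>_. 1, u} h" using h o by blast
      obtain v \<mu>2 where v: "orth n {\<lambda>_. 1, u} v" "ip n v v = 1" "\<And>k. k < n \<Longrightarrow> wlap n ?W v k = \<mu>2 * v k"
        "\<And>h. orth n {\<lambda>_. 1, u} h \<Longrightarrow> \<mu>2 * ip n h h \<le> ip n (wlap n ?W h) h"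
        using rayleigh_minimizer_exists[OF symw_kern inv oh True] by blast
      have vo: "(\<Sum>k<n. v k) = 0" "ip n u v = 0" using v(1) unfolding o by auto
      define \<rho> where "\<rho> k = (v (Suc k) - v k) / (u (Suc k) - u k)" for k
      have \<rho>: "v (Suc k) - v k = \<rho> k * (u (Suc k) - u k)" if "Suc k < n" for k
        using gpos[OF that] by (simp add: \<rho>_def)
      define K where "K = {k. Suc k < n}"
      have K: "finite K" "K \<noteq> {}"
      proof -
        have "K \<subseteq> {..<n}" by (auto simp: K_def)
        then show "finite K" by (rule finite_subset) simp
        show "K \<noteq> {}" using n0 by (auto simp: K_def intro!: exI[of _ 0])
      qed
      define M where "M = Max (\<rho> ` K)"
      define M' where "M' = Min (\<rho> ` K)"
      have "M \<in> \<rho> ` K" "M' \<in> \<rho> ` K" unfolding M_def M'_def using K by (auto intro: Max_in Min_in)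
      then obtain k k' where k: "Suc k < n" "\<rho> k = M" and k': "Suc k' < n" "\<rho> k' = M'" by (auto simp: K_def)
      have MM: "M' \<le> \<rho> j" "\<rho> j \<le> M" if "Suc j < n" for j
        using K that by (auto simp: M_def M'_def K_def)
      \<comment> \<open>At a step \<open>j\<close> where \<open>w\<close> does not change, the
        degree term of \<open>wlap_step\<close> drops out, and the two eigenvector equations leave s
        (\<mu>2 - \<mu>) times the increment of u. The sign t = 1 serves the largest ratio, t = -1
        the smallest.\<close>
      have bound: "(\<kappa> / C2) * real n * (w b - w a) \<le> s * (\<mu>2 - \<mu>)"
        if w: "nondecr n w" and w_def: "\<And>l. w l = s * u l - t * v l" and tt: "\<bar>t\<bar> = 1"
          and j: "Suc j < n" and wj: "w (Suc j) = w j" for w s t j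
      proof -
        have dx: "0 < x (Suc j) - x j" using pointsD(5)[OF x, of j "Suc j"] j by simp
        have jn: "j < n" using j by simp
        have wab: "w a \<le> w b" using nondecrD[OF w ab(1,2)] .
        have wl: "wlap n ?W w i = s * \<mu> * u i - t * \<mu>2 * v i" if "i < n" for i
        proof -
          have "w = (\<lambda>l. s * u l - t * v l)" using w_def by auto
          then show ?thesis using u(4)[OF that] v(3)[OF that] by (simp add: wlap_diff wlap_scale)
        qed
        have tv: "t * (v (Suc j) - v j) = s * (u (Suc j) - u j)"
          using wj unfolding w_def by (simp add: algebra_simps)
        have "wlap n ?W w (Suc j) - wlap n ?W w j = (\<Sum>l<n. ?W j l) * (w (Suc j) - w j) - ?S w j"
          by (rule wlap_step[OF j])
        then have "?S w j = wlap n ?W w j - wlap n ?W w (Suc j)" using wj by simp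
        also have "\<dots> = \<mu>2 * (t * (v (Suc j) - v j)) - \<mu> * (s * (u (Suc j) - u j))"
          unfolding wl[OF j] wl[OF jn] by (simp add: algebra_simps)
        also have "\<dots> = (s * (\<mu>2 - \<mu>)) * (u (Suc j) - u j)"
          unfolding tv by (simp add: algebra_simps)
        finally have e: "?S w j = (s * (\<mu>2 - \<mu>)) * (u (Suc j) - u j)" .
        have "((\<kappa> / C2) * real n * (w b - w a)) * (u (Suc j) - u j)
            \<le> ((\<kappa> / C2) * real n * (w b - w a)) * (C2 * (x (Suc j) - x j))"
          using uup[OF j] \<kappa> C2 wab by (intro mult_left_mono) auto
        also have "\<dots> = \<kappa> * real n * (x (Suc j) - x j) * (w b - w a)" using C2 by simp
        also have "\<dots> \<le> ?S w j" by (rule sl[OF w j])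
        finally show ?thesis using gpos[OF j] unfolding e by (rule mult_right_le_imp_le)
      qed
      have 1: "(\<kappa> / C2) * real n * ((M * u b - 1 * v b) - (M * u a - 1 * v a)) \<le> M * (\<mu>2 - \<mu>)"
      proof (rule bound[where w="\<lambda>l. M * u l - 1 * v l" and s=M and t=1 and j=k])
        show "nondecr n (\<lambda>l. M * u l - 1 * v l)"
        proof (rule nondecrI_Suc)
          fix j assume j: "Suc j < n"
          have "\<rho> j * (u (Suc j) - u j) \<le> M * (u (Suc j) - u j)"
            using MM[OF j] gpos[OF j] by (intro mult_right_mono) auto
          then show "M * u j - 1 * v j \<le> M * u (Suc j) - 1 * v (Suc j)"
            using \<rho>[OF j] by (simp add: algebra_simps)
        qed
        show "M * u (Suc k) - 1 * v (Suc k) = M * u k - 1 * v k" using \<rho>[OF k(1)] k(2) by (simp add: algebra_simps)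
      qed (use k in auto)
      have 2: "(\<kappa> / C2) * real n * ((- M' * u b - (-1) * v b) - (- M' * u a - (-1) * v a)) \<le> - M' * (\<mu>2 - \<mu>)"
      proof (rule bound[where w="\<lambda>l. - M' * u l - (-1) * v l" and s="- M'" and t="-1" and j=k'])
        show "nondecr n (\<lambda>l. - M' * u l - (-1) * v l)"
        proof (rule nondecrI_Suc)
          fix j assume j: "Suc j < n"
          have "M' * (u (Suc j) - u j) \<le> \<rho> j * (u (Suc j) - u j)"
            using MM[OF j] gpos[OF j] by (intro mult_right_mono) auto
          then show "- M' * u j - (-1) * v j \<le> - M' * u (Suc j) - (-1) * v (Suc j)"
            using \<rho>[OF j] by (simp add: algebra_simps)
        qed
        show "- M' * u (Suc k') - (-1) * v (Suc k') = - M' * u k' - (-1) * v k'"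
          using \<rho>[OF k'(1)] k'(2) by (simp add: algebra_simps)
      qed (use k' in auto)
      \<comment> \<open>Equal ratios would make \<open>v\<close> affine in \<open>u\<close>; mean
        zero kills the constant and orthogonality to \<open>u\<close> the slope.\<close>
      have MM': "M > M'"
      proof (rule ccontr)
        assume "\<not> M > M'"
        then have e: "v (Suc j) - v j = M * (u (Suc j) - u j)" if "Suc j < n" for j
          using MM[OF that] \<rho>[OF that] by (metis dual_order.antisym not_less order_trans)
        have vu: "v j = M * u j + (v 0 - M * u 0)" if "j < n" for j
          using that
        proof (induction j)
          case (Suc j) then show ?case using e[of j] by (simp add: algebra_simps)
        qed simp
        have "(\<Sum>k<n. v k) = (\<Sum>k<n. M * u k + (v 0 - M * u 0))" by (intro sum.cong) (auto simp: vu[symmetric])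
        also have "\<dots> = real n * (v 0 - M * u 0)" using u(1) by (simp add: sum.distrib flip: sum_distrib_left)
        finally have z: "v 0 - M * u 0 = 0" using vo n0 by simp
        have vu': "v j = M * u j" if "j < n" for j using vu[OF that] z by simp
        have "ip n u v = ip n u (\<lambda>j. M * u j)" by (rule ip_cong) (auto simp: vu')
        then have "M = 0" using vo(2) upos by (simp add: ip_simps)
        then have "ip n v v = 0" unfolding ip_self_eq_0 by (simp add: vu')
        then show False using v(2) by simp
      qed
      \<comment> \<open>In the sum of the two bounds \<open>v\<close> cancels, and M - M' > 0 can be
        divided out.\<close>
      have "(\<kappa> / C2) * real n * ((M - M') * (u b - u a)) \<le> (M - M') * (\<mu>2 - \<mu>)"
        using 1 2 by (simp add: algebra_simps)
      moreover have "(\<kappa> / C2) * real n * ((M - M') * (1/2)) \<le> (\<kappa> / C2) * real n * ((M - M') * (u b - u a))"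
        using uab MM' \<kappa> C2 by (intro mult_left_mono) auto
      ultimately have "(M - M') * (\<gamma> * real n) \<le> (M - M') * (\<mu>2 - \<mu>)"
        by (simp add: \<gamma>_def algebra_simps)
      then have "\<mu> + \<gamma> * real n \<le> \<mu>2" using MM' by (simp add: mult_le_cancel_left_pos)
      then have "(\<mu> + \<gamma> * real n) * ip n h h \<le> \<mu>2 * ip n h h"
        by (intro mult_right_mono ip_nonneg)
      also have "\<dots> \<le> ip n (wlap n ?W h) h" by (rule v(4)[OF oh])
      finally show ?thesis .
    qed
    have unorm: "c' * real n \<le> ip n u u"
    proof -
      \<comment> \<open>Pairing \<open>k\<close> with \<open>k + q\<close> compares points at
        distance at least 1/4, so a pair carries squared mass at least (c/4)^2 / 2. At least n / 4
        pairs give c' = c^2 / 128.\<close>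
      define q where "q = n div 2"
      have q: "real q \<ge> real n / 4" "2 * q \<le> n" "2 * real q + 1 \<ge> real n" using nn(3) by (auto simp: q_def)
      have each: "c\<^sup>2 / 32 \<le> u k * u k + u (k + q) * u (k + q)" if k: "k < q" for k
      proof -
        have kn: "k < n" "k + q < n" using k q by auto
        have "real (k + q) / real n - real k / real n = real q / real n" by (simp add: add_divide_distrib)
        moreover have "2 / 5 \<le> real q / real n" using q nn(3) n0 by (simp add: field_simps)
        ultimately have "1/4 \<le> x (k + q) - x k"
          using pointsD(3)[OF x kn(1)] pointsD(3)[OF x kn(2)] \<eta>0(4) by linarith
        then have "c * (1/4) \<le> c * (x (k + q) - x k)" using c0' by (intro mult_left_mono) auto
        then have "c / 4 \<le> u (k + q) - u k" using ulow'[of k "k + q"] kn by simp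
        then have "(c / 4)\<^sup>2 \<le> (u (k + q) - u k)\<^sup>2" using c0' by (intro power_mono) auto
        also have "\<dots> \<le> 2 * (u k * u k + u (k + q) * u (k + q))"
          using zero_le_power2[of "u k + u (k + q)"] by (simp add: power2_eq_square algebra_simps)
        finally show ?thesis by (simp add: power2_eq_square)
      qed
      have "real q * (c\<^sup>2 / 32) = (\<Sum>k<q. c\<^sup>2 / 32)" by simp
      also have "\<dots> \<le> (\<Sum>k<q. u k * u k + u (k + q) * u (k + q))" by (intro sum_mono each) auto
      also have "\<dots> = (\<Sum>k<q. u k * u k) + (\<Sum>k\<in>{q..<2*q}. u k * u k)"
      proof -
        have "(\<Sum>k<q. u (k + q) * u (k + q)) = (\<Sum>k\<in>{q..<2*q}. u k * u k)"
          by (rule sum.reindex_bij_witness[of _ "\<lambda>i. i - q" "\<lambda>i. i + q"]) auto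
        then show ?thesis by (simp add: sum.distrib)
      qed
      also have "\<dots> = (\<Sum>k\<in>{..<q} \<union> {q..<2*q}. u k * u k)" by (rule sum.union_disjoint[symmetric]) auto
      also have "\<dots> \<le> ip n u u" unfolding ip_def using q by (intro sum_mono2) auto
      finally have "real q * (c\<^sup>2 / 32) \<le> ip n u u" .
      moreover have "real n / 4 * (c\<^sup>2 / 32) \<le> real q * (c\<^sup>2 / 32)" using q by (intro mult_right_mono) auto
      ultimately have "real n / 4 * (c\<^sup>2 / 32) \<le> ip n u u" by linarith
      then show ?thesis by (simp add: c'_def mult.commute)
    qed
    have "fiedler n ?W c0 \<gamma> c' u \<mu>"
      unfolding fiedler_def using u(1,4) uabs dk gap unorm by blast
    then show "\<exists>u \<mu>. fiedler n ?W c0 \<gamma> c' u \<mu> \<and>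
       (\<forall>j k. j \<le> k \<longrightarrow> k < n \<longrightarrow> c * (x k - x j) \<le> u k - u j)"
      using ulow' by blast
  qed
qed

end

section \<open>Perturbation of the Fiedler vector\<close>

lemma abs_sum_le_sqrt_ip:
  assumes "\<And>l. l < n \<Longrightarrow> \<bar>f l\<bar> \<le> b" "0 \<le> b"
  shows "\<bar>ip n f e\<bar> \<le> b * sqrt (real n) * sqrt (ip n e e)"
proof -
  have "ip n f f \<le> (\<Sum>l<n. b * b)"
    unfolding ip_def
  proof (rule sum_mono)
    fix l assume "l \<in> {..<n}"
    then have "\<bar>f l\<bar> * \<bar>f l\<bar> \<le> b * b" using assms by (intro mult_mono) auto
    then show "f l * f l \<le> b * b" by (simp add: abs_mult_self_eq)
  qed
  then have "sqrt (ip n f f) \<le> sqrt (real n * (b * b))" by (intro real_sqrt_le_mono) simp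
  also have "\<dots> = b * sqrt (real n)" using assms(2) by (simp add: real_sqrt_mult)
  finally have "sqrt (ip n f f) * sqrt (ip n e e) \<le> (b * sqrt (real n)) * sqrt (ip n e e)"
    by (intro mult_right_mono) (auto simp: ip_nonneg)
  then show ?thesis using ip_Cauchy[of n f e] by linarith
qed

text \<open>The squared norm of E h is the quadratic form of the square of E. Its diagonal is at
  most n, and its off-diagonal part at most B times the squared l1 norm of \<open>h\<close>, hence n
  B times the squared l2 norm. Bounding entries of the square instead of the norm itself keeps
  everything within reach of Hoeffding's inequality.\<close>

lemma symmetric_form_bound:
  fixes E :: "nat \<Rightarrow> nat \<Rightarrow> real"
  assumes sym: "symw n E" and le1: "\<And>k l. k < n \<Longrightarrow> l < n \<Longrightarrow> \<bar>E k l\<bar> \<le> 1"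
    and off: "\<And>i k. i < n \<Longrightarrow> k < n \<Longrightarrow> i \<noteq> k \<Longrightarrow> \<bar>\<Sum>j<n. E i j * E j k\<bar> \<le> B" and B: "0 \<le> B"
  shows "\<bar>ip n (\<lambda>k. \<Sum>l<n. E k l * h l) h\<bar> \<le> sqrt (real n + real n * B) * ip n h h"
proof -
  define g where "g k = (\<Sum>l<n. E k l * h l)" for k
  define Q where "Q j k = (\<Sum>i<n. E j i * E i k)" for j k
  have "ip n g g = (\<Sum>i<n. (\<Sum>j<n. \<Sum>k<n. (E i j * h j) * (E i k * h k)))"
    by (simp add: ip_def g_def sum_product)
  also have "\<dots> = (\<Sum>j<n. \<Sum>i<n. \<Sum>k<n. (E i j * h j) * (E i k * h k))" by (rule sum.swap)
  also have "\<dots> = (\<Sum>j<n. \<Sum>k<n. \<Sum>i<n. (E i j * h j) * (E i k * h k))"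
    by (intro sum.cong refl sum.swap)
  also have "\<dots> = (\<Sum>j<n. \<Sum>k<n. Q j k * (h j * h k))"
  proof (intro sum.cong refl)
    fix j k assume jk: "j \<in> {..<n}" "k \<in> {..<n}"
    have "(\<Sum>i<n. (E i j * h j) * (E i k * h k)) = (\<Sum>i<n. (E j i * E i k) * (h j * h k))"
      using sym jk by (intro sum.cong refl) (auto simp: symw_def)
    then show "(\<Sum>i<n. (E i j * h j) * (E i k * h k)) = Q j k * (h j * h k)"
      by (simp add: Q_def sum_distrib_right)
  qed
  also have "\<dots> \<le> (\<Sum>j<n. \<Sum>k<n. (if j = k then real n * (h j * h j) else 0) + B * (\<bar>h j\<bar> * \<bar>h k\<bar>))"
  proof (intro sum_mono)
    fix j k assume jk: "j \<in> {..<n}" "k \<in> {..<n}"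
    show "Q j k * (h j * h k) \<le> (if j = k then real n * (h j * h j) else 0) + B * (\<bar>h j\<bar> * \<bar>h k\<bar>)"
    proof (cases "j = k")
      case True
      have "Q j j \<le> (\<Sum>i<n. 1)" unfolding Q_def
      proof (rule sum_mono)
        fix i assume i: "i \<in> {..<n}"
        have "\<bar>E j i\<bar> * \<bar>E i j\<bar> \<le> 1 * 1" using le1 jk i by (intro mult_mono) auto
        then show "E j i * E i j \<le> 1" by (simp add: abs_le_iff flip: abs_mult)
      qed
      then have "Q j j * (h j * h j) \<le> real n * (h j * h j)" by (intro mult_right_mono) auto
      moreover have "0 \<le> B * (\<bar>h j\<bar> * \<bar>h k\<bar>)" using B by simp
      ultimately show ?thesis using True by simp
    next
      case False
      have "Q j k * (h j * h k) \<le> \<bar>Q j k\<bar> * (\<bar>h j\<bar> * \<bar>h k\<bar>)" by (metis abs_ge_self abs_mult)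
      also have "\<dots> \<le> B * (\<bar>h j\<bar> * \<bar>h k\<bar>)" using off[of j k] jk False by (intro mult_right_mono) (auto simp: Q_def)
      finally show ?thesis using False by simp
    qed
  qed
  also have "\<dots> = real n * ip n h h + B * (\<Sum>j<n. \<bar>h j\<bar>)\<^sup>2"
    by (simp add: sum.distrib ip_def sum_distrib_left power2_eq_square sum_product mult.commute)
  also have "\<dots> \<le> real n * ip n h h + B * (real n * ip n h h)"
  proof -
    have "(\<Sum>j<n. \<bar>h j\<bar> * 1)\<^sup>2 \<le> (\<Sum>j<n. \<bar>h j\<bar>\<^sup>2) * (\<Sum>j<n. 1\<^sup>2)" by (rule Cauchy_Schwarz_ineq_sum)
    also have "(\<Sum>j<n. \<bar>h j\<bar>\<^sup>2) = ip n h h" by (simp add: ip_def power2_eq_square)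
    finally have "(\<Sum>j<n. \<bar>h j\<bar>)\<^sup>2 \<le> real n * ip n h h" by (simp add: mult.commute)
    then show ?thesis using B by (intro add_left_mono mult_left_mono) auto
  qed
  finally have "ip n g g \<le> (real n + real n * B) * ip n h h" by (simp add: algebra_simps)
  then have "sqrt (ip n g g) \<le> sqrt (real n + real n * B) * sqrt (ip n h h)"
    by (metis real_sqrt_le_mono real_sqrt_mult)
  then have "sqrt (ip n g g) * sqrt (ip n h h) \<le> sqrt (real n + real n * B) * sqrt (ip n h h) * sqrt (ip n h h)"
    by (intro mult_right_mono) (auto simp: ip_nonneg)
  also have "\<dots> = sqrt (real n + real n * B) * ip n h h" using ip_nonneg[of n h] by simp
  finally show ?thesis using ip_Cauchy[of n g h] by (simp add: g_def[abs_def])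
qed

text \<open>The perturbation is only controlled in operator norm up to o(n), but its action on the fixed
  vector u is controlled entrywise; the eigenvector equation, whose diagonal part dominates,
  turns the resulting l2 estimate into a uniform one.\<close>
theorem eigenvector_perturbation:
  fixes c0 \<gamma> c' r1 :: real
  assumes const: "c0 > 0" "\<gamma> > 0" "c' > 0" "r1 > 0"
  obtains \<eta> K where "\<eta> > 0" "K > 0"
    "\<And>n W A u \<mu> B E. symw n A \<Longrightarrow> symw n W \<Longrightarrow> (\<And>k l. k < n \<Longrightarrow> l < n \<Longrightarrow> 0 \<le> A k l \<and> A k l \<le> 1) \<Longrightarrow>
       (\<And>k l. k < n \<Longrightarrow> l < n \<Longrightarrow> 0 \<le> W k l \<and> W k l \<le> 1) \<Longrightarrow> (\<And>k. A k k = 0) \<Longrightarrow>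
       (\<And>k l. E k l = (if k = l then 0 else A k l - W k l)) \<Longrightarrow>
       1 \<le> B \<Longrightarrow> B \<le> \<eta> * real n \<Longrightarrow>
       (\<And>k. k < n \<Longrightarrow> \<bar>\<Sum>l<n. E k l\<bar> \<le> B) \<Longrightarrow>
       (\<And>k. k < n \<Longrightarrow> \<bar>\<Sum>l<n. E k l * u l\<bar> \<le> B) \<Longrightarrow>
       (\<And>i k. i < n \<Longrightarrow> k < n \<Longrightarrow> i \<noteq> k \<Longrightarrow> \<bar>\<Sum>j<n. E i j * E j k\<bar> \<le> B) \<Longrightarrow>
       fiedler n W c0 \<gamma> c' u \<mu> \<Longrightarrow>
       (\<And>h. (\<Sum>k<n. h k) = 0 \<Longrightarrow> r1 * real n * ip n h h \<le> ip n (wlap n W h) h) \<Longrightarrow>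
       (\<forall>h. (\<Sum>k<n. h k) = 0 \<longrightarrow> ip n h h > 0 \<longrightarrow> ip n (wlap n A h) h > 0) \<and>
       (\<forall>v r. 0 < r \<longrightarrow> r * ip n u u \<le> ip n (wlap n A u) u \<longrightarrow> (\<forall>k<n. wlap n A v k = r * v k) \<longrightarrow> ip n v v > 0 \<longrightarrow>
          (\<exists>a. a \<noteq> 0 \<and> (\<forall>k<n. \<bar>v k / a - u k\<bar> \<le> K * B / real n)))"
proof -
  \<comment> \<open>\<omega> n is the budget for the noise as a quadratic form: at most a quarter of
    the spectral gap, half of the coercivity and a quarter of the degree gap.\<close>
  define \<omega> where "\<omega> = min (\<gamma> / 4) (min (r1 / 2) (c0 / 4))"
  have \<omega>: "\<omega> > 0" "\<omega> \<le> \<gamma> / 4" "\<omega> \<le> r1 / 2" "\<omega> \<le> c0 / 4" using const by (auto simp: \<omega>_def)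
  \<comment> \<open>The four bounds control, in order, the diagonal of the noise Laplacian, its
    off-diagonal part through sqrt (n + n B) \<le> \<omega> n / 2, the second-order term in the
    eigenvalue estimate, and the loss in the degrees.\<close>
  define \<eta> where "\<eta> = min (min (\<omega> / 2) (\<omega>\<^sup>2 / 8)) (min (\<gamma> / 8) (c0 / 8))"
  have \<eta>: "\<eta> > 0" "\<eta> \<le> \<omega> / 2" "\<eta> \<le> \<omega>\<^sup>2 / 8" "\<eta> \<le> \<gamma> / 8" "\<eta> \<le> c0 / 8" using const \<omega> by (auto simp: \<eta>_def)
  define K where "K = 2 / c0 * (4 / \<gamma> + 2 + 3 / c')"
  have "4 / \<gamma> + 2 + 3 / c' > 0" using const by (intro add_pos_pos) auto
  then have K: "K > 0" using const unfolding K_def by (intro mult_pos_pos) auto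
  show thesis
  proof (rule that[OF \<eta>(1) K], goal_cases)
    case (1 n W A u \<mu> B E)
    note symA = 1(1) and symW = 1(2) and A01 = 1(3) and W01 = 1(4) and A0 = 1(5) and Edef = 1(6) and B1 = 1(7) and Bn = 1(8)
      and H1 = 1(9) and H2 = 1(10) and H3 = 1(11) and coer = 1(13)
    note usum = fiedlerD(1)[OF 1(12)] and ueig = fiedlerD(2)[OF 1(12)] and uabs = fiedlerD(3)[OF 1(12)]
      and deg = fiedlerD(4)[OF 1(12)] and gap = fiedlerD(5)[OF 1(12)] and unorm = fiedlerD(6)[OF 1(12)]
    have n0: "real n > 0" using B1 Bn \<eta>(1) by (metis less_le_trans mult_zero_right not_one_le_zero of_nat_0_le_iff order.order_iff_strict)
    have Bq: "B \<le> q * real n" if "\<eta> \<le> q" for q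
      using Bn mult_right_mono[OF that, of "real n"] by simp
    have Esym: "symw n E" using symA symW by (auto simp: symw_def Edef)
    have E1: "\<bar>E k l\<bar> \<le> 1" if "k < n" "l < n" for k l
      using A01[OF that] W01[OF that] by (auto simp: Edef abs_le_iff)
    \<comment> \<open>The Laplacian of the noise. Diagonal weights cancel in a Laplacian, so
      \<open>E\<close> may be given a zero diagonal, although the kernel has R 0 there and the
      adjacency matrix 0.\<close>
    define F where "F h k = h k * (\<Sum>l<n. E k l) - (\<Sum>l<n. E k l * h l)" for h k
    have AWF: "wlap n A h k = wlap n W h k + F h k" if "k < n" for h k
    proof -
      have "F h k = (\<Sum>l<n. E k l * (h k - h l))"
        unfolding F_def sum_distrib_left sum_subtractf[symmetric] by (intro sum.cong) (auto simp: algebra_simps)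
      also have "\<dots> = (\<Sum>l<n. (A k l - W k l) * (h k - h l))"
        by (intro sum.cong) (auto simp: Edef)
      finally show ?thesis by (simp add: wlap_def left_diff_distrib sum_subtractf)
    qed
    have ipAWF: "ip n (wlap n A h) g = ip n (wlap n W h) g + ip n (F h) g" for h g
      using ip_cong[of n "wlap n A h" "\<lambda>k. wlap n W h k + F h k" g g] AWF by (simp add: ip_simps)
    have form: "\<bar>ip n (F h) h\<bar> \<le> \<omega> * real n * ip n h h" for h
    proof -
      have "ip n (F h) h = ip n (\<lambda>k. (\<Sum>l<n. E k l) * h k) h - ip n (\<lambda>k. \<Sum>l<n. E k l * h l) h"
        unfolding F_def by (simp add: ip_diff_left mult.commute)
      moreover have "\<bar>ip n (\<lambda>k. (\<Sum>l<n. E k l) * h k) h\<bar> \<le> B * ip n h h"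
      proof -
        have "\<bar>ip n (\<lambda>k. (\<Sum>l<n. E k l) * h k) h\<bar> \<le> (\<Sum>k<n. \<bar>(\<Sum>l<n. E k l) * h k * h k\<bar>)"
          unfolding ip_def by (rule sum_abs)
        also have "\<dots> \<le> (\<Sum>k<n. B * (h k * h k))"
        proof (rule sum_mono)
          fix k assume "k \<in> {..<n}"
          then have "\<bar>\<Sum>l<n. E k l\<bar> * (h k * h k) \<le> B * (h k * h k)" using H1[of k] by (intro mult_right_mono) auto
          then show "\<bar>(\<Sum>l<n. E k l) * h k * h k\<bar> \<le> B * (h k * h k)" by (simp add: abs_mult abs_mult_self_eq mult.assoc)
        qed
        finally show ?thesis by (simp add: ip_def sum_distrib_left)
      qed
      moreover have "\<bar>ip n (\<lambda>k. \<Sum>l<n. E k l * h l) h\<bar> \<le> (\<omega> / 2 * real n) * ip n h h"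
      proof -
        have "real n + real n * B \<le> (\<omega> / 2 * real n)\<^sup>2"
        proof -
          have "real n * B \<le> real n * (\<omega>\<^sup>2 / 8 * real n)"
            using Bq[OF \<eta>(3)] by (intro mult_left_mono) auto
          moreover have "real n \<le> real n * B" using B1 n0 by simp
          ultimately show ?thesis by (simp add: power2_eq_square algebra_simps)
        qed
        then have "sqrt (real n + real n * B) \<le> \<omega> / 2 * real n"
          using \<omega> n0 by (intro real_le_lsqrt) auto
        then have "sqrt (real n + real n * B) * ip n h h \<le> (\<omega> / 2 * real n) * ip n h h"
          by (intro mult_right_mono ip_nonneg)
        moreover have "0 \<le> B" using B1 by simp
        ultimately show ?thesis using symmetric_form_bound[OF Esym E1 H3, of h] by linarith
      qed
      moreover have "B * ip n h h \<le> (\<omega> / 2 * real n) * ip n h h"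
        using Bq[OF \<eta>(2)] by (intro mult_right_mono ip_nonneg) auto
      ultimately show ?thesis by (simp add: algebra_simps)
    qed
    have pd: "ip n (wlap n A h) h > 0" if h: "(\<Sum>k<n. h k) = 0" "ip n h h > 0" for h
    proof -
      have "\<omega> * real n * ip n h h \<le> r1 / 2 * real n * ip n h h"
        using \<omega>(3) ip_nonneg by (intro mult_right_mono) auto
      moreover have "r1 / 2 * real n * ip n h h > 0" using const n0 h by simp
      ultimately show ?thesis using coer[OF h(1)] form[of h] ipAWF[of h h] by (simp add: abs_le_iff)
    qed
    have Fu: "\<bar>F u k\<bar> \<le> 2 * B" if k: "k < n" for k
    proof -
      have "\<bar>u k\<bar> * \<bar>\<Sum>l<n. E k l\<bar> \<le> 1 * B" using uabs[OF k] H1[OF k] by (intro mult_mono) auto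
      then show ?thesis using H2[OF k] unfolding F_def abs_mult[symmetric] by linarith
    qed
    have main: "\<exists>a. a \<noteq> 0 \<and> (\<forall>k<n. \<bar>v k / a - u k\<bar> \<le> K * B / real n)"
      if r: "0 < r" "r * ip n u u \<le> ip n (wlap n A u) u" and v: "\<And>k. k < n \<Longrightarrow> wlap n A v k = r * v k" "ip n v v > 0" for v r
    proof -
      have uu: "ip n u u > 0" using unorm const n0 by (meson less_le_trans mult_pos_pos)
      have "(\<Sum>k<n. r * v k) = (\<Sum>k<n. wlap n A v k)" using v by simp
      then have vsum: "(\<Sum>k<n. v k) = 0" using wlap_mean_zero[OF symA] r by (simp flip: sum_distrib_left)
      \<comment> \<open>The coefficient of the projection of \<open>v\<close> onto \<open>u\<close>;
        \<open>h\<close> is the rest. The bound on \<open>h\<close> will be proportional to |a|, and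
        this forces a \<noteq> 0.\<close>
      define a where "a = ip n v u / ip n u u"
      define h where "h k = v k - a * u k" for k
      have hsum: "(\<Sum>k<n. h k) = 0" using vsum usum by (simp add: h_def sum_subtractf flip: sum_distrib_left)
      have "ip n u h = ip n v u - a * ip n u u"
        by (simp add: h_def[abs_def] ip_simps ip_commute[of n u v])
      then have hu: "ip n u h = 0" using uu by (simp add: a_def)
      have uW: "ip n (wlap n W u) g = \<mu> * ip n u g" for g
        using ip_cong[of n "wlap n W u" "\<lambda>k. \<mu> * u k" g g] ueig by (simp add: ip_simps)
      have vA: "ip n (wlap n A v) g = r * ip n v g" for g
        using ip_cong[of n "wlap n A v" "\<lambda>k. r * v k" g g] v by (simp add: ip_simps)
      \<comment> \<open>So far \<open>r\<close> is bounded only from above and only up to \<omega>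
        n. This suffices to keep it well below the next eigenvalue.\<close>
      have rmu: "r \<le> \<mu> + \<omega> * real n"
      proof -
        have "r * ip n u u \<le> (\<mu> + \<omega> * real n) * ip n u u"
          using r(2) form[of u] unfolding ipAWF uW by (simp add: abs_le_iff algebra_simps)
        then show ?thesis using uu by simp
      qed
      have vsplit: "v = (\<lambda>k. a * u k + h k)" by (auto simp: h_def)
      have wAv: "wlap n A v = (\<lambda>k. a * wlap n A u k + wlap n A h k)"
        unfolding vsplit by (rule ext) (simp add: wlap_add wlap_scale)
      have "r * ip n h h = ip n (wlap n A v) h" unfolding vA by (subst vsplit) (simp add: ip_simps hu)
      also have "\<dots> = a * ip n (F u) h + ip n (wlap n W h) h + ip n (F h) h"
        unfolding wAv by (simp add: ip_simps ipAWF uW hu)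
      finally have e1: "r * ip n h h = a * ip n (F u) h + ip n (wlap n W h) h + ip n (F h) h" .
      have e2: "\<gamma> / 2 * real n * ip n h h \<le> \<bar>a\<bar> * \<bar>ip n (F u) h\<bar>"
      proof -
        have "r * ip n h h \<le> (\<mu> + \<omega> * real n) * ip n h h" using rmu by (intro mult_right_mono ip_nonneg)
        moreover have "\<omega> * real n * ip n h h \<le> \<gamma> / 4 * real n * ip n h h"
          using \<omega>(2) ip_nonneg by (intro mult_right_mono) auto
        moreover have "- (a * ip n (F u) h) \<le> \<bar>a\<bar> * \<bar>ip n (F u) h\<bar>" by (metis abs_ge_minus_self abs_mult)
        ultimately show ?thesis using e1 gap[OF hsum hu] form[of h] by (simp add: abs_le_iff algebra_simps)
      qed
      have Fug: "\<bar>ip n (F u) g\<bar> \<le> 2 * B * sqrt (real n) * sqrt (ip n g g)" for g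
        using abs_sum_le_sqrt_ip[of n "F u" "2 * B" g] Fu B1 by simp
      have hn: "sqrt (ip n h h) * sqrt (real n) \<le> \<bar>a\<bar> * (4 * B / \<gamma>)"
      proof (cases "ip n h h > 0")
        case False
        then have "ip n h h = 0" using ip_nonneg[of n h] by linarith
        then show ?thesis using B1 const by simp
      next
        case True
        define s where "s = sqrt (ip n h h)"
        define t where "t = sqrt (real n)"
        have s: "s > 0" "ip n h h = s * s" using True by (auto simp: s_def)
        have t: "t > 0" "real n = t * t" using n0 by (auto simp: t_def)
        have "\<gamma> / 2 * real n * ip n h h \<le> \<bar>a\<bar> * (2 * B * t * s)"
          using e2 mult_left_mono[OF Fug[of h], of "\<bar>a\<bar>"] unfolding s_def t_def by linarith
        then have "(\<gamma> / 2 * (s * t)) * (s * t) \<le> (\<bar>a\<bar> * (2 * B)) * (s * t)"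
          unfolding s(2) t(2) by (simp add: algebra_simps)
        then have "\<gamma> / 2 * (s * t) \<le> \<bar>a\<bar> * (2 * B)" using s t by (simp add: mult_le_cancel_right_pos)
        then show ?thesis using const unfolding s_def[symmetric] t_def[symmetric] by (simp add: field_simps)
      qed
      have a0: "a \<noteq> 0"
      proof
        assume "a = 0"
        then have "sqrt (ip n h h) * sqrt (real n) \<le> 0" using hn by simp
        then have "ip n h h \<le> 0" using n0 by (simp add: mult_le_0_iff)
        moreover have "h = v" using \<open>a = 0\<close> by (auto simp: h_def)
        ultimately show False using v(2) by simp
      qed
      define e where "e k = v k / a - u k" for k
      define w where "w k = v k / a" for k
      have we: "w = (\<lambda>k. u k + e k)" by (auto simp: w_def e_def)
      have eh: "e = (\<lambda>k. (1 / a) * h k)" using a0 by (auto simp: e_def h_def field_simps)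
      have en: "sqrt (ip n e e) * sqrt (real n) \<le> 4 * B / \<gamma>"
      proof -
        have "ip n e e = (1 / a)\<^sup>2 * ip n h h" unfolding eh ip_scale_left ip_scale_right by (simp add: power2_eq_square)
        then have "sqrt (ip n e e) = 1 / \<bar>a\<bar> * sqrt (ip n h h)" by (simp add: real_sqrt_mult real_sqrt_divide)
        then have "\<bar>a\<bar> * (sqrt (ip n e e) * sqrt (real n)) \<le> \<bar>a\<bar> * (4 * B / \<gamma>)" using hn a0 by simp
        then show ?thesis by (rule mult_left_le_imp_le) (use a0 in simp)
      qed
      have eu: "ip n e u = 0" unfolding eh ip_scale_left using hu by (simp add: ip_commute[of n h u])
      have ww: "wlap n A w k = r * w k" if "k < n" for k
      proof -
        have "w = (\<lambda>k. (1 / a) * v k)" by (auto simp: w_def)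
        then show ?thesis using v(1)[OF that] wlap_scale[of n A "1 / a" v k] by simp
      qed
      \<comment> \<open>Testing the equation for \<open>w\<close> against \<open>u\<close>, with
        \<open>e\<close> orthogonal to \<open>u\<close>, improves the location of the eigenvalue
        from \<omega> n to O(B); \<open>e\<close> enters only through
        \<open>ip n (F u) e\<close>.\<close>
      have rmu2: "\<bar>r - \<mu>\<bar> \<le> 3 * B / c'"
      proof -
        have "ip n (wlap n A w) u = r * ip n w u"
          using ip_cong[of n "wlap n A w" "\<lambda>k. r * w k" u u] ww by (simp add: ip_simps)
        also have "ip n w u = ip n u u" unfolding we by (simp add: ip_simps eu)
        finally have "r * ip n u u = ip n w (wlap n A u)" using wlap_self_adjoint[OF symA] by simp
        also have "\<dots> = ip n (wlap n W u) w + ip n (F u) w" by (subst ip_commute) (rule ipAWF)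
        also have "\<dots> = \<mu> * ip n u u + ip n (F u) u + ip n (F u) e"
          unfolding uW we by (simp add: ip_simps eu ip_commute[of n u e])
        finally have d: "(r - \<mu>) * ip n u u = ip n (F u) u + ip n (F u) e" by (simp add: algebra_simps)
        have "\<bar>ip n (F u) u\<bar> \<le> 2 * B * real n"
        proof -
          have "ip n u u \<le> (\<Sum>k<n. 1)" unfolding ip_def
          proof (rule sum_mono)
            fix k assume "k \<in> {..<n}"
            then have "\<bar>u k\<bar> * \<bar>u k\<bar> \<le> 1 * 1" using uabs by (intro mult_mono) auto
            then show "u k * u k \<le> 1" by (simp add: abs_mult_self_eq)
          qed
          then have "sqrt (ip n u u) \<le> sqrt (real n)" by simp
          then have "2 * B * sqrt (real n) * sqrt (ip n u u) \<le> 2 * B * sqrt (real n) * sqrt (real n)"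
            using B1 by (intro mult_left_mono) auto
          then show ?thesis using Fug[of u] by simp
        qed
        moreover have "\<bar>ip n (F u) e\<bar> \<le> B * real n"
        proof -
          have "\<bar>ip n (F u) e\<bar> \<le> 2 * B * (sqrt (ip n e e) * sqrt (real n))" using Fug[of e] by (simp add: ac_simps)
          also have "\<dots> \<le> 2 * B * (4 * B / \<gamma>)" using en B1 by (intro mult_left_mono) auto
          also have "\<dots> = B * (8 * B / \<gamma>)" by simp
          also have "\<dots> \<le> B * real n"
          proof -
            have "B \<le> \<gamma> / 8 * real n" by (rule Bq[OF \<eta>(4)])
            then have "8 * B / \<gamma> \<le> real n" using const by (simp add: field_simps)
            then show ?thesis using B1 by (intro mult_left_mono) auto
          qed
          finally show ?thesis .
        qed
        ultimately have "\<bar>(r - \<mu>) * ip n u u\<bar> \<le> 3 * B * real n" unfolding d by linarith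
        then have "\<bar>r - \<mu>\<bar> * ip n u u \<le> 3 * B * real n" using uu by (simp add: abs_mult)
        moreover have "\<bar>r - \<mu>\<bar> * (c' * real n) \<le> \<bar>r - \<mu>\<bar> * ip n u u" using unorm by (intro mult_left_mono) auto
        ultimately have "(\<bar>r - \<mu>\<bar> * c') * real n \<le> (3 * B) * real n" by (simp add: algebra_simps)
        then have "\<bar>r - \<mu>\<bar> * c' \<le> 3 * B" using n0 by (simp add: mult_le_cancel_right_pos)
        then show ?thesis using const by (simp add: field_simps)
      qed
      have point: "\<bar>e k\<bar> \<le> K * B / real n" if k: "k < n" for k
      proof -
        define D where "D = (\<Sum>l<n. A k l)"
        have wl: "wlap n A f k = D * f k - ip n (A k) f" for f
          by (simp add: wlap_def D_def ip_def right_diff_distrib sum_subtractf sum_distrib_right)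
        have "wlap n A w k = wlap n A u k + wlap n A e k" unfolding we by (rule wlap_add)
        then have "r * (u k + e k) = \<mu> * u k + F u k + (D * e k - ip n (A k) e)"
          using ww[OF k] AWF[OF k, of u] ueig[OF k] wl[of e] by (simp add: we)
        \<comment> \<open>Row \<open>k\<close> solved for \<open>e k\<close>. The right side is
          O(B): entries of \<open>A\<close> are at most 1, so Cauchy-Schwarz bounds the first term
          by sqrt n times the l2 norm of \<open>e\<close>, which is exactly what \<open>en\<close>
          controls.\<close>
        then have eq: "(D - r) * e k = ip n (A k) e - F u k + (r - \<mu>) * u k" by (simp add: algebra_simps)
        have "\<bar>ip n (A k) e\<bar> \<le> 4 * B / \<gamma>"
          using abs_sum_le_sqrt_ip[of n "A k" 1 e] A01[OF k] en by (simp add: mult.commute)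
        moreover have "\<bar>(r - \<mu>) * u k\<bar> \<le> 3 * B / c'"
        proof -
          have "\<bar>r - \<mu>\<bar> * \<bar>u k\<bar> \<le> (3 * B / c') * 1" using rmu2 uabs[OF k] B1 const by (intro mult_mono) auto
          then show ?thesis by (simp add: abs_mult)
        qed
        ultimately have num: "\<bar>(D - r) * e k\<bar> \<le> 4 * B / \<gamma> + 2 * B + 3 * B / c'"
          unfolding eq using Fu[OF k] by linarith
        \<comment> \<open>\<open>A\<close> has zero diagonal while \<open>W k k\<close> can be as
          large as 1, which accounts for the extra 1. The losses B, 1 and \<omega> n together use up
          at most half of the degree gap.\<close>
        have "D - r \<ge> c0 / 2 * real n"
        proof -
          have "(\<Sum>l<n. W k l) = (\<Sum>l<n. A k l - E k l + (if k = l then W k l else 0))"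
            by (intro sum.cong) (auto simp: Edef A0)
          also have "\<dots> = D - (\<Sum>l<n. E k l) + W k k"
            using k by (simp add: sum.distrib sum_subtractf D_def)
          finally have "D \<ge> \<mu> + c0 * real n - B - 1" using deg[OF k] H1[OF k] W01[OF k k] by (simp add: abs_le_iff)
          moreover have "B \<le> c0 / 8 * real n" by (rule Bq[OF \<eta>(5)])
          moreover have "\<omega> * real n \<le> c0 / 4 * real n" using \<omega>(4) by (intro mult_right_mono) auto
          ultimately show ?thesis using rmu B1 by linarith
        qed
        moreover have "c0 / 2 * real n > 0" using const n0 by simp
        ultimately have "c0 / 2 * real n * \<bar>e k\<bar> \<le> \<bar>D - r\<bar> * \<bar>e k\<bar>" by (intro mult_right_mono) auto
        then have "c0 / 2 * real n * \<bar>e k\<bar> \<le> 4 * B / \<gamma> + 2 * B + 3 * B / c'" using num by (simp add: abs_mult)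
        also have "\<dots> = (4 / \<gamma> + 2 + 3 / c') * B" by (simp add: algebra_simps)
        finally have "\<bar>e k\<bar> * real n \<le> K * B" using const by (simp add: K_def field_simps)
        then show ?thesis using n0 by (simp add: field_simps)
      qed
      show ?thesis using a0 point unfolding e_def by blast
    qed
    show ?case using pd main by blast
  qed
qed

section \<open>The subroutine\<close>

text \<open>Two one-sided discrepancy bounds, with a weak inequality in the first count and a strict
  one in the second, so that the reflection 1 - y exchanges the two halves exactly.\<close>

definition equid :: "nat set \<Rightarrow> (nat \<Rightarrow> real) \<Rightarrow> real \<Rightarrow> bool" where
  "equid S y b \<longleftrightarrow> (\<forall>z\<ge>0. real (card {s\<in>S. y s \<le> z}) \<le> (z + b) * real (card S)) \<and>
     (\<forall>z\<le>1. (z - b) * real (card S) \<le> real (card {s\<in>S. y s < z}))"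

definition near_order :: "nat set \<Rightarrow> (nat \<Rightarrow> nat) \<Rightarrow> (nat \<Rightarrow> real) \<Rightarrow> real \<Rightarrow> bool" where
  "near_order S \<sigma> y e \<longleftrightarrow> (\<forall>v\<in>S. \<bar>real (\<sigma> v) - real (card S) * y v\<bar> \<le> e * real (card S))"

definition edge_counts_near :: "(real \<Rightarrow> real) \<Rightarrow> (nat \<times> nat \<Rightarrow> bool) \<Rightarrow> nat set \<Rightarrow> nat set \<Rightarrow> (nat \<Rightarrow> bool) \<Rightarrow> (nat \<Rightarrow> real) \<Rightarrow> real \<Rightarrow> bool" where
  "edge_counts_near R G T S Q y e \<longleftrightarrow> (\<forall>v\<in>S.
     \<bar>real (card {t\<in>{t\<in>T. Q t}. adj G t v}) - (\<Sum>t\<in>{t\<in>T. Q t}. R \<bar>y t - y v\<bar>)\<bar> \<le> e * real (card T))"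

lemma equid_le: "equid S y b \<Longrightarrow> 0 \<le> z \<Longrightarrow> real (card {s\<in>S. y s \<le> z}) \<le> (z + b) * real (card S)"
  and equid_ge: "equid S y b \<Longrightarrow> z \<le> 1 \<Longrightarrow> (z - b) * real (card S) \<le> real (card {s\<in>S. y s < z})"
  by (auto simp: equid_def)

lemma card_split:
  assumes "finite S"
  shows "real (card {s\<in>S. P s}) + real (card {s\<in>S. \<not> P s}) = real (card S)"
proof -
  have "{s\<in>S. P s} \<union> {s\<in>S. \<not> P s} = S" "{s\<in>S. P s} \<inter> {s\<in>S. \<not> P s} = {}" by auto
  then have "card S = card {s\<in>S. P s} + card {s\<in>S. \<not> P s}"
    using card_Un_disjoint[of "{s\<in>S. P s}" "{s\<in>S. \<not> P s}"] assms by simp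
  then show ?thesis by simp
qed

lemma equid_flip:
  assumes S: "finite S" and e: "equid S y b"
  shows "equid S (\<lambda>s. 1 - y s) b"
  unfolding equid_def
proof (intro conjI allI impI)
  fix z :: real assume "z \<ge> 0"
  have "{s\<in>S. 1 - y s \<le> z} = {s\<in>S. \<not> y s < 1 - z}" by auto
  then show "real (card {s\<in>S. 1 - y s \<le> z}) \<le> (z + b) * real (card S)"
    using card_split[OF S, of "\<lambda>s. y s < 1 - z"] equid_ge[OF e, of "1 - z"] \<open>z \<ge> 0\<close>
    by (simp add: algebra_simps)
next
  fix z :: real assume "z \<le> 1"
  have "{s\<in>S. 1 - y s < z} = {s\<in>S. \<not> y s \<le> 1 - z}" by auto
  then show "(z - b) * real (card S) \<le> real (card {s\<in>S. 1 - y s < z})"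
    using card_split[OF S, of "\<lambda>s. y s \<le> 1 - z"] equid_le[OF e, of "1 - z"] \<open>z \<le> 1\<close>
    by (simp add: algebra_simps)
qed

text \<open>Valid for every way of breaking ties: a rank lies between the number of strictly smaller
  values and the number of values that are not larger. Vertices more than \<open>a\<close> apart are
  compared correctly by \<open>f\<close>, and counting the others costs \<open>b\<close>.\<close>

lemma rank_ordering_near:
  assumes S: "finite S" and e: "equid S y b" and y: "\<And>s. s \<in> S \<Longrightarrow> 0 \<le> y s \<and> y s \<le> 1" and a: "0 \<le> a"
    and f: "\<And>u v. u \<in> S \<Longrightarrow> v \<in> S \<Longrightarrow> y u + a < y v \<Longrightarrow> f u < f v"
    and \<sigma>: "\<sigma> \<in> rank_orderings S f"
  shows "near_order S \<sigma> y (a + b)"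
  unfolding near_order_def
proof
  fix v assume v: "v \<in> S"
  have \<sigma>v: "card {s\<in>S. f s < f v} < \<sigma> v" "\<sigma> v \<le> card {s\<in>S. f s \<le> f v}"
    using \<sigma> v by (auto simp: rank_orderings_def)
  have "{s\<in>S. f s \<le> f v} \<subseteq> {s\<in>S. y s \<le> y v + a}" using f[OF v] by force
  then have "card {s\<in>S. f s \<le> f v} \<le> card {s\<in>S. y s \<le> y v + a}" using S by (intro card_mono) auto
  moreover have "real (card {s\<in>S. y s \<le> y v + a}) \<le> (y v + a + b) * real (card S)"
    using y[OF v] a by (intro equid_le[OF e]) auto
  ultimately have up: "real (\<sigma> v) \<le> (y v + a + b) * real (card S)" using \<sigma>v by linarith
  have "{s\<in>S. y s < y v - a} \<subseteq> {s\<in>S. f s < f v}" using f[OF _ v] by force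
  then have "card {s\<in>S. y s < y v - a} \<le> card {s\<in>S. f s < f v}" using S by (intro card_mono) auto
  moreover have "(y v - a - b) * real (card S) \<le> real (card {s\<in>S. y s < y v - a})"
    using y[OF v] a by (intro equid_ge[OF e]) auto
  ultimately have "(y v - a - b) * real (card S) \<le> real (\<sigma> v)" using \<sigma>v by linarith
  with up show "\<bar>real (\<sigma> v) - real (card S) * y v\<bar> \<le> (a + b) * real (card S)"
    by (simp add: abs_le_iff algebra_simps)
qed

text \<open>The threshold is the empirical 0.69-quantile of \<open>p\<close>. A vertex far right of
  0.69 has at least 69 percent of \<open>S\<close> strictly below it in \<open>p\<close>; for one
  far left, every level below the values of the vertices to its right captures fewer than 69
  percent. The tolerances fit between 0.69 and 0.7, up to where \<open>p\<close> is known to order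
  vertices correctly.\<close>

lemma cthr_split:
  fixes p y :: "nat \<Rightarrow> real"
  assumes S: "finite S" "S \<noteq> {}" and e: "equid S y e" "0 \<le> e" and p: "\<And>s. 0 \<le> p s"
    and mono: "\<And>u v. u \<in> S \<Longrightarrow> v \<in> S \<Longrightarrow> y u \<le> 7/10 \<Longrightarrow> y u + a < y v \<Longrightarrow> p u < p v"
    and a: "0 < a" "a + 2 * e \<le> 1/100"
    and v: "v \<in> S"
  shows "p v < cthr p S (31/100) \<Longrightarrow> y v \<le> 69/100 + (a + 2 * e)"
    and "cthr p S (31/100) \<le> p v \<Longrightarrow> 69/100 - (a + 2 * e) \<le> y v"
proof -
  let ?C = "{c. c \<ge> 0 \<and> real (card {v\<in>S. p v \<le> c}) \<ge> (1 - 31/100) * real (card S)}"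
  have c: "cthr p S (31/100) = Inf ?C" by (simp add: cthr_def)
  have cS: "real (card S) > 0" using S by (simp add: card_gt_0_iff)
  have bdd: "bdd_below ?C" by (rule bdd_belowI[of _ 0]) auto
  show "y v \<le> 69/100 + (a + 2 * e)" if lt: "p v < cthr p S (31/100)"
  proof (rule ccontr)
    assume "\<not> y v \<le> 69/100 + (a + 2 * e)"
    then have yv: "69/100 + 2 * e + a < y v" by simp
    define X where "X = {u\<in>S. y u < 69/100 + 2 * e}"
    have X: "finite X" using S by (simp add: X_def)
    have "(69/100 + 2 * e - e) * real (card S) \<le> real (card X)"
      unfolding X_def using a e by (intro equid_ge[OF e(1)]) auto
    moreover have "69/100 * real (card S) \<le> (69/100 + 2 * e - e) * real (card S)"
      using e cS by (intro mult_right_mono) auto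
    ultimately have cX: "69/100 * real (card S) \<le> real (card X)" by linarith
    then have "X \<noteq> {}" using cS by auto
    define c0 where "c0 = Max (p ` X)"
    have c0in: "c0 \<in> p ` X" unfolding c0_def using X \<open>X \<noteq> {}\<close> by (intro Max_in) auto
    then obtain u where u: "u \<in> X" "c0 = p u" by auto
    have "p u < p v" using u a e yv by (intro mono v) (auto simp: X_def)
    have "X \<subseteq> {v\<in>S. p v \<le> c0}" using X by (auto simp: c0_def X_def)
    then have "card X \<le> card {v\<in>S. p v \<le> c0}" using S by (intro card_mono) auto
    then have "c0 \<in> ?C" using cX u p by auto
    then have "Inf ?C \<le> c0" using bdd by (rule cInf_lower)
    then show False using lt c u \<open>p u < p v\<close> by simp
  qed
  show "69/100 - (a + 2 * e) \<le> y v" if ge: "cthr p S (31/100) \<le> p v"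
  proof (rule ccontr)
    assume "\<not> 69/100 - (a + 2 * e) \<le> y v"
    then have yv: "y v + a + e < 69/100" using e by simp
    have yv7: "y v \<le> 7/10" using yv a e by simp
    have small: "real (card {u\<in>S. y u \<le> y v + a}) < 69/100 * real (card S)"
    proof -
      have "real (card {u\<in>S. y u \<le> y v + a}) \<le> real (card {u\<in>S. y u \<le> max 0 (y v + a)})"
        using S by (intro of_nat_mono card_mono) auto
      also have "\<dots> \<le> (max 0 (y v + a) + e) * real (card S)" by (rule equid_le[OF e(1)]) simp
      also have "\<dots> < 69/100 * real (card S)" using yv cS a e by (intro mult_strict_right_mono) (auto simp: max_def)
      finally show ?thesis .
    qed
    define Y where "Y = {u\<in>S. y v + a < y u}"
    have fY: "finite Y" using S by (simp add: Y_def)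
    have "Y \<noteq> {}"
    proof
      assume "Y = {}"
      then have "{u\<in>S. y u \<le> y v + a} = S" by (auto simp: Y_def not_less)
      then show False using small cS by simp
    qed
    define m where "m = Min (p ` Y)"
    have min: "m \<in> p ` Y" unfolding m_def using fY \<open>Y \<noteq> {}\<close> by (intro Min_in) auto
    then obtain u where u: "u \<in> Y" "m = p u" by auto
    have "p v < p u" using u yv7 by (intro mono v) (auto simp: Y_def)
    \<comment> \<open>The maximum of \<open>p\<close> is an admissible level, so the infimum is
      taken over a nonempty set and can be approached from above.\<close>
    have "Max (p ` S) \<in> ?C"
    proof -
      have "{v\<in>S. p v \<le> Max (p ` S)} = S" using S by auto
      moreover have "0 \<le> Max (p ` S)" using p[of v] S v by (meson Max_ge finite_imageI imageI order_trans)
      ultimately show ?thesis using cS by simp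
    qed
    moreover have "Inf ?C < m" using ge c u \<open>p v < p u\<close> by simp
    ultimately obtain c1 where c1: "c1 \<in> ?C" "c1 < m" using cInf_lessD[of ?C m] by blast
    have "{v\<in>S. p v \<le> c1} \<subseteq> {u\<in>S. y u \<le> y v + a}"
    proof
      fix s assume s: "s \<in> {v\<in>S. p v \<le> c1}"
      have "s \<notin> Y"
      proof
        assume "s \<in> Y"
        then have "m \<le> p s" unfolding m_def using fY by (intro Min_le) auto
        then show False using s c1 by simp
      qed
      then show "s \<in> {u\<in>S. y u \<le> y v + a}" using s by (auto simp: Y_def)
    qed
    then have "card {v\<in>S. p v \<le> c1} \<le> card {u\<in>S. y u \<le> y v + a}" using S by (intro card_mono) auto
    then show False using c1(1) small by simp
  qed
qed

text \<open>The clauses of \<open>Fhat0\<close> match three situations. Two vertices below the right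
  threshold are both left of 0.7; two below the left threshold are both right of 0.3; otherwise one
  is left of about 0.31 and the other right of about 0.69, and the right count alone tells them
  apart.\<close>

lemma Fhat_correct:
  fixes y pR pL :: "nat \<Rightarrow> real"
  assumes mR: "\<And>u v. u \<in> S \<Longrightarrow> v \<in> S \<Longrightarrow> y u \<le> 7/10 \<Longrightarrow> y u + a < y v \<Longrightarrow> pR u < pR v"
    and mL: "\<And>u v. u \<in> S \<Longrightarrow> v \<in> S \<Longrightarrow> 3/10 \<le> y v \<Longrightarrow> y u + a < y v \<Longrightarrow> pL v < pL u"
    and cR: "\<And>v. v \<in> S \<Longrightarrow> pR v < cR \<Longrightarrow> y v \<le> 69/100 + d" "\<And>v. v \<in> S \<Longrightarrow> cR \<le> pR v \<Longrightarrow> 69/100 - d \<le> y v"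
    and cL: "\<And>v. v \<in> S \<Longrightarrow> pL v < cL \<Longrightarrow> 31/100 - d \<le> y v" "\<And>v. v \<in> S \<Longrightarrow> cL \<le> pL v \<Longrightarrow> y v \<le> 31/100 + d"
    and d: "0 \<le> d" "d \<le> 1/100" "0 \<le> a"
    and uv: "u \<in> S" "v \<in> S" "y u + a < y v"
  shows "Fhat pR pL cR cL u v = 1" "Fhat pR pL cR cL v u = -1"
proof -
  \<comment> \<open>\<open>Fhat\<close> passes the smaller label first, while \<open>y\<close> may
    run against the labels, so both orders of the arguments are treated.\<close>
  have *: "Fhat0 pR pL cR cL u v = 1 \<and> Fhat0 pR pL cR cL v u = -1"
  proof (cases "pR u < cR \<and> pR v < cR")
    case True
    then have "pR u < pR v" using cR(1)[OF uv(1)] d uv by (intro mR) auto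
    then show ?thesis using True by (simp add: Fhat0_def)
  next
    case nR: False
    show ?thesis
    proof (cases "pL u < cL \<and> pL v < cL")
      case True
      then have "pL v < pL u" using cL(1)[OF uv(2)] d uv by (intro mL) auto
      then show ?thesis using True nR by (auto simp: Fhat0_def)
    next
      case nL: False
      have "69/100 - d \<le> y v" using nR cR(2)[OF uv(1)] cR(2)[OF uv(2)] uv d by fastforce
      have yu: "y u \<le> 31/100 + d" using nL cL(2)[OF uv(1)] cL(2)[OF uv(2)] uv d by fastforce
      have "pR u < cR" using cR(2)[OF uv(1)] yu d by fastforce
      then show ?thesis using nR nL by (auto simp: Fhat0_def)
    qed
  qed
  have "u \<noteq> v" using uv d by auto
  then show "Fhat pR pL cR cL u v = 1" "Fhat pR pL cR cL v u = -1"
    using * by (auto simp: Fhat_def)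
qed

lemma Fhat_bounds: "-1 \<le> Fhat pR pL cR cL u v" "Fhat pR pL cR cL u v \<le> 1"
  by (auto simp: Fhat_def Fhat0_def)

lemma sum_sign_ge:
  fixes F :: "nat \<Rightarrow> int"
  assumes S: "finite S" and F: "\<And>s. s \<in> S \<Longrightarrow> -1 \<le> F s" "\<And>s. s \<in> S \<Longrightarrow> P s \<Longrightarrow> F s = 1"
  shows "2 * real (card {s\<in>S. P s}) - real (card S) \<le> real_of_int (\<Sum>s\<in>S. F s)"
proof -
  have "(\<Sum>s\<in>S. if P s then 1 else -1) \<le> (\<Sum>s\<in>S. F s)"
    using F by (intro sum_mono) auto
  moreover have "(\<Sum>s\<in>S. if P s then 1 else -1) = int (card {s\<in>S. P s}) - int (card {s\<in>S. \<not> P s})"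
    using S by (simp add: sum.If_cases Int_def)
  ultimately have "real (card {s\<in>S. P s}) - real (card {s\<in>S. \<not> P s}) \<le> real_of_int (\<Sum>s\<in>S. F s)"
    by linarith
  then show ?thesis using card_split[OF S, of P] by linarith
qed

section \<open>Expected edge counts into the end blocks and the resulting order\<close>

context profile
begin

text \<open>For v \<le> 0.9 the block lies to the right of both points: every term gains by
  monotonicity, and the vertices below 0.975 keep distances where R has slope at least m. For v >
  0.9 the point may lie inside the block, but then block vertices are within 1/10 of v and at least
  1/4 away from w, a gain bounded below.\<close>

lemma right_profile_increases:
  obtains c e1 where "c > 0" "e1 > 0"
    "\<And>T y e w v. finite T \<Longrightarrow> equid T y e \<Longrightarrow> e \<le> e1 \<Longrightarrow> (\<And>t. t \<in> T \<Longrightarrow> y t \<le> 1) \<Longrightarrow>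
       0 \<le> w \<Longrightarrow> w \<le> 7/10 \<Longrightarrow> w < v \<Longrightarrow> v \<le> 1 \<Longrightarrow>
       c * (v - w) * real (card T) \<le> (\<Sum>t\<in>{t\<in>T. 95/100 \<le> y t}. R \<bar>y t - v\<bar>) - (\<Sum>t\<in>{t\<in>T. 95/100 \<le> y t}. R \<bar>y t - w\<bar>)"
proof -
  obtain m where m: "m > 0" "\<And>a b. 25/1000 \<le> a \<Longrightarrow> a \<le> b \<Longrightarrow> b \<le> 1 - 25/1000 \<Longrightarrow> m * (b - a) \<le> R a - R b"
    using R_slope[of "25/1000"] by auto
  show thesis
  \<comment> \<open>With e \<le> 1/400 both the window of length 0.025 and the whole block contain
    at least 2 percent of \<open>T\<close>; 3/1000 is 0.02 times 1/4 - 1/10.\<close>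
  proof (rule that[of "3/1000 * m" "1/400"])
    show "3/1000 * m > 0" "(1/400::real) > 0" using m by auto
    fix T :: "nat set" and y :: "nat \<Rightarrow> real" and e w v :: real
    assume T: "finite T" and e: "equid T y e" "e \<le> 1/400" and y: "\<And>t. t \<in> T \<Longrightarrow> y t \<le> 1"
      and w: "0 \<le> w" "w \<le> 7/10" "w < v" "v \<le> 1"
    let ?R0 = "{t\<in>T. 95/100 \<le> y t}"
    let ?g = "\<lambda>t. (R \<bar>y t - v\<bar>) - (R \<bar>y t - w\<bar>)"
    have T': "finite {t\<in>T. Q t}" for Q using T by simp
    have below: "real (card {t\<in>T. y t \<le> 95/100}) \<le> (95/100 + e) * real (card T)" by (rule equid_le[OF e(1)]) simp
    have below': "real (card {t\<in>T. y t < 95/100}) \<le> (95/100 + e) * real (card T)"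
    proof -
      have "card {t\<in>T. y t < 95/100} \<le> card {t\<in>T. y t \<le> 95/100}" using T by (intro card_mono) auto
      then show ?thesis using below by linarith
    qed
    have eT: "e * real (card T) \<le> 1/400 * real (card T)" using e by (intro mult_right_mono) auto
    have sum: "(\<Sum>t\<in>?R0. R \<bar>y t - v\<bar>) - (\<Sum>t\<in>?R0. R \<bar>y t - w\<bar>) = (\<Sum>t\<in>?R0. ?g t)" by (simp add: sum_subtractf)
    have "3/1000 * m * (v - w) * real (card T) \<le> (\<Sum>t\<in>?R0. ?g t)"
    proof (cases "v \<le> 9/10")
      case True
      let ?D = "{t\<in>T. 95/100 \<le> y t \<and> y t < 975/1000}"
      have "{t\<in>T. y t < 975/1000} = {t\<in>T. y t < 95/100} \<union> ?D" by auto
      moreover have "card ({t\<in>T. y t < 95/100} \<union> ?D) \<le> card {t\<in>T. y t < 95/100} + card ?D" by (rule card_Un_le)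
      moreover have "(975/1000 - e) * real (card T) \<le> real (card {t\<in>T. y t < 975/1000})" by (rule equid_ge[OF e(1)]) simp
      ultimately have "(975/1000 - e) * real (card T) - (95/100 + e) * real (card T) \<le> real (card ?D)"
        using below' by simp
      then have cD: "2/100 * real (card T) \<le> real (card ?D)" using eT by (simp add: algebra_simps)
      have "3/1000 * m * (v - w) * real (card T) \<le> (2/100 * real (card T)) * (m * (v - w))"
      proof -
        have "0 \<le> m * (v - w) * real (card T)" using m w by simp
        then have "3/1000 * (m * (v - w) * real (card T)) \<le> 2/100 * (m * (v - w) * real (card T))"
          by (intro mult_right_mono) auto
        then show ?thesis by (simp only: ac_simps)
      qed
      also have "\<dots> \<le> real (card ?D) * (m * (v - w))" using cD m w by (intro mult_right_mono) auto
      also have "\<dots> \<le> (\<Sum>t\<in>?D. ?g t)"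
      proof (rule sum_bounded_below)
        fix t assume t: "t \<in> ?D"
        have "m * ((y t - w) - (y t - v)) \<le> R (y t - v) - R (y t - w)"
          using t w True by (intro m(2)) auto
        then show "m * (v - w) \<le> ?g t" using t w True by (simp add: abs_if)
      qed
      also have "\<dots> \<le> (\<Sum>t\<in>?R0. ?g t)"
      proof (rule sum_mono2[OF T'])
        fix t assume t: "t \<in> ?R0 - ?D"
        have "R (y t - w) \<le> R (y t - v)" using t w True y[of t] by (intro R_mono) auto
        then show "0 \<le> ?g t" using t w True by (simp add: abs_if)
      qed auto
      finally show ?thesis .
    next
      case False
      have "(1 - (95/100 + e)) * real (card T) \<le> real (card {t\<in>T. \<not> y t < 95/100})"
        using card_split[OF T, of "\<lambda>t. y t < 95/100"] below' by (simp add: algebra_simps)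
      moreover have "{t\<in>T. \<not> y t < 95/100} = ?R0" by auto
      ultimately have cR: "2/100 * real (card T) \<le> real (card ?R0)" using eT by (simp add: algebra_simps)
      have "3/1000 * m * (v - w) * real (card T) = (2/100 * real (card T)) * (15/100 * m) * (v - w)"
        by simp
      also have "\<dots> \<le> (2/100 * real (card T)) * (15/100 * m) * 1"
        using m w by (intro mult_left_mono) auto
      also have "\<dots> \<le> real (card ?R0) * (15/100 * m)" using mult_right_mono[OF cR, of "15/100 * m"] m by simp
      also have "\<dots> \<le> (\<Sum>t\<in>?R0. ?g t)"
      proof (rule sum_bounded_below)
        fix t assume t: "t \<in> ?R0"
        have "\<bar>y t - v\<bar> \<le> 1/10" by (rule abs_leI) (use t w False y[of t] in auto)
        then have "R (1/10) \<le> R \<bar>y t - v\<bar>" by (intro R_mono) auto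
        moreover have "R \<bar>y t - w\<bar> \<le> R (1/4)" using t w y[of t] by (intro R_mono) auto
        moreover have "m * (1/4 - 1/10) \<le> R (1/10) - R (1/4)" by (intro m(2)) auto
        ultimately show "15/100 * m \<le> ?g t" by simp
      qed
      finally show ?thesis .
    qed
    then show "3/1000 * m * (v - w) * real (card T) \<le> (\<Sum>t\<in>?R0. R \<bar>y t - v\<bar>) - (\<Sum>t\<in>?R0. R \<bar>y t - w\<bar>)"
      unfolding sum .
  qed
qed

text \<open>Q is the empirical version of the block of vertices with y at least 0.95.\<close>
lemma psi_increases:
  obtains K0 e1 where "K0 > 0" "e1 > 0"
    "\<And>T S G y e Q u v. finite T \<Longrightarrow> T \<noteq> {} \<Longrightarrow> equid T y e \<Longrightarrow> 0 < e \<Longrightarrow> e \<le> e1 \<Longrightarrow>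
       (\<And>t. t \<in> T \<union> S \<Longrightarrow> 0 \<le> y t \<and> y t \<le> 1) \<Longrightarrow> Q \<subseteq> T \<Longrightarrow>
       (\<And>t. t \<in> Q \<Longrightarrow> 95/100 - e \<le> y t) \<Longrightarrow> (\<And>t. t \<in> T \<Longrightarrow> 95/100 + e < y t \<Longrightarrow> t \<in> Q) \<Longrightarrow>
       edge_counts_near R G T S (\<lambda>t. 95/100 \<le> y t) y e \<Longrightarrow>
       u \<in> S \<Longrightarrow> v \<in> S \<Longrightarrow> y u \<le> 7/10 \<Longrightarrow> y u + K0 * e < y v \<Longrightarrow> psi G T Q u < psi G T Q v"
proof -
  obtain c e1 where c: "c > 0" "e1 > 0" and inc: "\<And>T y e w v. finite T \<Longrightarrow> equid T y e \<Longrightarrow> e \<le> e1 \<Longrightarrow> (\<And>t. t \<in> T \<Longrightarrow> y t \<le> 1) \<Longrightarrow>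
       0 \<le> w \<Longrightarrow> w \<le> 7/10 \<Longrightarrow> w < v \<Longrightarrow> v \<le> 1 \<Longrightarrow>
       c * (v - w) * real (card T) \<le> (\<Sum>t\<in>{t\<in>T. 95/100 \<le> y t}. R \<bar>y t - v\<bar>) - (\<Sum>t\<in>{t\<in>T. 95/100 \<le> y t}. R \<bar>y t - w\<bar>)"
    using right_profile_increases by blast
  \<comment> \<open>Each of the two counts has error 5 e: 4 e from the boundary layer of the block
    and e from the noise.\<close>
  define K0 where "K0 = 10 / c"
  show thesis
  proof (rule that[of K0 "min e1 (1/100)"])
    show "K0 > 0" "min e1 (1/100) > 0" using c by (auto simp: K0_def)
    fix T S Q :: "nat set" and G :: "nat \<times> nat \<Rightarrow> bool" and y :: "nat \<Rightarrow> real" and e :: real and u v :: nat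
    assume T: "finite T" "T \<noteq> {}" and e: "equid T y e" "0 < e" "e \<le> min e1 (1/100)"
      and y: "\<And>t. t \<in> T \<union> S \<Longrightarrow> 0 \<le> y t \<and> y t \<le> 1" and Q: "Q \<subseteq> T" "\<And>t. t \<in> Q \<Longrightarrow> 95/100 - e \<le> y t"
        "\<And>t. t \<in> T \<Longrightarrow> 95/100 + e < y t \<Longrightarrow> t \<in> Q"
      and conc: "edge_counts_near R G T S (\<lambda>t. 95/100 \<le> y t) y e"
      and uv: "u \<in> S" "v \<in> S" "y u \<le> 7/10" "y u + K0 * e < y v"
    let ?R0 = "{t\<in>T. 95/100 \<le> y t}"
    have cT: "real (card T) > 0" using T by (simp add: card_gt_0_iff)
    \<comment> \<open>The empirical block \<open>Q\<close> and the fixed block can differ only on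
      this layer.\<close>
    define Z where "Z = {t\<in>T. 95/100 - e \<le> y t \<and> y t \<le> 95/100 + e}"
    have fZ: "finite Z" using T by (simp add: Z_def)
    have cZ: "real (card Z) \<le> 4 * e * real (card T)"
    proof -
      have "Z = {t\<in>T. y t \<le> 95/100 + e} - {t\<in>T. y t < 95/100 - e}" by (auto simp: Z_def)
      moreover have "{t\<in>T. y t < 95/100 - e} \<subseteq> {t\<in>T. y t \<le> 95/100 + e}" using e by auto
      ultimately have "card Z = card {t\<in>T. y t \<le> 95/100 + e} - card {t\<in>T. y t < 95/100 - e}"
        "card {t\<in>T. y t < 95/100 - e} \<le> card {t\<in>T. y t \<le> 95/100 + e}"
        using T by (auto simp: card_Diff_subset intro: card_mono)
      then have "real (card Z) = real (card {t\<in>T. y t \<le> 95/100 + e}) - real (card {t\<in>T. y t < 95/100 - e})"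
        by simp
      also have "\<dots> \<le> (95/100 + e + e) * real (card T) - (95/100 - e - e) * real (card T)"
        using e by (intro diff_mono equid_le[OF e(1)] equid_ge[OF e(1)]) auto
      finally show ?thesis by (simp add: algebra_simps)
    qed
    have psi: "\<bar>psi G T Q s * real (card T) - (\<Sum>t\<in>?R0. R \<bar>y t - y s\<bar>)\<bar> \<le> 5 * e * real (card T)" if s: "s \<in> S" for s
    proof -
      let ?A = "{t\<in>Q. adj G t s}" and ?B = "{t\<in>?R0. adj G t s}"
      have fin: "finite ?A" "finite ?B" using T Q(1) by (auto intro: finite_subset)
      have "?A \<subseteq> ?B \<union> Z" "?B \<subseteq> ?A \<union> Z" using Q by (auto simp: Z_def not_le not_less) force+
      then have "card ?A \<le> card ?B + card Z" "card ?B \<le> card ?A + card Z"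
        using fin fZ by (meson card_Un_le card_mono finite_UnI order_trans)+
      then have "\<bar>real (card ?A) - real (card ?B)\<bar> \<le> real (card Z)" by linarith
      then have "\<bar>real (card ?A) - (\<Sum>t\<in>?R0. R \<bar>y t - y s\<bar>)\<bar> \<le> 5 * e * real (card T)"
        using cZ conc[unfolded edge_counts_near_def] s by (simp add: algebra_simps) force
      moreover have "psi G T Q s * real (card T) = real (card ?A)" using cT by (simp add: psi_def)
      ultimately show ?thesis by simp
    qed
    have lt: "y u < y v" using uv(4) c e by (simp add: K0_def) (smt (verit) divide_pos_pos mult_pos_pos)
    have "c * (y v - y u) * real (card T) \<le> (\<Sum>t\<in>?R0. R \<bar>y t - y v\<bar>) - (\<Sum>t\<in>?R0. R \<bar>y t - y u\<bar>)"
      using y uv e lt by (intro inc[OF T(1) e(1)]) auto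
    moreover have "10 * e * real (card T) < c * (y v - y u) * real (card T)"
    proof -
      have "c * (K0 * e) < c * (y v - y u)" using uv(4) c by (intro mult_strict_left_mono) auto
      then have "10 * e < c * (y v - y u)" using c by (simp add: K0_def)
      then show ?thesis using cT by (intro mult_strict_right_mono) auto
    qed
    ultimately have "psi G T Q u * real (card T) < psi G T Q v * real (card T)"
      using psi[OF uv(1)] psi[OF uv(2)] by (simp add: abs_le_iff)
    then show "psi G T Q u < psi G T Q v" using cT by simp
  qed
qed

text \<open>The left block becomes a right block under the reflection 1 - y, so one monotonicity
  lemma serves both. With a = K0 e, vertices more than \<open>a\<close> apart are compared
  correctly, so the score of \<open>v\<close> is (2 y v - 1) |S| up to 2 (a + e) |S|. Scores then
  separate vertices more than 2 a + 2 e apart, and one more \<open>e\<close> leads from scores to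
  ranks.\<close>

theorem subroutine_near_order:
  obtains K e0 where "K > 0" "e0 > 0"
    "\<And>T S G y e \<sigma>T \<sigma>. finite T \<Longrightarrow> T \<noteq> {} \<Longrightarrow> finite S \<Longrightarrow> S \<noteq> {} \<Longrightarrow> equid T y e \<Longrightarrow> equid S y e \<Longrightarrow> 0 < e \<Longrightarrow> e \<le> e0 \<Longrightarrow>
       (\<And>t. t \<in> T \<union> S \<Longrightarrow> 0 \<le> y t \<and> y t \<le> 1) \<Longrightarrow> near_order T \<sigma>T y e \<Longrightarrow>
       edge_counts_near R G T S (\<lambda>t. 95/100 \<le> y t) y e \<Longrightarrow>
       edge_counts_near R G T S (\<lambda>t. y t \<le> 5/100) y e \<Longrightarrow>
       \<sigma> \<in> rank_orderings S (\<lambda>v. real_of_int (fhat G T S (5/100) (31/100) \<sigma>T v)) \<Longrightarrow> near_order S \<sigma> y (K * e)"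
proof -
  obtain K0 e1 where K0: "K0 > 0" "e1 > 0" and inc:
    "\<And>T S G y e Q u v. finite T \<Longrightarrow> T \<noteq> {} \<Longrightarrow> equid T y e \<Longrightarrow> 0 < e \<Longrightarrow> e \<le> e1 \<Longrightarrow>
       (\<And>t. t \<in> T \<union> S \<Longrightarrow> 0 \<le> y t \<and> y t \<le> 1) \<Longrightarrow> Q \<subseteq> T \<Longrightarrow>
       (\<And>t. t \<in> Q \<Longrightarrow> 95/100 - e \<le> y t) \<Longrightarrow> (\<And>t. t \<in> T \<Longrightarrow> 95/100 + e < y t \<Longrightarrow> t \<in> Q) \<Longrightarrow>
       edge_counts_near R G T S (\<lambda>t. 95/100 \<le> y t) y e \<Longrightarrow>
       u \<in> S \<Longrightarrow> v \<in> S \<Longrightarrow> y u \<le> 7/10 \<Longrightarrow> y u + K0 * e < y v \<Longrightarrow> psi G T Q u < psi G T Q v"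
    using psi_increases by blast
  define e0 where "e0 = min e1 (1 / (100 * (K0 + 2)))"
  show thesis
  proof (rule that[of "2 * K0 + 3" e0])
    show "2 * K0 + 3 > 0" "e0 > 0" using K0 by (auto simp: e0_def)
    fix T S :: "nat set" and G :: "nat \<times> nat \<Rightarrow> bool" and y :: "nat \<Rightarrow> real" and e :: real and \<sigma>T \<sigma> :: "nat \<Rightarrow> nat"
    assume T: "finite T" "T \<noteq> {}" and S: "finite S" "S \<noteq> {}" and eT: "equid T y e" and eS: "equid S y e"
      and e: "0 < e" "e \<le> e0" and y: "\<And>t. t \<in> T \<union> S \<Longrightarrow> 0 \<le> y t \<and> y t \<le> 1" and nT: "near_order T \<sigma>T y e"
      and conc: "edge_counts_near R G T S (\<lambda>t. 95/100 \<le> y t) y e"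
      and conc': "edge_counts_near R G T S (\<lambda>t. y t \<le> 5/100) y e"
      and \<sigma>: "\<sigma> \<in> rank_orderings S (\<lambda>v. real_of_int (fhat G T S (5/100) (31/100) \<sigma>T v))"
    have cT: "real (card T) > 0" using T by (simp add: card_gt_0_iff)
    have cS: "real (card S) > 0" using S by (simp add: card_gt_0_iff)
    have e1: "e \<le> e1" "(K0 + 2) * e \<le> 1/100" using e K0 by (auto simp: e0_def field_simps)
    define a where "a = K0 * e"
    have a: "a > 0" "a + 2 * e \<le> 1/100" using K0 e e1 by (auto simp: a_def algebra_simps)
    define Rs where "Rs = {u\<in>T. real (\<sigma>T u) \<ge> (1 - 5/100) * real (card T)}"
    define Ls where "Ls = {u\<in>T. real (\<sigma>T u) \<le> 5/100 * real (card T)}"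
    define pR where "pR = psi G T Rs"
    define pL where "pL = psi G T Ls"
    define cR where "cR = cthr pR S (31/100)"
    define cL where "cL = cthr pL S (31/100)"
    have fh: "fhat G T S (5/100) (31/100) \<sigma>T v = (\<Sum>u\<in>S. Fhat pR pL cR cL u v)" for v
      unfolding fhat_def Let_def Rs_def[symmetric] Ls_def[symmetric] pR_def[symmetric] pL_def[symmetric] cR_def[symmetric] cL_def[symmetric] ..
    have \<sigma>T: "real (\<sigma>T t) \<le> (y t + e) * real (card T)" "(y t - e) * real (card T) \<le> real (\<sigma>T t)" if "t \<in> T" for t
      using nT that by (auto simp: near_order_def abs_le_iff algebra_simps)
    have mR: "pR u < pR v" if "u \<in> S" "v \<in> S" "y u \<le> 7/10" "y u + a < y v" for u v
      unfolding pR_def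
    proof (rule inc[OF T eT e(1) e1(1) y _ _ _ conc that(1,2,3) that(4)[unfolded a_def]])
      show "Rs \<subseteq> T" by (auto simp: Rs_def)
      show "95/100 - e \<le> y t" if "t \<in> Rs" for t
      proof -
        have t: "t \<in> T" "95/100 * real (card T) \<le> real (\<sigma>T t)" using that by (auto simp: Rs_def)
        then have "95/100 * real (card T) \<le> (y t + e) * real (card T)" using \<sigma>T(1)[OF t(1)] by linarith
        then have "95/100 \<le> y t + e" using cT by (rule mult_right_le_imp_le)
        then show ?thesis by simp
      qed
      show "t \<in> Rs" if "t \<in> T" "95/100 + e < y t" for t
      proof -
        have "95/100 * real (card T) \<le> (y t - e) * real (card T)" using that cT by (intro mult_right_mono) auto
        then show ?thesis using \<sigma>T(2)[OF that(1)] that(1) by (simp add: Rs_def)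
      qed
    qed auto
    let ?y' = "\<lambda>t. 1 - y t"
    have eT': "equid T ?y' e" and eS': "equid S ?y' e" using eT eS T S by (auto intro: equid_flip)
    have flip: "{t\<in>T. 95/100 \<le> 1 - y t} = {t\<in>T. y t \<le> 5/100}" "\<bar>(1 - y t) - (1 - y v)\<bar> = \<bar>y t - y v\<bar>" for t v
      by auto
    have mL': "pL u < pL v" if "u \<in> S" "v \<in> S" "?y' u \<le> 7/10" "?y' u + a < ?y' v" for u v
      unfolding pL_def
    proof (rule inc[OF T eT' e(1) e1(1) _ _ _ _ _ that(1,2,3) that(4)[unfolded a_def]])
      show "Ls \<subseteq> T" by (auto simp: Ls_def)
      show "95/100 - e \<le> 1 - y t" if "t \<in> Ls" for t
      proof -
        have t: "t \<in> T" "real (\<sigma>T t) \<le> 5/100 * real (card T)" using that by (auto simp: Ls_def)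
        then have "(y t - e) * real (card T) \<le> 5/100 * real (card T)" using \<sigma>T(2)[OF t(1)] by linarith
        then have "y t - e \<le> 5/100" using cT by (rule mult_right_le_imp_le)
        then show ?thesis by simp
      qed
      show "t \<in> Ls" if "t \<in> T" "95/100 + e < 1 - y t" for t
      proof -
        have "(y t + e) * real (card T) \<le> 5/100 * real (card T)" using that cT by (intro mult_right_mono) auto
        then show ?thesis using \<sigma>T(1)[OF that(1)] that(1) by (simp add: Ls_def)
      qed
      show "edge_counts_near R G T S (\<lambda>t. 95/100 \<le> 1 - y t) ?y' e"
        using conc' unfolding edge_counts_near_def flip .
    qed (use y in auto)
    have mL: "pL v < pL u" if "u \<in> S" "v \<in> S" "3/10 \<le> y v" "y u + a < y v" for u v
      using mL'[of v u] that by simp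
    have p0: "0 \<le> pR s" "0 \<le> pL s" for s by (auto simp: pR_def pL_def psi_def)
    have e0': "0 \<le> e" using e by simp
    have sR1: "y s \<le> 69/100 + (a + 2 * e)" if "s \<in> S" "pR s < cR" for s
      by (rule cthr_split(1)[OF S eS e0' p0(1) mR a that(1) that(2)[unfolded cR_def]])
    have sR2: "69/100 - (a + 2 * e) \<le> y s" if "s \<in> S" "cR \<le> pR s" for s
      by (rule cthr_split(2)[OF S eS e0' p0(1) mR a that(1) that(2)[unfolded cR_def]])
    have sL1: "?y' s \<le> 69/100 + (a + 2 * e)" if "s \<in> S" "pL s < cL" for s
      by (rule cthr_split(1)[where y = ?y', OF S eS' e0' p0(2) mL' a that(1) that(2)[unfolded cL_def]])
    have sL2: "69/100 - (a + 2 * e) \<le> ?y' s" if "s \<in> S" "cL \<le> pL s" for s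
      by (rule cthr_split(2)[where y = ?y', OF S eS' e0' p0(2) mL' a that(1) that(2)[unfolded cL_def]])
    have l1: "31/100 - (a + 2 * e) \<le> y s" if "s \<in> S" "pL s < cL" for s using sL1[OF that] by simp
    have l2: "y s \<le> 31/100 + (a + 2 * e)" if "s \<in> S" "cL \<le> pL s" for s using sL2[OF that] by simp
    have d: "0 \<le> a + 2 * e" "0 \<le> a" using a e by auto
    have F1: "Fhat pR pL cR cL u v = 1" if uv: "u \<in> S" "v \<in> S" "y u + a < y v" for u v
      by (rule Fhat_correct(1)[where y = y and S = S, OF mR mL sR1 sR2 l1 l2 d(1) a(2) d(2) uv])
    have F2: "Fhat pR pL cR cL v u = -1" if uv: "u \<in> S" "v \<in> S" "y u + a < y v" for u v
      by (rule Fhat_correct(2)[where y = y and S = S, OF mR mL sR1 sR2 l1 l2 d(1) a(2) d(2) uv])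
    have lower: "(2 * (y v - a - e) - 1) * real (card S) \<le> real_of_int (fhat G T S (5/100) (31/100) \<sigma>T v)" if v: "v \<in> S" for v
    proof -
      have "2 * real (card {s\<in>S. y s < y v - a}) - real (card S) \<le> real_of_int (\<Sum>s\<in>S. Fhat pR pL cR cL s v)"
        by (rule sum_sign_ge[OF S(1)]) (use F1[OF _ v] Fhat_bounds in auto)
      moreover have "(y v - a - e) * real (card S) \<le> real (card {s\<in>S. y s < y v - a})"
        using y v a by (intro equid_ge[OF eS]) force
      ultimately show ?thesis unfolding fh by (simp add: algebra_simps)
    qed
    have upper: "real_of_int (fhat G T S (5/100) (31/100) \<sigma>T v) \<le> (2 * (y v + a + e) - 1) * real (card S)" if v: "v \<in> S" for v
    proof -
      have "2 * real (card {s\<in>S. \<not> y s \<le> y v + a}) - real (card S) \<le> real_of_int (\<Sum>s\<in>S. - Fhat pR pL cR cL s v)"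
      proof (rule sum_sign_ge[OF S(1)])
        show "-1 \<le> - Fhat pR pL cR cL s v" for s using Fhat_bounds(2)[of pR pL cR cL s v] by simp
        show "- Fhat pR pL cR cL s v = 1" if "s \<in> S" "\<not> y s \<le> y v + a" for s
          using F2[OF v that(1)] that by simp
      qed
      moreover have "real (card {s\<in>S. y s \<le> y v + a}) \<le> (y v + a + e) * real (card S)"
        using y v a by (intro equid_le[OF eS]) force
      ultimately show ?thesis unfolding fh using card_split[OF S(1), of "\<lambda>s. y s \<le> y v + a"]
        by (simp add: algebra_simps sum_negf)
    qed
    have "near_order S \<sigma> y ((2 * a + 2 * e) + e)"
    proof (rule rank_ordering_near[OF S(1) eS _ _ _ \<sigma>])
      fix u v assume uv: "u \<in> S" "v \<in> S" "y u + (2 * a + 2 * e) < y v"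
      have "(2 * (y u + a + e) - 1) * real (card S) < (2 * (y v - a - e) - 1) * real (card S)"
        using uv cS by (intro mult_strict_right_mono) auto
      then show "real_of_int (fhat G T S (5/100) (31/100) \<sigma>T u) < real_of_int (fhat G T S (5/100) (31/100) \<sigma>T v)"
        using lower[OF uv(2)] upper[OF uv(1)] by linarith
    qed (use y a e in auto)
    moreover have "(2 * a + 2 * e) + e = (2 * K0 + 3) * e" by (simp add: a_def algebra_simps)
    ultimately show "near_order S \<sigma> y ((2 * K0 + 3) * e)" by simp
  qed
qed

end

section \<open>Concentration of the edge noise\<close>

text \<open>Products over disjoint blocks \<open>K l\<close> of coordinates cover several uses at
  once: singletons give linear sums, pairs of edges give entries of the squared noise matrix.
  Disjointness makes the products independent, and each is centred because its factors are
  independent and centred. Bounding \<open>card L\<close> by \<open>N\<close> makes the tail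
  uniform.\<close>

lemma Pi_pmf_Hoeffding:
  fixes h :: "'i \<Rightarrow> 'b \<Rightarrow> real" and a :: "'l \<Rightarrow> real"
  assumes I: "finite I" and L: "finite L" "card L \<le> N" "N > 0"
    and K: "\<And>l. l \<in> L \<Longrightarrow> K l \<subseteq> I" "\<And>l. l \<in> L \<Longrightarrow> K l \<noteq> {}" "disjoint_family_on K L"
    and h: "\<And>i b. i \<in> I \<Longrightarrow> \<bar>h i b\<bar> \<le> 1" "\<And>i. i \<in> I \<Longrightarrow> measure_pmf.expectation (p i) (h i) = 0"
    and a: "\<And>l. l \<in> L \<Longrightarrow> \<bar>a l\<bar> \<le> 1" and B: "B \<ge> 0"
  shows "measure_pmf.prob (Pi_pmf I d p) {f. B \<le> \<bar>\<Sum>l\<in>L. a l * (\<Prod>i\<in>K l. h i (f i))\<bar>} \<le> 2 * exp (- B\<^sup>2 / (2 * real N))"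
\<comment> \<open>Hoeffding's inequality wants a positive total width, so the empty sum is settled
  apart: the event is empty unless B = 0, and then the bound is 2.\<close>
proof (cases "L = {}")
  case True
  have "measure_pmf.prob (Pi_pmf I d p) {f. B \<le> \<bar>\<Sum>l\<in>L. a l * (\<Prod>i\<in>K l. h i (f i))\<bar>} \<le> 2 * exp (- B\<^sup>2 / (2 * real N))" if "B = 0"
    using that by (simp add: order_trans[OF measure_pmf.prob_le_1])
  then show ?thesis using True B by (cases "B = 0") auto
next
  case False
  let ?M = "measure_pmf (Pi_pmf I d p)"
  define X where "X l f = a l * (\<Prod>i\<in>K l. h i (f i))" for l and f :: "'i \<Rightarrow> 'b"
  have fK: "finite (K l)" if "l \<in> L" for l using K(1)[OF that] I by (rule finite_subset)
  have ind: "prob_space.indep_vars ?M (\<lambda>_. borel) (\<lambda>i f. h i (f i)) I"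
    by (rule prob_space.indep_vars_compose2[OF prob_space_measure_pmf indep_vars_Pi_pmf[OF I]]) simp
  have indX: "prob_space.indep_vars ?M (\<lambda>_. borel) X L"
  proof -
    have "prob_space.indep_vars ?M (\<lambda>_. borel) (\<lambda>l f. (\<lambda>g. a l * (\<Prod>i\<in>K l. g i)) (restrict (\<lambda>i. h i (f i)) (K l))) L"
    proof (rule prob_space.indep_vars_compose2[OF prob_space_measure_pmf prob_space.indep_vars_restrict[OF prob_space_measure_pmf ind K(1) K(3)]])
      fix l assume "l \<in> L"
      have "(\<lambda>g. \<Prod>i\<in>K l. g i) \<in> borel_measurable (PiM (K l) (\<lambda>_. borel :: real measure))"
        by (rule borel_measurable_prod) (rule measurable_component_singleton)
      then show "(\<lambda>g. a l * (\<Prod>i\<in>K l. g i)) \<in> borel_measurable (PiM (K l) (\<lambda>_. borel :: real measure))"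
        by (intro borel_measurable_times) auto
    qed auto
    moreover have "(\<lambda>l f. (\<lambda>g. a l * (\<Prod>i\<in>K l. g i)) (restrict (\<lambda>i. h i (f i)) (K l))) = X"
      by (intro ext) (simp add: X_def)
    ultimately show ?thesis by simp
  qed
  have bnd: "\<bar>X l f\<bar> \<le> 1" if l: "l \<in> L" for l f
  proof -
    have "\<bar>\<Prod>i\<in>K l. h i (f i)\<bar> \<le> 1"
      unfolding abs_prod using h(1) K(1)[OF l] by (intro prod_le_1) auto
    then have "\<bar>a l\<bar> * \<bar>\<Prod>i\<in>K l. h i (f i)\<bar> \<le> 1 * 1" using a[OF l] by (intro mult_mono) auto
    then show ?thesis by (simp add: X_def abs_mult)
  qed
  interpret H: Hoeffding_ineq ?M L X "\<lambda>_. -1" "\<lambda>_. 1" "\<Sum>l\<in>L. lebesgue_integral ?M (X l)"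
    by unfold_locales (use L indX bnd in \<open>auto simp: abs_le_iff minus_le_iff\<close>)
  have E0: "lebesgue_integral ?M (X l) = 0" if l: "l \<in> L" for l
  proof -
    have int: "integrable ?M (\<lambda>f. h i (f i))" if "i \<in> K l" for i
      by (rule measure_pmf.integrable_const_bound[where B=1]) (use h(1) K(1)[OF l] that in auto)
    have comp: "lebesgue_integral ?M (\<lambda>f. h i (f i)) = 0" if i: "i \<in> K l" for i
    proof -
      have iI: "i \<in> I" using K(1)[OF l] i by auto
      have "lebesgue_integral ?M (\<lambda>f. h i (f i)) = measure_pmf.expectation (map_pmf (\<lambda>f. f i) (Pi_pmf I d p)) (h i)"
        by simp
      also have "map_pmf (\<lambda>f. f i) (Pi_pmf I d p) = p i"
        using Pi_pmf_component[OF I, of i d p] iI by simp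
      finally show ?thesis using h(2)[OF iI] by simp
    qed
    have "lebesgue_integral ?M (\<lambda>f. \<Prod>i\<in>K l. h i (f i)) = (\<Prod>i\<in>K l. lebesgue_integral ?M (\<lambda>f. h i (f i)))"
      by (rule prob_space.indep_vars_lebesgue_integral[OF prob_space_measure_pmf fK[OF l] prob_space.indep_vars_subset[OF prob_space_measure_pmf ind K(1)[OF l]] int])
    also have "\<dots> = 0" using comp K(2)[OF l] fK[OF l] by (auto intro!: prod_zero)
    finally show ?thesis by (simp add: X_def[abs_def])
  qed
  have s: "(\<Sum>l\<in>L. (1 - (-1::real))\<^sup>2) = 4 * real (card L)" by simp
  have cL: "0 < card L" using False L by (simp add: card_gt_0_iff)
  have "measure ?M {f \<in> space ?M. \<bar>(\<Sum>l\<in>L. X l f) - (\<Sum>l\<in>L. lebesgue_integral ?M (X l))\<bar> \<ge> B}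
      \<le> 2 * exp (-2 * B\<^sup>2 / (\<Sum>l\<in>L. (1 - (-1::real))\<^sup>2))"
    by (rule H.Hoeffding_ineq_abs_ge[OF B]) (use cL s in simp)
  also have "(\<Sum>l\<in>L. lebesgue_integral ?M (X l)) = 0" using E0 by simp
  also have "2 * exp (-2 * B\<^sup>2 / (\<Sum>l\<in>L. (1 - (-1::real))\<^sup>2)) \<le> 2 * exp (- B\<^sup>2 / (2 * real N))"
  proof -
    have "B\<^sup>2 / (2 * real N) \<le> B\<^sup>2 / (2 * real (card L))"
      using cL L by (intro divide_left_mono) auto
    also have "\<dots> = 2 * B\<^sup>2 / (4 * real (card L))" by simp
    finally show ?thesis unfolding s by simp
  qed
  finally show ?thesis by (simp add: X_def)
qed

section \<open>Centred edge variables of the sampled graph\<close>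

definition edge :: "nat \<Rightarrow> nat \<Rightarrow> nat \<times> nat" where
  "edge i j = (min i j, max i j)"

definition noise :: "(real \<Rightarrow> real) \<Rightarrow> nat \<Rightarrow> (nat \<times> nat \<Rightarrow> bool) \<Rightarrow> nat \<Rightarrow> nat \<Rightarrow> real" where
  "noise R N G i j = (if i = j then 0 else of_bool (adj G i j) - R \<bar>real i / real N - real j / real N\<bar>)"

text \<open>The noise of one edge written as a function of a single coordinate of the product
  measure.\<close>

definition cedge :: "(real \<Rightarrow> real) \<Rightarrow> nat \<Rightarrow> nat \<times> nat \<Rightarrow> bool \<Rightarrow> real" where
  "cedge R N e b = of_bool b - R \<bar>real (fst e) / real N - real (snd e) / real N\<bar>"

lemma noise_edge: "i \<noteq> j \<Longrightarrow> noise R N G i j = cedge R N (edge i j) (G (edge i j))"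
  by (auto simp: noise_def cedge_def edge_def adj_def min_def max_def abs_minus_commute)

locale edge_prob =
  fixes R :: "real \<Rightarrow> real" and N :: nat
  assumes R01: "\<And>t. 0 \<le> t \<Longrightarrow> t \<le> 1 \<Longrightarrow> 0 \<le> R t \<and> R t \<le> 1" and N0: "N > 0"
begin

abbreviation "edges \<equiv> {(i, j). 1 \<le> i \<and> i < j \<and> j \<le> N}"
abbreviation "\<G> \<equiv> graph_pmf (\<lambda>x y. R \<bar>x - y\<bar>) N"

lemma finite_edges: "finite edges"
  by (rule finite_subset[of _ "{1..N} \<times> {1..N}"]) auto

lemma edge_in: "i \<in> {1..N} \<Longrightarrow> j \<in> {1..N} \<Longrightarrow> i \<noteq> j \<Longrightarrow> edge i j \<in> edges"
  by (auto simp: edge_def min_def max_def)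

lemma R_edge:
  assumes "e \<in> edges"
  shows "0 \<le> R \<bar>real (fst e) / real N - real (snd e) / real N\<bar>" "R \<bar>real (fst e) / real N - real (snd e) / real N\<bar> \<le> 1"
proof -
  have "0 \<le> real (fst e) / real N" "real (fst e) / real N \<le> 1" "0 \<le> real (snd e) / real N" "real (snd e) / real N \<le> 1"
    using assms by auto
  then have "\<bar>real (fst e) / real N - real (snd e) / real N\<bar> \<le> 1" by linarith
  then show "0 \<le> R \<bar>real (fst e) / real N - real (snd e) / real N\<bar>" "R \<bar>real (fst e) / real N - real (snd e) / real N\<bar> \<le> 1"
    using R01 by auto
qed

lemma cedge_bound: "e \<in> edges \<Longrightarrow> \<bar>cedge R N e b\<bar> \<le> 1"
  using R_edge[of e] by (cases b) (auto simp: cedge_def)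

lemma cedge_mean:
  assumes "e \<in> edges"
  shows "measure_pmf.expectation (case e of (i, j) \<Rightarrow> bernoulli_pmf (R \<bar>real i / real N - real j / real N\<bar>)) (cedge R N e) = 0"
  using R_edge[OF assms] by (cases e) (simp add: cedge_def algebra_simps)

lemma noise_sum_Hoeffding:
  assumes L: "finite L" "card L \<le> N"
    and K: "\<And>l. l \<in> L \<Longrightarrow> K l \<subseteq> edges" "\<And>l. l \<in> L \<Longrightarrow> K l \<noteq> {}" "disjoint_family_on K L"
    and a: "\<And>l. l \<in> L \<Longrightarrow> \<bar>a l\<bar> \<le> 1" and B: "B \<ge> 0"
  shows "measure_pmf.prob \<G> {G. B \<le> \<bar>\<Sum>l\<in>L. a l * (\<Prod>e\<in>K l. cedge R N e (G e))\<bar>} \<le> 2 * exp (- B\<^sup>2 / (2 * real N))"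
  unfolding graph_pmf_def
  by (rule Pi_pmf_Hoeffding[OF finite_edges L N0 K cedge_bound cedge_mean a B]) auto

lemma linear_noise:
  assumes k: "k \<in> {1..N}" and T: "T \<subseteq> {1..N}" and a: "\<And>l. l \<in> T \<Longrightarrow> \<bar>a l\<bar> \<le> 1" and B: "B \<ge> 0"
  shows "measure_pmf.prob \<G> {G. B \<le> \<bar>\<Sum>l\<in>T. noise R N G k l * a l\<bar>} \<le> 2 * exp (- B\<^sup>2 / (2 * real N))"
proof -
  have fT: "finite T" using T by (rule finite_subset) simp
  let ?L = "T - {k}"
  have "(\<Sum>l\<in>T. noise R N G k l * a l) = (\<Sum>l\<in>?L. a l * (\<Prod>e\<in>{edge k l}. cedge R N e (G e)))" for G
  proof -
    have "(\<Sum>l\<in>T. noise R N G k l * a l) = (\<Sum>l\<in>?L. noise R N G k l * a l)"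
      using fT by (intro sum.mono_neutral_right) (auto simp: noise_def)
    also have "\<dots> = (\<Sum>l\<in>?L. a l * (\<Prod>e\<in>{edge k l}. cedge R N e (G e)))"
      by (intro sum.cong) (auto simp: noise_edge)
    finally show ?thesis .
  qed
  moreover have "measure_pmf.prob \<G> {G. B \<le> \<bar>\<Sum>l\<in>?L. a l * (\<Prod>e\<in>{edge k l}. cedge R N e (G e))\<bar>} \<le> 2 * exp (- B\<^sup>2 / (2 * real N))"
  proof (rule noise_sum_Hoeffding)
    show "card ?L \<le> N" using card_mono[of "{1..N}" ?L] T by auto
    show "disjoint_family_on (\<lambda>l. {edge k l}) ?L"
      by (auto simp: disjoint_family_on_def edge_def min_def max_def split: if_splits)
    show "{edge k l} \<subseteq> edges" if "l \<in> ?L" for l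
      using edge_in[OF k, of l] that T by auto
  qed (use fT a B in auto)
  ultimately show ?thesis by simp
qed

text \<open>For i \<noteq> k and j outside {i, k} the edges ij and jk are distinct, and the pairs
  belonging to different j are disjoint. So an off-diagonal entry of the squared noise is again a
  sum of independent centred terms, unlike a diagonal one.\<close>

lemma quadratic_noise:
  assumes i: "i \<in> {1..N}" and k: "k \<in> {1..N}" and ik: "i \<noteq> k" and T: "T \<subseteq> {1..N}" and B: "B \<ge> 0"
  shows "measure_pmf.prob \<G> {G. B \<le> \<bar>\<Sum>j\<in>T. noise R N G i j * noise R N G j k\<bar>} \<le> 2 * exp (- B\<^sup>2 / (2 * real N))"
proof -
  have fT: "finite T" using T by (rule finite_subset) simp
  let ?L = "T - {i, k}"
  let ?K = "\<lambda>j. {edge i j, edge j k}"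
  have "(\<Sum>j\<in>T. noise R N G i j * noise R N G j k) = (\<Sum>j\<in>?L. 1 * (\<Prod>e\<in>?K j. cedge R N e (G e)))" for G
  proof -
    have "(\<Sum>j\<in>T. noise R N G i j * noise R N G j k) = (\<Sum>j\<in>?L. noise R N G i j * noise R N G j k)"
      using fT by (intro sum.mono_neutral_right) (auto simp: noise_def)
    also have "\<dots> = (\<Sum>j\<in>?L. 1 * (\<Prod>e\<in>?K j. cedge R N e (G e)))"
    proof (intro sum.cong refl)
      fix j assume j: "j \<in> ?L"
      have "edge i j \<noteq> edge j k" using j ik by (auto simp: edge_def min_def max_def split: if_splits)
      then show "noise R N G i j * noise R N G j k = 1 * (\<Prod>e\<in>?K j. cedge R N e (G e))"
        using j by (auto simp: noise_edge)
    qed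
    finally show ?thesis .
  qed
  moreover have "measure_pmf.prob \<G> {G. B \<le> \<bar>\<Sum>j\<in>?L. 1 * (\<Prod>e\<in>?K j. cedge R N e (G e))\<bar>} \<le> 2 * exp (- B\<^sup>2 / (2 * real N))"
  proof (rule noise_sum_Hoeffding)
    show "card ?L \<le> N" using card_mono[of "{1..N}" ?L] T by auto
    show "disjoint_family_on ?K ?L"
      using ik by (auto simp: disjoint_family_on_def edge_def min_def max_def split: if_splits)
    show "?K j \<subseteq> edges" if "j \<in> ?L" for j
      using edge_in[OF i, of j] edge_in[of j k] k that T by auto
  qed (use fT B in auto)
  ultimately show ?thesis by simp
qed

end

section \<open>Random partitions\<close>

definition part_set :: "nat \<Rightarrow> nat set \<times> nat set \<times> nat set \<Rightarrow> nat set" where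
  "part_set c P = (case P of (S1, S2, S3) \<Rightarrow> if c = 0 then S1 else if c = 1 then S2 else S3)"

text \<open>The final 0 is the default value outside {1..N} that \<open>PiE_dflt\<close> prescribes
  for \<open>labelings\<close>.\<close>

definition part_label :: "nat set \<times> nat set \<times> nat set \<Rightarrow> nat \<Rightarrow> nat" where
  "part_label P i = (case P of (S1, S2, S3) \<Rightarrow> if i \<in> S1 then 0 else if i \<in> S2 then 1 else if i \<in> S3 then 2 else 0)"

abbreviation labelings :: "nat \<Rightarrow> (nat \<Rightarrow> nat) set" where
  "labelings N \<equiv> PiE_dflt {1..N} 0 (\<lambda>_. {0, 1, 2})"

lemma finite_labelings: "finite (labelings N)" and card_labelings: "card (labelings N) = 3 ^ N"
  by (auto simp: card_PiE_dflt numeral_3_eq_3 intro!: finite_PiE_dflt)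

lemma labelings_ne: "labelings N \<noteq> {}"
  using card_labelings[of N] by (metis card.empty power_eq_0_iff zero_neq_numeral)

lemma part_set_label:
  assumes "P \<in> good_partitions N" "c < 3"
  shows "part_set c P = {i\<in>{1..N}. part_label P i = c}"
proof -
  obtain S1 S2 S3 where P: "P = (S1, S2, S3)" by (cases P)
  have "c = 0 \<or> c = 1 \<or> c = 2" using assms by auto
  then show ?thesis using assms(1) unfolding P good_partitions_def part_set_def part_label_def
    by (auto split: if_splits)
qed

lemma part_label_in: "P \<in> good_partitions N \<Longrightarrow> part_label P \<in> labelings N"
  by (auto simp: good_partitions_def part_label_def PiE_dflt_def split: prod.splits)

lemma inj_on_part_label: "inj_on part_label (good_partitions N)"
proof (rule inj_onI)
  fix P Q assume PQ: "P \<in> good_partitions N" "Q \<in> good_partitions N" "part_label P = part_label Q"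
  have "part_set c P = part_set c Q" if "c < 3" for c
    using part_set_label[OF PQ(1) that] part_set_label[OF PQ(2) that] PQ(3) by simp
  from this[of 0] this[of 1] this[of 2] show "P = Q"
    by (cases P; cases Q) (auto simp: part_set_def)
qed

lemma finite_good_partitions: "finite (good_partitions N)"
  by (rule finite_imageD[OF finite_subset[OF _ finite_labelings[of N]] inj_on_part_label])
    (use part_label_in in auto)

text \<open>Hermite's identity for floors at N/3. The summands are the block sizes of a good
  partition in decreasing order.\<close>

lemma third_sizes: "(N + 2) div 3 + (N + 1) div 3 + N div 3 = (N::nat)"
proof (induction N rule: less_induct)
  case (less N)
  show ?case
  proof (cases "N < 3")
    case True
    then have "N = 0 \<or> N = 1 \<or> N = 2" by auto
    then show ?thesis by auto
  next
    case False
    then obtain M where M: "N = M + 3" by (metis add.commute le_Suc_ex not_less)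
    have "(M + 3 + 2) div 3 = (M + 2) div 3 + 1" "(M + 3 + 1) div 3 = (M + 1) div 3 + 1" "(M + 3) div 3 = M div 3 + 1"
      by linarith+
    then show ?thesis using less[of M] unfolding M by linarith
  qed
qed

text \<open>The quotient of successive terms in m is (m + 1) / (n + 1): at most 1 up to m = n and at
  least 1 from there on.\<close>

lemma fact_power_min:
  "fact n / (real n + 1) ^ n \<le> fact m / (real n + 1) ^ m"
proof (cases "n \<le> m")
  case True
  then show ?thesis
  proof (induction m rule: dec_induct)
    case (step m)
    have "fact m / (real n + 1) ^ m * 1 \<le> fact m / (real n + 1) ^ m * ((real m + 1) / (real n + 1))"
      using step by (intro mult_left_mono) auto
    also have "\<dots> = fact (Suc m) / (real n + 1) ^ Suc m" by (simp add: algebra_simps)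
    finally show ?case using step by simp
  qed simp
next
  case False
  then have "m \<le> n" by simp
  then show ?thesis
  proof (induction m rule: inc_induct)
    case (step m)
    have "fact (Suc m) / (real n + 1) ^ Suc m = fact m / (real n + 1) ^ m * ((real m + 1) / (real n + 1))"
      by (simp add: algebra_simps)
    also have "\<dots> \<le> fact m / (real n + 1) ^ m * 1"
      using step by (intro mult_left_mono) auto
    finally show ?case using step by simp
  qed simp
qed

text \<open>By the previous lemma, m! divided by (n+1)^m is minimal at m = n and m = n+1.\<close>
lemma fact_balanced_le:
  assumes "a + b + c = N"
  shows "fact ((N + 2) div 3) * fact ((N + 1) div 3) * fact (N div 3) \<le> (fact a * fact b * fact c :: real)"
proof -
  define n where "n = N div 3"
  define q where "q = real n + 1"
  have q: "q > 0" by (simp add: q_def)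
  have eq: "fact s / q ^ s = fact n / q ^ n" if "s = n \<or> s = n + 1" for s
    using that
  proof
    assume "s = n + 1"
    then show ?thesis using q by (simp add: q_def add.commute)
  qed simp
  have s: "(N + 2) div 3 = n \<or> (N + 2) div 3 = n + 1" "(N + 1) div 3 = n \<or> (N + 1) div 3 = n + 1"
    unfolding n_def by linarith+
  have sum: "(N + 2) div 3 + (N + 1) div 3 + N div 3 = N" by (rule third_sizes)
  have "fact ((N + 2) div 3) * fact ((N + 1) div 3) * fact (N div 3) / q ^ N
      = (fact ((N + 2) div 3) / q ^ ((N + 2) div 3)) * (fact ((N + 1) div 3) / q ^ ((N + 1) div 3)) * (fact n / q ^ n)"
    by (subst (4) sum[symmetric]) (simp add: power_add n_def)
  also have "\<dots> = (fact n / q ^ n) * (fact n / q ^ n) * (fact n / q ^ n)"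
    using eq[OF s(1)] eq[OF s(2)] by simp
  also have "\<dots> \<le> (fact a / q ^ a) * (fact b / q ^ b) * (fact c / q ^ c)"
    using fact_power_min[of n] q unfolding q_def[symmetric] by (intro mult_mono) auto
  also have "\<dots> = fact a * fact b * fact c / q ^ N"
    unfolding assms[symmetric] by (simp add: power_add)
  finally show ?thesis using q by (simp add: divide_le_cancel)
qed

lemma trinomial_eq:
  assumes "a + b \<le> N"
  shows "real ((N choose a) * ((N - a) choose b)) = fact N / (fact a * fact b * fact (N - a - b))"
proof -
  have "real (N choose a) = fact N / (fact a * fact (N - a))" using assms by (intro binomial_fact) auto
  moreover have "real ((N - a) choose b) = fact (N - a) / (fact b * fact (N - a - b))"
    using assms by (intro binomial_fact) auto
  ultimately show ?thesis by simp
qed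

lemma trinomial_balanced_max:
  assumes "a + b \<le> N"
  shows "(N choose a) * ((N - a) choose b) \<le> (N choose ((N + 2) div 3)) * ((N - (N + 2) div 3) choose ((N + 1) div 3))"
proof -
  have s: "(N + 2) div 3 + (N + 1) div 3 \<le> N" "N - (N + 2) div 3 - (N + 1) div 3 = N div 3"
    using third_sizes[of N] by auto
  have "real ((N choose a) * ((N - a) choose b)) \<le> real ((N choose ((N + 2) div 3)) * ((N - (N + 2) div 3) choose ((N + 1) div 3)))"
    unfolding trinomial_eq[OF assms] trinomial_eq[OF s(1)] s(2)
    using fact_balanced_le[of a b "N - a - b" N] assms
    by (intro divide_left_mono) (auto intro!: mult_pos_pos)
  then show ?thesis by (simp only: of_nat_le_iff)
qed

text \<open>3^N is the sum of all trinomial coefficients. There are at most (N + 1)^2 of them, and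
  the largest is the balanced one, which counts partitions with the prescribed sizes.\<close>

lemma card_good_partitions_ge: "3 ^ N \<le> (N + 1)\<^sup>2 * card (good_partitions N)"
proof -
  let ?s1 = "(N + 2) div 3" and ?s2 = "(N + 1) div 3"
  let ?M = "(N choose ?s1) * ((N - ?s1) choose ?s2)"
  have "(3::nat) ^ N = (1 + 2) ^ N" by (rule arg_cong[of _ _ "\<lambda>x. x ^ N"]) simp
  also have "\<dots> = (\<Sum>a\<le>N. (N choose a) * 2 ^ (N - a))" by (subst binomial_ring) simp
  also have "\<dots> = (\<Sum>a\<le>N. \<Sum>b\<le>N - a. (N choose a) * ((N - a) choose b))"
    by (simp add: choose_row_sum flip: sum_distrib_left)
  also have "\<dots> \<le> (\<Sum>a\<le>N. \<Sum>b\<le>N - a. ?M)"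
    by (intro sum_mono trinomial_balanced_max) auto
  also have "\<dots> \<le> (\<Sum>a\<le>N. (N + 1) * ?M)"
    by (intro sum_mono) auto
  also have "\<dots> = (N + 1) * ((N + 1) * ?M)" by simp
  also have "\<dots> = (N + 1)\<^sup>2 * ?M" by (simp only: power2_eq_square mult.assoc)
  finally have 1: "3 ^ N \<le> (N + 1)\<^sup>2 * ?M" .
  define \<Sigma> where "\<Sigma> = (SIGMA S1:{S. S \<subseteq> {1..N} \<and> card S = ?s1}. {S. S \<subseteq> {1..N} - S1 \<and> card S = ?s2})"
  have "card \<Sigma> = (\<Sum>S1\<in>{S. S \<subseteq> {1..N} \<and> card S = ?s1}. card {S. S \<subseteq> {1..N} - S1 \<and> card S = ?s2})"
    unfolding \<Sigma>_def by (intro card_SigmaI) auto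
  also have "\<dots> = (\<Sum>S1\<in>{S. S \<subseteq> {1..N} \<and> card S = ?s1}. (N - ?s1) choose ?s2)"
  proof (intro sum.cong refl)
    fix S1 assume S1: "S1 \<in> {S. S \<subseteq> {1..N} \<and> card S = ?s1}"
    then have "finite S1" by (auto intro: finite_subset)
    then have "card ({1..N} - S1) = N - ?s1" using S1 by (simp add: card_Diff_subset)
    then show "card {S. S \<subseteq> {1..N} - S1 \<and> card S = ?s2} = (N - ?s1) choose ?s2"
      using n_subsets[of "{1..N} - S1" ?s2] by simp
  qed
  also have "\<dots> = ?M" using n_subsets[of "{1..N}" ?s1] by simp
  finally have c: "card \<Sigma> = ?M" .
  define g where "g = (\<lambda>(S1, S2). (S1, S2, {1..N} - S1 - S2))"
  have inj: "inj_on g \<Sigma>" by (auto simp: inj_on_def g_def)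
  have "g ` \<Sigma> \<subseteq> good_partitions N"
  proof
    fix P assume "P \<in> g ` \<Sigma>"
    then obtain S1 S2 where P: "P = (S1, S2, {1..N} - S1 - S2)" and S: "S1 \<subseteq> {1..N}" "card S1 = ?s1" "S2 \<subseteq> {1..N} - S1" "card S2 = ?s2"
      by (auto simp: \<Sigma>_def g_def)
    have f: "finite S1" "finite S2" using S by (auto intro: finite_subset)
    have "card ({1..N} - S1 - S2) = N - ?s1 - ?s2"
      using S f by (simp add: card_Diff_subset)
    also have "\<dots> = N div 3" using third_sizes[of N] by simp
    finally have c3: "card ({1..N} - S1 - S2) = N div 3" .
    have "?s2 \<le> ?s1" "N div 3 \<le> ?s2" "?s1 \<le> N div 3 + 1" by linarith+
    then show "P \<in> good_partitions N"
      unfolding P good_partitions_def using S c3 by auto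
  qed
  then have "card \<Sigma> \<le> card (good_partitions N)"
    using card_mono[OF finite_good_partitions] card_image[OF inj] by metis
  then have "(N + 1)\<^sup>2 * ?M \<le> (N + 1)\<^sup>2 * card (good_partitions N)" using c by simp
  with 1 show ?thesis by linarith
qed

lemma good_partitions_ne: "good_partitions N \<noteq> {}"
  using card_good_partitions_ge[of N] by (auto simp: power2_eq_square)

text \<open>A good partition is an i.i.d. uniform labelling conditioned on an event of probability at least
  (N+1)^(-2), so Hoeffding's inequality carries over at the price of a polynomial factor.\<close>
lemma good_partition_concentration:
  assumes A: "A \<subseteq> {1..N}" and N: "N > 0" and c: "c < 3" and B: "B \<ge> 0"
  shows "measure_pmf.prob (pmf_of_set (good_partitions N)) {P. B \<le> \<bar>real (card (part_set c P \<inter> A)) - real (card A) / 3\<bar>}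
     \<le> 2 * (real N + 1)\<^sup>2 * exp (- B\<^sup>2 / (2 * real N))"
proof -
  let ?good = "good_partitions N" and ?F = "labelings N"
  let ?bad = "{P. B \<le> \<bar>real (card (part_set c P \<inter> A)) - real (card A) / 3\<bar>}"
  let ?h = "\<lambda>v::nat. of_bool (v = c) - 1 / 3 :: real"
  let ?bad' = "{f. B \<le> \<bar>\<Sum>i\<in>A. 1 * (\<Prod>j\<in>{i}. ?h (f j))\<bar>}"
  have fA: "finite A" using A by (rule finite_subset) simp
  have "measure_pmf.prob (Pi_pmf {1..N} 0 (\<lambda>_. pmf_of_set {0, 1, 2})) ?bad' \<le> 2 * exp (- B\<^sup>2 / (2 * real N))"
  proof (rule Pi_pmf_Hoeffding)
    show "card A \<le> N" using card_mono[of "{1..N}" A] A by simp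
    show "disjoint_family_on (\<lambda>i. {i}) A" by (auto simp: disjoint_family_on_def)
    show "measure_pmf.expectation (pmf_of_set {0, 1, 2}) ?h = 0"
      using c by (subst integral_pmf_of_set) (auto simp: less_Suc_eq numeral_3_eq_3)
  qed (use A B fA N in auto)
  also have "Pi_pmf {1..N} 0 (\<lambda>_. pmf_of_set {0, 1, 2::nat}) = pmf_of_set ?F"
    by (rule Pi_pmf_of_set) auto
  finally have "real (card (?F \<inter> ?bad')) / real (card ?F) \<le> 2 * exp (- B\<^sup>2 / (2 * real N))"
    unfolding measure_pmf_of_set[OF labelings_ne finite_labelings] .
  then have F: "real (card (?F \<inter> ?bad')) \<le> 2 * exp (- B\<^sup>2 / (2 * real N)) * 3 ^ N"
    unfolding card_labelings by (simp add: field_simps)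
  \<comment> \<open>\<open>part_label\<close> embeds the good partitions violating the bound into
    the labellings violating it, so the only loss is the ratio of the two total counts.\<close>
  have "part_label ` (?good \<inter> ?bad) \<subseteq> ?F \<inter> ?bad'"
  proof
    fix f assume "f \<in> part_label ` (?good \<inter> ?bad)"
    then obtain P where P: "P \<in> ?good" "P \<in> ?bad" "f = part_label P" by blast
    have "part_set c P \<inter> A = {i\<in>A. f i = c}"
      using part_set_label[OF P(1) c] A P(3) by auto
    moreover have "(\<Sum>i\<in>A. 1 * (\<Prod>j\<in>{i}. ?h (f j))) = real (card {i\<in>A. f i = c}) - real (card A) / 3"
    proof -
      have "(\<Sum>i\<in>A. of_bool (f i = c)) = real (card {i\<in>A. f i = c})"
        using fA by (simp add: of_bool_def sum.If_cases Int_def)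
      then show ?thesis using fA by (simp add: sum_subtractf)
    qed
    ultimately show "f \<in> ?F \<inter> ?bad'" using P part_label_in by auto
  qed
  then have "card (part_label ` (?good \<inter> ?bad)) \<le> card (?F \<inter> ?bad')"
    using finite_labelings by (intro card_mono) auto
  moreover have "card (part_label ` (?good \<inter> ?bad)) = card (?good \<inter> ?bad)"
    using inj_on_part_label by (intro card_image) (auto intro: inj_on_subset)
  ultimately have g: "real (card (?good \<inter> ?bad)) \<le> 2 * exp (- B\<^sup>2 / (2 * real N)) * 3 ^ N"
    using F by linarith
  have gc: "real (card ?good) > 0" using good_partitions_ne finite_good_partitions by (simp add: card_gt_0_iff)
  have "real (3 ^ N) \<le> real ((N + 1)\<^sup>2 * card ?good)"
    using card_good_partitions_ge[of N] by (simp only: of_nat_le_iff)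
  then have "2 * exp (- B\<^sup>2 / (2 * real N)) * 3 ^ N \<le> 2 * exp (- B\<^sup>2 / (2 * real N)) * ((real N + 1)\<^sup>2 * real (card ?good))"
    by (intro mult_left_mono) (auto simp: add.commute)
  with g have "real (card (?good \<inter> ?bad)) \<le> 2 * exp (- B\<^sup>2 / (2 * real N)) * ((real N + 1)\<^sup>2 * real (card ?good))"
    by linarith
  also have "\<dots> = 2 * (real N + 1)\<^sup>2 * exp (- B\<^sup>2 / (2 * real N)) * real (card ?good)"
    by simp
  finally have "real (card (?good \<inter> ?bad)) \<le> 2 * (real N + 1)\<^sup>2 * exp (- B\<^sup>2 / (2 * real N)) * real (card ?good)" .
  then show ?thesis using gc
    by (simp add: measure_pmf_of_set good_partitions_ne finite_good_partitions divide_le_eq)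
qed

section \<open>Spectral seriation\<close>

lemma sum_sorted_list:
  assumes "finite T"
  shows "(\<Sum>l<card T. f (sorted_list_of_set T ! l)) = (\<Sum>t\<in>T. f t)"
proof -
  have "bij_betw (\<lambda>l. sorted_list_of_set T ! l) {..<card T} T"
    using bij_betw_nth[of "sorted_list_of_set T" "{..<card T}" T] assms by simp
  then show ?thesis by (rule sum.reindex_bij_betw)
qed

lemma card_below_nth:
  assumes T: "finite T" and k: "k < card T"
  defines "ts \<equiv> sorted_list_of_set T"
  shows "card {s\<in>T. s < ts ! k} = k" "card {s\<in>T. s \<le> ts ! k} = Suc k"
proof -
  have sd: "sorted_wrt (<) ts" unfolding ts_def by (rule strict_sorted_list_of_set)
  have len: "length ts = card T" and st: "set ts = T"
    using T by (auto simp: ts_def)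
  have mono: "ts ! i < ts ! j \<longleftrightarrow> i < j" if "i < card T" "j < card T" for i j
    using sd that len by (metis linorder_neqE_nat not_less_iff_gr_or_eq sorted_wrt_nth_less)
  have inj: "inj_on ((!) ts) {..<card T}"
    using sd len by (simp add: inj_on_def nth_eq_iff_index_eq strict_sorted_iff)
  have TI: "T = (!) ts ` {..<card T}" 
  proof -
    have "set ts = (!) ts ` {..<length ts}" by (auto simp: set_conv_nth)
    then show ?thesis by (simp only: st len)
  qed
  have "{s\<in>T. s < ts ! k} = (!) ts ` {..<k}"
    using k by (subst TI) (auto simp: mono)
  then show "card {s\<in>T. s < ts ! k} = k"
    using k inj by (simp add: card_image inj_on_subset)
  have "{s\<in>T. s \<le> ts ! k} = insert (ts ! k) {s\<in>T. s < ts ! k}"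
    using k len st by (auto simp: le_less)
  then show "card {s\<in>T. s \<le> ts ! k} = Suc k"
    using \<open>card {s\<in>T. s < ts ! k} = k\<close> T by simp
qed

lemma lap_mat_eq_gen_lap:
  assumes T: "finite T"
  shows "lap_mat G T = gen_lap (card T) (\<lambda>k l. of_bool (adj G (sorted_list_of_set T ! k) (sorted_list_of_set T ! l)))"
proof (rule eq_matI)
  let ?ts = "sorted_list_of_set T"
  fix a b assume "a < dim_row (gen_lap (card T) (\<lambda>k l. of_bool (adj G (?ts ! k) (?ts ! l))))"
    "b < dim_col (gen_lap (card T) (\<lambda>k l. of_bool (adj G (?ts ! k) (?ts ! l))))"
  then have ab: "a < card T" "b < card T" by auto
  have "(\<Sum>l<card T. of_bool (adj G (?ts ! a) (?ts ! l))) = (\<Sum>u\<in>T. of_bool (adj G (?ts ! a) u) :: real)"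
    by (rule sum_sorted_list[OF T])
  also have "\<dots> = real (card {u\<in>T. adj G (?ts ! a) u})"
    using T by (simp add: of_bool_def sum.If_cases Int_def)
  finally show "lap_mat G T $$ (a, b) = gen_lap (card T) (\<lambda>k l. of_bool (adj G (?ts ! k) (?ts ! l))) $$ (a, b)"
    using ab by (cases "a = b") (simp_all add: lap_mat_def gen_lap_def Let_def, simp_all add: adj_def)
qed (auto simp: lap_mat_def gen_lap_def Let_def)

definition pos :: "nat \<Rightarrow> nat \<Rightarrow> real" where
  "pos N i = real i / real N"

text \<open>The sign of an eigenvector is free, so positions are found only up to this reflection.
  It sends i/N to (N - i)/N, one unit off the reversal N + 1 - i, which contributes to the additive
  constants in the distance bounds.\<close>

definition oriented :: "nat \<Rightarrow> (nat \<Rightarrow> real) set" where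
  "oriented N = {pos N, \<lambda>i. 1 - pos N i}"

text \<open>The noise conditions of the perturbation argument in terms of vertex labels;
  \<open>a\<close> will be the second eigenvector of the expected Laplacian on \<open>T\<close>. The
  factor 1 keeps plain row sums an instance of weighted ones.\<close>

definition noise_ok :: "(real \<Rightarrow> real) \<Rightarrow> nat \<Rightarrow> nat set \<Rightarrow> (nat \<Rightarrow> real) \<Rightarrow> real \<Rightarrow> (nat \<times> nat \<Rightarrow> bool) \<Rightarrow> bool" where
  "noise_ok R N T a B G \<longleftrightarrow>
     (\<forall>k\<in>T. \<bar>\<Sum>l\<in>T. noise R N G k l * 1\<bar> \<le> B) \<and> (\<forall>k\<in>T. \<bar>\<Sum>l\<in>T. noise R N G k l * a l\<bar> \<le> B) \<and>
     (\<forall>i\<in>T. \<forall>k\<in>T. i \<noteq> k \<longrightarrow> \<bar>\<Sum>j\<in>T. noise R N G i j * noise R N G j k\<bar> \<le> B)"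

text \<open>At the point with index k itself, k elements lie strictly below and k + 1 weakly below,
  so the two halves of \<open>equid\<close> pin its position to within \<open>e\<close> of k /
  |T|.\<close>

lemma equid_points:
  assumes T: "T \<subseteq> {1..N}" and e: "equid T (pos N) e" and N: "N > 0"
  shows "points (card T) (\<lambda>k. pos N (sorted_list_of_set T ! k)) e"
proof -
  let ?ts = "sorted_list_of_set T"
  have fT: "finite T" using T by (rule finite_subset) simp
  have mem: "?ts ! k \<in> T" if "k < card T" for k
    using that fT nth_mem[of k ?ts] by simp
  have x01: "0 \<le> pos N (?ts ! k) \<and> pos N (?ts ! k) \<le> 1" if "k < card T" for k
    using mem[OF that] T N by (auto simp: pos_def divide_le_eq)
  show ?thesis unfolding points_def
  proof (intro conjI allI impI)
    fix k assume k: "k < card T"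
    show "0 \<le> pos N (?ts ! k)" "pos N (?ts ! k) \<le> 1" using x01[OF k] by auto
    have n: "real (card T) > 0" using k by simp
    let ?x = "pos N (?ts ! k)"
    have "{s\<in>T. pos N s \<le> ?x} = {s\<in>T. s \<le> ?ts ! k}" "{s\<in>T. pos N s < ?x} = {s\<in>T. s < ?ts ! k}"
      using N by (auto simp: pos_def divide_le_cancel divide_less_cancel)
    then have "real (Suc k) \<le> (?x + e) * real (card T)" "(?x - e) * real (card T) \<le> real k"
      using equid_le[OF e, of ?x] equid_ge[OF e, of ?x] x01[OF k] card_below_nth[OF fT k] by auto
    then have "real k / real (card T) \<le> ?x + e" "?x - e \<le> real k / real (card T)"
      using n by (auto simp: field_simps)
    then show "\<bar>?x - real k / real (card T)\<bar> \<le> e" by (simp add: abs_le_iff)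
  next
    fix k l assume kl: "k < card T" "l < card T" "k < l"
    then have "?ts ! k < ?ts ! l" using fT by (simp add: sorted_wrt_nth_less)
    then show "pos N (?ts ! k) < pos N (?ts ! l)" using N by (simp add: pos_def divide_strict_right_mono)
  qed
qed

context profile
begin

text \<open>The order of quantifiers is the point: \<open>a\<close> is fixed by \<open>T\<close>
  alone, before the graph, so that \<open>noise_ok\<close> can be verified by a union bound. The
  uniform eigenvector estimate is then compared with the increments of the expected eigenvector,
  which are proportional to those of the positions.\<close>

theorem spectral_near_order:
  obtains K e0 n0 \<beta> where "K > 0" "e0 > 0" "\<beta> > 0"
    "\<And>N T e. N > 0 \<Longrightarrow> T \<subseteq> {1..N} \<Longrightarrow> equid T (pos N) e \<Longrightarrow> 0 \<le> e \<Longrightarrow> e \<le> e0 \<Longrightarrow> n0 \<le> card T \<Longrightarrow>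
      \<exists>a. (\<forall>t\<in>T. \<bar>a t\<bar> \<le> 1) \<and> (\<forall>G B \<sigma>. 1 \<le> B \<longrightarrow> B \<le> \<beta> * real (card T) \<longrightarrow>
         noise_ok R N T a B G \<longrightarrow>
         \<sigma> \<in> spectral_outputs G T \<longrightarrow>
         (\<exists>y\<in>oriented N. near_order T \<sigma> y (K * B / real (card T) + e)))"
proof -
  obtain \<eta>0 n0 c0 \<gamma> c c' where const: "\<eta>0 > 0" "c0 > 0" "\<gamma> > 0" "c > 0" "c' > 0"
    and spec: "\<And>n x. n \<ge> n0 \<Longrightarrow> points n x \<eta>0 \<Longrightarrow> \<exists>u \<mu>. fiedler n (kern R x) c0 \<gamma> c' u \<mu> \<and>
       (\<forall>j k. j \<le> k \<longrightarrow> k < n \<longrightarrow> c * (x k - x j) \<le> u k - u j)"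
  proof (rule expected_spectrum, goal_cases)
    case 1
    show thesis by (rule 1(1)[OF 1(2-7)])
  qed
  have R1: "R 1 > 0" using R_pos[of 1] by simp
  obtain \<beta> K where \<beta>: "\<beta> > 0" and K: "K > 0" and pert:
    "\<And>n W A u \<mu> B E. symw n A \<Longrightarrow> symw n W \<Longrightarrow> (\<And>k l. k < n \<Longrightarrow> l < n \<Longrightarrow> 0 \<le> A k l \<and> A k l \<le> 1) \<Longrightarrow>
       (\<And>k l. k < n \<Longrightarrow> l < n \<Longrightarrow> 0 \<le> W k l \<and> W k l \<le> 1) \<Longrightarrow> (\<And>k. A k k = 0) \<Longrightarrow>
       (\<And>k l. E k l = (if k = l then 0 else A k l - W k l)) \<Longrightarrow>
       1 \<le> B \<Longrightarrow> B \<le> \<beta> * real n \<Longrightarrow>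
       (\<And>k. k < n \<Longrightarrow> \<bar>\<Sum>l<n. E k l\<bar> \<le> B) \<Longrightarrow>
       (\<And>k. k < n \<Longrightarrow> \<bar>\<Sum>l<n. E k l * u l\<bar> \<le> B) \<Longrightarrow>
       (\<And>i k. i < n \<Longrightarrow> k < n \<Longrightarrow> i \<noteq> k \<Longrightarrow> \<bar>\<Sum>j<n. E i j * E j k\<bar> \<le> B) \<Longrightarrow>
       fiedler n W c0 \<gamma> c' u \<mu> \<Longrightarrow>
       (\<And>h. (\<Sum>k<n. h k) = 0 \<Longrightarrow> R 1 * real n * ip n h h \<le> ip n (wlap n W h) h) \<Longrightarrow>
       (\<forall>h. (\<Sum>k<n. h k) = 0 \<longrightarrow> ip n h h > 0 \<longrightarrow> ip n (wlap n A h) h > 0) \<and>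
       (\<forall>v r. 0 < r \<longrightarrow> r * ip n u u \<le> ip n (wlap n A u) u \<longrightarrow> (\<forall>k<n. wlap n A v k = r * v k) \<longrightarrow> ip n v v > 0 \<longrightarrow>
          (\<exists>a. a \<noteq> 0 \<and> (\<forall>k<n. \<bar>v k / a - u k\<bar> \<le> K * B / real n)))"
  proof (rule eigenvector_perturbation[OF const(2,3,5) R1], goal_cases)
    case 1
    show thesis by (rule 1(1)[OF 1(2-4)])
  qed
  \<comment> \<open>Entrywise errors K B / n at two vertices are harmless once the expected
    increment exceeds 2 K B / n, that is for positions more than K' B / n apart.\<close>
  define K' where "K' = 2 * K / c"
  show thesis
  proof (rule that[of K' \<eta>0 \<beta> "max n0 2"])
    show "K' > 0" "\<eta>0 > 0" "\<beta> > 0" using K const \<beta> by (auto simp: K'_def)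
    fix N T and e :: real assume N: "N > 0" and T: "T \<subseteq> {1..N}" and e: "equid T (pos N) e" "0 \<le> e" "e \<le> \<eta>0" and cT: "max n0 2 \<le> card T"
    define n where "n = card T"
    define ts where "ts = sorted_list_of_set T"
    define x where "x k = pos N (ts ! k)" for k
    have fT: "finite T" using T by (rule finite_subset) simp
    have n: "n \<ge> n0" "n > 1" using cT by (auto simp: n_def)
    have len: "length ts = n" "set ts = T" "distinct ts" using fT by (auto simp: ts_def n_def)
    have x: "points n x \<eta>0"
      using equid_points[OF T e(1) N] e(3) unfolding n_def x_def ts_def points_def by (meson order_trans)
    obtain u \<mu> where F: "fiedler n (kern R x) c0 \<gamma> c' u \<mu>"
      and incr: "\<And>j k. j \<le> k \<Longrightarrow> k < n \<Longrightarrow> c * (x k - x j) \<le> u k - u j"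
      using spec[OF n(1) x] by blast
    define ix where "ix t = (THE k. k < n \<and> ts ! k = t)" for t
    have ixts: "ix (ts ! k) = k" if "k < n" for k
      unfolding ix_def using that len by (intro the_equality) (auto simp: nth_eq_iff_index_eq)
    have tsix: "ix t < n" "ts ! ix t = t" if t: "t \<in> T" for t
    proof -
      obtain k where "k < n" "ts ! k = t" using t len by (metis in_set_conv_nth)
      then show "ix t < n" "ts ! ix t = t" using ixts[of k] by auto
    qed
    define a where "a t = u (ix t)" for t
    have ats: "a (ts ! k) = u k" if "k < n" for k using ixts[OF that] by (simp add: a_def)
    have amax: "\<forall>t\<in>T. \<bar>a t\<bar> \<le> 1" using fiedlerD(3)[OF F] tsix by (auto simp: a_def)
    have tsum: "(\<Sum>l<n. f (ts ! l)) = (\<Sum>t\<in>T. f t)" for f :: "nat \<Rightarrow> real"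
      unfolding n_def ts_def by (rule sum_sorted_list[OF fT])
    have tsT: "ts ! k \<in> T" if "k < n" for k using that len by (metis nth_mem)
    have "\<exists>y\<in>oriented N. near_order T \<sigma> y (K' * B / real n + e)"
      if B: "1 \<le> B" "B \<le> \<beta> * real n" and H: "noise_ok R N T a B G" and \<sigma>: "\<sigma> \<in> spectral_outputs G T" for G B \<sigma>
    proof -
      have H1: "\<bar>\<Sum>l\<in>T. noise R N G k l * 1\<bar> \<le> B" and H2: "\<bar>\<Sum>l\<in>T. noise R N G k l * a l\<bar> \<le> B" if "k \<in> T" for k
        using H that by (auto simp: noise_ok_def)
      have H3: "\<bar>\<Sum>j\<in>T. noise R N G i j * noise R N G j k\<bar> \<le> B" if "i \<in> T" "k \<in> T" "i \<noteq> k" for i k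
        using H that by (auto simp: noise_ok_def)
      define A where "A k l = (of_bool (adj G (ts ! k) (ts ! l)) :: real)" for k l
      define E where "E k l = (if k = l then 0 else A k l - kern R x k l)" for k l
      have En: "E k l = noise R N G (ts ! k) (ts ! l)" if "k < n" "l < n" for k l
        using that len N by (auto simp: E_def A_def noise_def kern_def x_def pos_def nth_eq_iff_index_eq)
      have symA: "symw n A" by (auto simp: symw_def A_def adj_def)
      have kern01: "0 \<le> kern R x k l \<and> kern R x k l \<le> 1" if "k < n" "l < n" for k l
        unfolding kern_def using pointsD(1,2)[OF x, of k] pointsD(1,2)[OF x, of l] that
        by (auto intro!: R_le_1 less_imp_le[OF R_pos])
      have e1: "\<bar>\<Sum>l<n. E k l\<bar> \<le> B" if "k < n" for k
      proof -
        have "(\<Sum>l<n. E k l) = (\<Sum>l<n. noise R N G (ts ! k) (ts ! l) * 1)" using that by (intro sum.cong) (auto simp: En)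
        also have "\<dots> = (\<Sum>l\<in>T. noise R N G (ts ! k) l * 1)" by (rule tsum)
        finally show ?thesis using H1[OF tsT[OF that]] by simp
      qed
      have e2: "\<bar>\<Sum>l<n. E k l * u l\<bar> \<le> B" if "k < n" for k
      proof -
        have "(\<Sum>l<n. E k l * u l) = (\<Sum>l<n. noise R N G (ts ! k) (ts ! l) * a (ts ! l))"
          using that by (intro sum.cong) (auto simp: En ats)
        also have "\<dots> = (\<Sum>l\<in>T. noise R N G (ts ! k) l * a l)" by (rule tsum)
        finally show ?thesis using H2[OF tsT[OF that]] by simp
      qed
      have e3: "\<bar>\<Sum>j<n. E i j * E j k\<bar> \<le> B" if "i < n" "k < n" "i \<noteq> k" for i k
      proof -
        have "(\<Sum>j<n. E i j * E j k) = (\<Sum>j<n. noise R N G (ts ! i) (ts ! j) * noise R N G (ts ! j) (ts ! k))"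
          using that by (intro sum.cong) (auto simp: En)
        also have "\<dots> = (\<Sum>j\<in>T. noise R N G (ts ! i) j * noise R N G j (ts ! k))" by (rule tsum)
        finally show ?thesis using H3[OF tsT[OF that(1)] tsT[OF that(2)]] that len by (simp add: nth_eq_iff_index_eq)
      qed
      have A01: "0 \<le> A k l \<and> A k l \<le> 1" for k l by (simp add: A_def)
      have A0: "A k k = 0" for k by (simp add: A_def adj_def)
      note P = pert[OF symA symw_kern A01 kern01 A0 E_def B e1 e2 e3 F kern_form_coercive[OF x]]
      have pd: "\<And>h. (\<Sum>k<n. h k) = 0 \<Longrightarrow> ip n h h > 0 \<Longrightarrow> ip n (wlap n A h) h > 0" using P by blast
      have ev: "\<And>v r. 0 < r \<Longrightarrow> r * ip n u u \<le> ip n (wlap n A u) u \<Longrightarrow> (\<forall>k<n. wlap n A v k = r * v k) \<Longrightarrow> ip n v v > 0 \<Longrightarrow>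
          (\<exists>a. a \<noteq> 0 \<and> (\<forall>k<n. \<bar>v k / a - u k\<bar> \<le> K * B / real n))" using P by blast
      have lap: "lap_mat G T = gen_lap n A"
        unfolding n_def A_def[abs_def] ts_def by (rule lap_mat_eq_gen_lap[OF fT])
      define r where "r = lambda2 G T"
      have rdef: "r = sorted_list_of_multiset (proots (char_poly (gen_lap n A))) ! 1"
        by (simp add: r_def lambda2_def lap)
      have A0': "\<And>k l. 0 \<le> A k l" using A01 by blast
      have r: "0 < r" "r * ip n u u \<le> ip n (wlap n A u) u"
        unfolding rdef using second_eigenvalue_gen_lap[OF n(2) symA A0' pd] fiedlerD(1)[OF F] by blast+
      obtain v \<phi> where v: "eigenvector (lap_mat G T) v r" "\<forall>i<n. \<phi> (ts ! i) = v $ i" "\<sigma> \<in> rank_orderings T \<phi>"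
        using \<sigma> unfolding spectral_outputs_def r_def n_def ts_def by blast
      have v': "v \<in> carrier_vec n" "v \<noteq> 0\<^sub>v n" "\<forall>k<n. wlap n A (\<lambda>i. v $ i) k = r * v $ k"
        using v(1) unfolding lap gen_lap_eigenvalue_iff by auto
      \<comment> \<open>The scaling factor \<open>s\<close> can be negative; its sign decides which
        of the two orientations appears.\<close>
      obtain s where s: "s \<noteq> 0" "\<And>k. k < n \<Longrightarrow> \<bar>v $ k / s - u k\<bar> \<le> K * B / real n"
        using ev[OF r v'(3) vec_nonzero_ip[OF v'(1,2)]] by blast
      define \<delta> where "\<delta> = K' * B / real n"
      have \<delta>: "0 \<le> \<delta>" using K const B by (simp add: \<delta>_def K'_def)
      have sep: "\<phi> t / s < \<phi> t' / s" if t: "t \<in> T" "t' \<in> T" "pos N t + \<delta> < pos N t'" for t t'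
      proof -
        let ?i = "ix t" and ?j = "ix t'"
        have i: "?i < n" "ts ! ?i = t" and j: "?j < n" "ts ! ?j = t'" using tsix t by auto
        have xx: "x ?i + \<delta> < x ?j" using t(3) i j by (simp add: x_def)
        have "?i \<le> ?j"
        proof (rule ccontr)
          assume "\<not> ?i \<le> ?j"
          then have "x ?j \<le> x ?i" using pointsD(4)[OF x, of ?j ?i] i by simp
          then show False using xx \<delta> by simp
        qed
        then have "c * (x ?j - x ?i) \<le> u ?j - u ?i" using incr j by simp
        moreover have "c * \<delta> < c * (x ?j - x ?i)" using xx const by (intro mult_strict_left_mono) auto
        moreover have "c * \<delta> = 2 * (K * B / real n)" using const by (simp add: \<delta>_def K'_def)
        ultimately have gap: "2 * (K * B / real n) < u ?j - u ?i" by linarith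
        have \<phi>: "\<phi> t = v $ ?i" "\<phi> t' = v $ ?j" using v(2) i j by metis+
        show ?thesis unfolding \<phi> using gap s(2)[OF i(1)] s(2)[OF j(1)] by linarith
      qed
      have p01: "0 \<le> pos N t \<and> pos N t \<le> 1" if "t \<in> T" for t
        using that T N by (auto simp: pos_def divide_le_eq)
      show ?thesis
      proof (cases "s > 0")
        case True
        have "near_order T \<sigma> (pos N) (\<delta> + e)"
        proof (rule rank_ordering_near[OF fT e(1) p01 \<delta> _ v(3)])
          show "\<phi> t < \<phi> t'" if "t \<in> T" "t' \<in> T" "pos N t + \<delta> < pos N t'" for t t'
            using sep[OF that] True by (simp add: divide_less_cancel)
        qed
        then show ?thesis unfolding \<delta>_def oriented_def by blast
      next
        case False
        have "near_order T \<sigma> (\<lambda>i. 1 - pos N i) (\<delta> + e)"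
        proof (rule rank_ordering_near[OF fT equid_flip[OF fT e(1)] _ \<delta> _ v(3)])
          show "\<phi> t < \<phi> t'" if t: "t \<in> T" "t' \<in> T" "1 - pos N t + \<delta> < 1 - pos N t'" for t t'
          proof -
            have "\<phi> t' / s < \<phi> t / s" using t by (intro sep) auto
            then show ?thesis using False s(1) by (simp add: divide_less_cancel)
          qed
        qed (use p01 in auto)
        then show ?thesis unfolding \<delta>_def oriented_def by blast
      qed
    qed
    then show "\<exists>a. (\<forall>t\<in>T. \<bar>a t\<bar> \<le> 1) \<and> (\<forall>G B \<sigma>. 1 \<le> B \<longrightarrow> B \<le> \<beta> * real (card T) \<longrightarrow>
         noise_ok R N T a B G \<longrightarrow>
         \<sigma> \<in> spectral_outputs G T \<longrightarrow>
         (\<exists>y\<in>oriented N. near_order T \<sigma> y (K' * B / real (card T) + e)))"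
      using amax unfolding n_def by (intro exI[of _ a]) blast
  qed
qed

end

section \<open>Alignment and merging\<close>

lemma near_order_mono: "near_order S \<sigma> y e \<Longrightarrow> e \<le> e' \<Longrightarrow> near_order S \<sigma> y e'"
  unfolding near_order_def by (meson mult_right_mono of_nat_0_le_iff order_trans)

lemma equid_mono: "equid S y e \<Longrightarrow> e \<le> e' \<Longrightarrow> equid S y e'"
  unfolding equid_def
proof (intro conjI allI impI, goal_cases)
  case (1 z)
  have "(z + e) * real (card S) \<le> (z + e') * real (card S)" using 1 by (intro mult_right_mono) auto
  then show ?case using 1 by force
next
  case (2 z)
  have "(z - e') * real (card S) \<le> (z - e) * real (card S)" using 2 by (intro mult_right_mono) auto
  then show ?case using 2 by force
qed

text \<open>\<open>rev_ord\<close> subtracts from |S| + 1 rather than |S|; the lower bound on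
  \<open>e\<close> absorbs this unit at the price of the factor 2.\<close>

lemma near_order_rev:
  assumes "near_order S \<sigma> y e" "\<sigma> ` S \<subseteq> {1..card S}" "1 \<le> e * real (card S)"
  shows "near_order S (rev_ord S \<sigma>) (\<lambda>i. 1 - y i) (2 * e)"
  unfolding near_order_def
proof
  fix v assume v: "v \<in> S"
  have "\<sigma> v \<le> card S" using assms(2) v by auto
  then have "real (rev_ord S \<sigma> v) = real (card S) + 1 - real (\<sigma> v)" by (simp add: rev_ord_def)
  moreover have "\<bar>real (\<sigma> v) - real (card S) * y v\<bar> \<le> e * real (card S)" using assms(1) v by (auto simp: near_order_def)
  ultimately show "\<bar>real (rev_ord S \<sigma> v) - real (card S) * (1 - y v)\<bar> \<le> 2 * e * real (card S)"
    using assms(3) by (simp add: algebra_simps)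
qed

lemma near_order_frac:
  assumes "near_order S \<sigma> y e" "finite S" "v \<in> S"
  shows "\<bar>real (\<sigma> v) / real (card S) - y v\<bar> \<le> e"
proof -
  have c: "real (card S) > 0" using assms by (auto simp: card_gt_0_iff)
  have "\<bar>real (\<sigma> v) - real (card S) * y v\<bar> \<le> e * real (card S)" using assms by (auto simp: near_order_def)
  moreover have "real (\<sigma> v) - real (card S) * y v = (real (\<sigma> v) / real (card S) - y v) * real (card S)"
    using c by (simp add: field_simps)
  ultimately have "\<bar>real (\<sigma> v) / real (card S) - y v\<bar> * real (card S) \<le> e * real (card S)"
    by (simp add: abs_mult)
  then show ?thesis using c by simp
qed

text \<open>A common vertex in the first quarter separates the two orientations.\<close>
lemma align_to_near:
  assumes fin: "finite S" "finite S'"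
    and \<sigma>: "near_order S \<sigma> y e" "y \<in> oriented N" "\<sigma> ` S \<subseteq> {1..card S}" "1 \<le> e * real (card S)"
    and \<sigma>': "near_order S' \<sigma>' y' e" "y' \<in> oriented N"
    and i0: "i0 \<in> S \<inter> S'" "pos N i0 \<le> 1/4" and e: "e < 1/10"
  shows "near_order S (align_to S \<sigma> S' \<sigma>') y' (2 * e)" "align_to S \<sigma> S' \<sigma>' ` S \<subseteq> {1..card S}"
proof -
  let ?I = "S \<inter> S'"
  let ?f = "\<lambda>\<tau> i. \<bar>real (\<tau> i) / real (card S) - real (\<sigma>' i) / real (card S')\<bar>"
  let ?\<rho> = "rev_ord S \<sigma>"
  have fI: "finite ?I" and nI: "?I \<noteq> {}" using fin i0 by auto
  have al: "aligned S \<sigma> S' \<sigma>' \<longleftrightarrow> Max (?f \<sigma> ` ?I) \<le> Max (?f ?\<rho> ` ?I)"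
    using nI by (auto simp: aligned_def)
  have e0: "0 \<le> e"
  proof -
    have "0 \<le> \<bar>real (\<sigma>' i0) / real (card S') - y' i0\<bar>" by simp
    also have "\<dots> \<le> e" by (rule near_order_frac[OF \<sigma>'(1) fin(2)]) (use i0 in auto)
    finally show ?thesis .
  qed
  have rev: "near_order S ?\<rho> (\<lambda>i. 1 - y i) (2 * e)" by (rule near_order_rev[OF \<sigma>(1,3,4)])
  have rr: "?\<rho> ` S \<subseteq> {1..card S}" using \<sigma>(3) by (force simp: rev_ord_def)
  have s: "\<bar>real (\<sigma> i) / real (card S) - y i\<bar> \<le> e" if "i \<in> ?I" for i
    using near_order_frac[OF \<sigma>(1) fin(1)] that by auto
  have r: "\<bar>real (?\<rho> i) / real (card S) - (1 - y i)\<bar> \<le> 2 * e" if "i \<in> ?I" for i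
    using near_order_frac[OF rev fin(1)] that by auto
  have s': "\<bar>real (\<sigma>' i) / real (card S') - y' i\<bar> \<le> e" if "i \<in> ?I" for i
    using near_order_frac[OF \<sigma>'(1) fin(2)] that by auto
  have quarter: "1/2 \<le> \<bar>(1 - y i0) - y i0\<bar>"
    using \<sigma>(2) i0(2) by (auto simp: oriented_def)
  have cases: "y = y' \<or> y' = (\<lambda>i. 1 - y i)"
    using \<sigma>(2) \<sigma>'(2) by (auto simp: oriented_def)
  \<comment> \<open>The right choice deviates by at most 2 e everywhere (3 e if it is the reversal),
    the wrong one by at least 1/2 - 3 e (resp. 1/2 - 2 e) at \<open>i0\<close>. The bound e < 1/10
    separates the two.\<close>
  have "near_order S (align_to S \<sigma> S' \<sigma>') y' (2 * e)"
  proof (cases "y = y'")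
    case True
    have "Max (?f \<sigma> ` ?I) \<le> 2 * e"
      using fI nI s s' True by (subst Max_le_iff) (auto, fastforce)
    also have "2 * e \<le> ?f ?\<rho> i0"
      using r[OF i0(1)] s'[OF i0(1)] quarter e True by (auto simp: abs_if split: if_splits)
    also have "\<dots> \<le> Max (?f ?\<rho> ` ?I)" using fI i0 by (intro Max_ge) auto
    finally have "aligned S \<sigma> S' \<sigma>'" using al by simp
    then show ?thesis using \<sigma>(1) True e0 by (simp add: align_to_def near_order_mono)
  next
    case False
    then have y': "y' = (\<lambda>i. 1 - y i)" using cases by blast
    have "Max (?f ?\<rho> ` ?I) \<le> 3 * e"
      using fI nI r s' y' by (subst Max_le_iff) (auto, fastforce)
    also have "3 * e < ?f \<sigma> i0"
      using s[OF i0(1)] s'[OF i0(1)] quarter e y' by (auto simp: abs_if split: if_splits)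
    also have "\<dots> \<le> Max (?f \<sigma> ` ?I)" using fI i0 by (intro Max_ge) auto
    finally have "\<not> aligned S \<sigma> S' \<sigma>'" using al by simp
    then show ?thesis using rev y' by (simp add: align_to_def)
  qed
  then show "near_order S (align_to S \<sigma> S' \<sigma>') y' (2 * e)" .
  show "align_to S \<sigma> S' \<sigma>' ` S \<subseteq> {1..card S}" using rr \<sigma>(3) by (simp add: align_to_def)
qed

text \<open>Each block size is within 1 of N/3, so three times the rank in a block approximates N y.
  Rounding of the sizes and the offset j cost at most 6 in total, the unit between reflection and
  reversal one more.\<close>

lemma distinf_merged:
  assumes N: "N > 0" and P: "(S1, S2, S3) \<in> good_partitions N" and y: "y \<in> oriented N"
    and near: "near_order S1 \<tau>1 y e" "near_order S2 \<tau>2 y e" "near_order S3 \<tau>3 y e"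
    and range: "\<tau>1 ` S1 \<subseteq> {1..card S1}" "\<tau>2 ` S2 \<subseteq> {1..card S2}" "\<tau>3 ` S3 \<subseteq> {1..card S3}"
  shows "distinf N (merged S1 S2 S3 \<tau>1 \<tau>2 \<tau>3) \<le> 3 * e * real N + 7"
proof -
  let ?m = "merged S1 S2 S3 \<tau>1 \<tau>2 \<tau>3"
  have part: "S1 \<union> S2 \<union> S3 = {1..N}" "S1 \<inter> S2 = {}" "S1 \<inter> S3 = {}" "S2 \<inter> S3 = {}"
    "N div 3 \<le> card S3" "card S3 \<le> card S2" "card S2 \<le> card S1" "card S1 \<le> N div 3 + 1"
    using P by (auto simp: good_partitions_def)
  have y01: "0 \<le> y i \<and> y i \<le> 1" if "i \<in> {1..N}" for i
    using that y N by (auto simp: oriented_def pos_def divide_le_eq)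
  have cardb: "\<bar>3 * real c - real N\<bar> \<le> 3" if "N div 3 \<le> c" "c \<le> N div 3 + 1" for c
  proof -
    have "3 * c \<le> N + 3" "N \<le> 3 * c + 2" using that by auto
    then have "real (3 * c) \<le> real (N + 3)" "real N \<le> real (3 * c + 2)" by (simp_all only: of_nat_le_iff)
    then show ?thesis by (simp add: abs_le_iff)
  qed
  have e0: "e * real (card S) \<le> e * real N" if "near_order S \<tau> y e" "i \<in> S" "card S \<le> N" "finite S" for S \<tau> i
  proof -
    have "0 \<le> e" using near_order_frac[OF that(1,4,2)] by linarith
    then show ?thesis using that by (intro mult_left_mono) auto
  qed
  have block: "\<bar>real (3 * (\<tau> i - 1) + j) - real N * y i\<bar> \<le> 3 * e * real N + 6"
    if "near_order S \<tau> y e" "i \<in> S" "\<tau> ` S \<subseteq> {1..card S}" "N div 3 \<le> card S" "card S \<le> N div 3 + 1" "S \<subseteq> {1..N}" "1 \<le> j" "j \<le> 3" for S \<tau> i j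
  proof -
    have fS: "finite S" using that(6) by (rule finite_subset) simp
    have cN: "card S \<le> N" using card_mono[OF _ that(6)] by simp
    have "1 \<le> \<tau> i" using that by auto
    then have r: "real (3 * (\<tau> i - 1) + j) = 3 * real (\<tau> i) - 3 + real j" by (simp add: of_nat_diff)
    have n: "\<bar>real (\<tau> i) - real (card S) * y i\<bar> \<le> e * real N"
      using that(1,2) e0[OF that(1,2) cN fS] by (force simp: near_order_def)
    have yi: "0 \<le> y i \<and> y i \<le> 1" using y01 that by auto
    have "\<bar>(3 * real (card S) - real N) * y i\<bar> \<le> 3 * 1"
      unfolding abs_mult using cardb[OF that(4,5)] yi by (intro mult_mono) auto
    then have c: "\<bar>3 * (real (card S) * y i) - real N * y i\<bar> \<le> 3" by (simp add: algebra_simps)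
    have j: "\<bar>- 3 + real j\<bar> \<le> 2" using that(7,8) by (auto simp: abs_le_iff)
    show ?thesis unfolding r using n c j by linarith
  qed
  have m: "\<bar>real (?m i) - real N * y i\<bar> \<le> 3 * e * real N + 6" if i: "i \<in> {1..N}" for i
  proof -
    have "i \<in> S1 \<union> S2 \<union> S3" using i part(1) by simp
    then consider "i \<in> S1" | "i \<in> S2" "i \<notin> S1" | "i \<in> S3" "i \<notin> S1" "i \<notin> S2" by blast
    then show ?thesis
    proof cases
      case 1 then show ?thesis using block[OF near(1) 1 range(1), of 1] part by (auto simp: merged_def)
    next
      case 2 then show ?thesis using block[OF near(2) 2(1) range(2), of 2] part by (auto simp: merged_def)
    next
      case 3 then show ?thesis using block[OF near(3) 3(1) range(3), of 3] part by (auto simp: merged_def)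
    qed
  qed
  have fin: "finite {1..N}" "{1..N} \<noteq> {}" using N by auto
  show ?thesis
  proof (cases "y = pos N")
    case True
    have "\<bar>real (?m i) - real i\<bar> \<le> 3 * e * real N + 7" if "i \<in> {1..N}" for i
      using m[OF that] N True by (simp add: pos_def)
    then have "Max ((\<lambda>i. \<bar>real (?m i) - real i\<bar>) ` {1..N}) \<le> 3 * e * real N + 7"
      using fin by (subst Max_le_iff) auto
    then show ?thesis unfolding distinf_def by linarith
  next
    case False
    then have y: "y = (\<lambda>i. 1 - pos N i)" using y by (auto simp: oriented_def)
    have "\<bar>real (N + 1 - ?m i) - real i\<bar> \<le> 3 * e * real N + 7" if i: "i \<in> {1..N}" for i
    proof -
      have "real N * y i = real N - real i" using N y by (simp add: pos_def algebra_simps)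
      then have "\<bar>real N + 1 - real (?m i) - real i\<bar> \<le> 3 * e * real N + 7" using m[OF i] by linarith
      \<comment> \<open>Natural subtraction truncates at 0, which can only bring the value closer to
        i.\<close>
      moreover have "\<bar>real (N + 1 - ?m i) - real i\<bar> \<le> \<bar>real N + 1 - real (?m i) - real i\<bar>"
      proof (cases "?m i \<le> N + 1")
        case True then show ?thesis by (simp add: of_nat_diff)
      next
        case False
        then have "real (?m i) \<ge> real N + 1" "N + 1 - ?m i = 0" by auto
        then show ?thesis using i by simp
      qed
      ultimately show ?thesis by linarith
    qed
    then have "Max ((\<lambda>i. \<bar>real (N + 1 - ?m i) - real i\<bar>) ` {1..N}) \<le> 3 * e * real N + 7"
      using fin by (subst Max_le_iff) auto
    then show ?thesis unfolding distinf_def by linarith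
  qed
qed

lemma dist1_near:
  assumes N: "N > 0" and y: "y \<in> oriented N" and near: "near_order {1..N} \<sigma> y e" and range: "\<sigma> ` {1..N} \<subseteq> {1..N}"
  shows "dist1 N \<sigma> \<le> real N * (e * real N + 1)"
proof -
  have m: "\<bar>real (\<sigma> i) - real N * y i\<bar> \<le> e * real N" if i: "i \<in> {1..N}" for i
    using near i by (simp add: near_order_def)
  show ?thesis
  proof (cases "y = pos N")
    case True
    have "(\<Sum>i=1..N. \<bar>real (\<sigma> i) - real i\<bar>) \<le> (\<Sum>i=1..N. e * real N + 1)"
    proof (rule sum_mono)
      fix i assume i: "i \<in> {1..N}"
      then show "\<bar>real (\<sigma> i) - real i\<bar> \<le> e * real N + 1" using m[OF i] N True by (simp add: pos_def)
    qed
    then show ?thesis unfolding dist1_def by simp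
  next
    case False
    then have y: "y = (\<lambda>i. 1 - pos N i)" using y by (auto simp: oriented_def)
    have "(\<Sum>i=1..N. \<bar>real (N + 1 - \<sigma> i) - real i\<bar>) \<le> (\<Sum>i=1..N. e * real N + 1)"
    proof (rule sum_mono)
      fix i assume i: "i \<in> {1..N}"
      have "\<sigma> i \<in> {1..N}" using range i by blast
      then have "real (N + 1 - \<sigma> i) = real N + 1 - real (\<sigma> i)" by (simp add: of_nat_diff)
      moreover have "real N * y i = real N - real i" using N y by (simp add: pos_def algebra_simps)
      ultimately show "\<bar>real (N + 1 - \<sigma> i) - real i\<bar> \<le> e * real N + 1" using m[OF i] by linarith
    qed
    then show ?thesis unfolding dist1_def by simp
  qed
qed

text \<open>Both counts in \<open>equid\<close> are compared with a prefix count of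
  \<open>S\<close>; passing between m/3, z N/3 and z |S| costs only rounding errors, which B \<ge> 1
  dominates.\<close>

lemma equid_of_counts:
  assumes S: "S \<subseteq> {1..N}" and N: "N \<ge> 6" and B: "1 \<le> B"
    and c: "N div 3 \<le> card S" "card S \<le> N div 3 + 1"
    and cnt: "\<And>m. m \<le> N \<Longrightarrow> \<bar>real (card (S \<inter> {1..m})) - real m / 3\<bar> \<le> B"
  shows "equid S (pos N) (18 * B / real N)"
proof -
  have fS: "finite S" using S by (rule finite_subset) simp
  have c1: "real N / 3 \<le> real (card S) + 1" "real (card S) - 1 \<le> real N / 3" "real N / 6 \<le> real (card S)"
  proof -
    have "3 * card S \<le> N + 3" "N \<le> 3 * card S + 2" using c by auto
    then have "real (3 * card S) \<le> real (N + 3)" "real N \<le> real (3 * card S + 2)" by (simp_all only: of_nat_le_iff)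
    then show "real N / 3 \<le> real (card S) + 1" "real (card S) - 1 \<le> real N / 3" "real N / 6 \<le> real (card S)"
      using N by auto
  qed
  \<comment> \<open>The deviation B and the rounding errors together are at most 3 B, and |S| \<ge>
    N/6 turns 3 B into 18 B / N relative to |S|.\<close>
  define e where "e = 18 * B / real N"
  have e: "3 * B \<le> e * real (card S)"
  proof -
    have "e * (real N / 6) \<le> e * real (card S)" using c1(3) B by (intro mult_left_mono) (auto simp: e_def)
    moreover have "e * (real N / 6) = 3 * B" using N by (simp add: e_def)
    ultimately show ?thesis by simp
  qed
  have "real (card {s\<in>S. pos N s \<le> z}) \<le> (z + e) * real (card S)" if z: "0 \<le> z" for z
  proof (cases "z \<le> 1")
    case True
    define m where "m = nat \<lfloor>z * real N\<rfloor>"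
    have m: "real m \<le> z * real N" using z by (simp add: m_def)
    have "z * real N \<le> real N" using True by (simp add: mult_left_le_one_le z)
    then have mN: "m \<le> N" using m by linarith
    have "{s\<in>S. pos N s \<le> z} \<subseteq> S \<inter> {1..m}"
    proof
      fix s assume s: "s \<in> {s\<in>S. pos N s \<le> z}"
      then have "real s \<le> z * real N" using N by (simp add: pos_def field_simps)
      then have "s \<le> m" unfolding m_def by (simp add: le_nat_floor)
      then show "s \<in> S \<inter> {1..m}" using s S by auto
    qed
    then have "card {s\<in>S. pos N s \<le> z} \<le> card (S \<inter> {1..m})" using fS by (intro card_mono) auto
    then have "real (card {s\<in>S. pos N s \<le> z}) \<le> real m / 3 + B" using cnt[OF mN] by linarith
    also have "\<dots> \<le> z * (real N / 3) + B" using m by simp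
    also have "\<dots> \<le> z * (real (card S) + 1) + B" using z c1(1) by (intro add_right_mono mult_left_mono) auto
    also have "\<dots> \<le> (z + e) * real (card S)" using e B True by (simp add: algebra_simps)
    finally show ?thesis .
  next
    case False
    have "real (card {s\<in>S. pos N s \<le> z}) \<le> real (card S)" using fS by (simp add: card_mono)
    also have "\<dots> \<le> z * real (card S)" using False by (simp add: mult_le_cancel_right1)
    also have "\<dots> \<le> (z + e) * real (card S)" using e B by (simp add: algebra_simps)
    finally show ?thesis .
  qed
  moreover have "(z - e) * real (card S) \<le> real (card {s\<in>S. pos N s < z})" if z: "z \<le> 1" for z
  proof (cases "0 < z")
    case True
    \<comment> \<open>The largest integer strictly below z N, since the count on this side is
      strict.\<close>
    define m where "m = nat (\<lceil>z * real N\<rceil> - 1)"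
    have zN: "0 < z * real N" using True N by simp
    then have m: "real m < z * real N" "z * real N - 1 \<le> real m" by (auto simp: m_def; linarith)+
    have "z * real N \<le> real N" using z True by (simp add: mult_left_le_one_le)
    then have mN: "m \<le> N" using m by linarith
    have "S \<inter> {1..m} \<subseteq> {s\<in>S. pos N s < z}"
    proof
      fix s assume s: "s \<in> S \<inter> {1..m}"
      then have "real s < z * real N" using m by auto
      then show "s \<in> {s\<in>S. pos N s < z}" using s N by (simp add: pos_def field_simps)
    qed
    then have "card (S \<inter> {1..m}) \<le> card {s\<in>S. pos N s < z}" using fS by (intro card_mono) auto
    then have "real m / 3 - B \<le> real (card {s\<in>S. pos N s < z})" using cnt[OF mN] by linarith
    moreover have "z * (real (card S) - 1) - 1/3 \<le> real m / 3"
    proof -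
      have "z * (real (card S) - 1) \<le> z * (real N / 3)" using True c1(2) by (intro mult_left_mono) auto
      then show ?thesis using m by simp
    qed
    ultimately show ?thesis using e B z by (simp add: algebra_simps)
  next
    case False
    have "(z - e) * real (card S) \<le> 0" using False e B by (simp add: algebra_simps) (smt (verit) mult_nonneg_nonneg mult_nonpos_nonneg of_nat_0_le_iff)
    then show ?thesis by (smt (verit) of_nat_0_le_iff)
  qed
  ultimately show ?thesis unfolding equid_def e_def by blast
qed

lemma equid_full:
  assumes N: "N > 0"
  shows "equid {1..N} (pos N) (1 / real N)"
proof -
  have "real (card {s\<in>{1..N}. pos N s \<le> z}) \<le> (z + 1 / real N) * real N" if z: "0 \<le> z" for z
  proof -
    have "{s\<in>{1..N}. pos N s \<le> z} \<subseteq> {1..nat \<lfloor>z * real N\<rfloor>}"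
      using N by (auto simp: pos_def field_simps le_nat_floor)
    then have "card {s\<in>{1..N}. pos N s \<le> z} \<le> card {1..nat \<lfloor>z * real N\<rfloor>}" by (intro card_mono) auto
    moreover have "real (nat \<lfloor>z * real N\<rfloor>) \<le> z * real N" using z by simp
    ultimately have "real (card {s\<in>{1..N}. pos N s \<le> z}) \<le> z * real N" by simp
    then show ?thesis using N by (simp add: algebra_simps)
  qed
  moreover have "(z - 1 / real N) * real N \<le> real (card {s\<in>{1..N}. pos N s < z})" if z: "z \<le> 1" for z
  proof (cases "0 < z")
    case True
    define m where "m = nat (\<lceil>z * real N\<rceil> - 1)"
    have zN: "0 < z * real N" using True N by simp
    then have m: "real m < z * real N" "z * real N - 1 \<le> real m" by (auto simp: m_def; linarith)+
    have "z * real N \<le> real N" using z True by (simp add: mult_left_le_one_le)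
    then have mN: "m \<le> N" using m by linarith
    have "{1..m} \<subseteq> {s\<in>{1..N}. pos N s < z}"
    proof
      fix s assume s: "s \<in> {1..m}"
      then have "real s < z * real N" using m by auto
      then show "s \<in> {s\<in>{1..N}. pos N s < z}" using s N mN by (simp add: pos_def field_simps)
    qed
    then have "card {1..m} \<le> card {s\<in>{1..N}. pos N s < z}" by (intro card_mono) auto
    then show ?thesis using m N by (simp add: algebra_simps)
  next
    case False
    have "(z - 1 / real N) * real N = z * real N - 1" using N by (simp add: algebra_simps)
    also have "\<dots> \<le> 0" using False by (smt (verit) mult_nonpos_nonneg of_nat_0_le_iff)
    finally show ?thesis by (smt (verit) of_nat_0_le_iff)
  qed
  ultimately show ?thesis unfolding equid_def by simp
qed

section \<open>Probability of the good event\<close>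

text \<open>58 = 18 + 40 collects the partitions and four runs with 10 each. Half of the exponent is
  given up to absorb the cube, which works because (ln N)^\<gamma> dominates ln N for \<gamma> >
  1.\<close>

lemma log_dominated:
  fixes \<gamma> c :: real
  assumes "\<gamma> > 1" "c > 0"
  shows "eventually (\<lambda>N::nat. 58 * (real N + 1) ^ 3 * exp (- 2 * c * ln (real N) powr \<gamma>) < exp (- c * ln (real N) powr \<gamma>)) sequentially"
  using assms by real_asymp

lemma scale_ge_1:
  fixes \<gamma> c :: real
  assumes "\<gamma> > 1" "c > 0"
  shows "eventually (\<lambda>N::nat. 1 \<le> c * sqrt (real N * ln (real N) powr \<gamma>)) sequentially"
  using assms by real_asymp

lemma scale_small:
  fixes \<gamma> c \<beta> :: real
  assumes "\<gamma> > 1" "c > 0" "\<beta> > 0"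
  shows "eventually (\<lambda>N::nat. c * sqrt (real N * ln (real N) powr \<gamma>) \<le> \<beta> * real N) sequentially"
  using assms by real_asymp

text \<open>The total error is of order N^(3/2) ln N, while 2 - \<eta> > 5/3; this room lets the
  constant \<open>C\<close> in the first claim be 1.\<close>

lemma first_part_asymp:
  fixes \<eta> K \<epsilon> :: real
  assumes "\<eta> < 1/3" "K > 0" "\<epsilon> > 0"
  shows "eventually (\<lambda>N::nat. real N * (K * (sqrt (real N * ln (real N) powr 2)) + 3) \<le> real N powr (2 - \<eta>)) sequentially"
    "eventually (\<lambda>N::nat. 10 * (real N)\<^sup>2 * exp (- (1/2) * ln (real N) powr 2) < \<epsilon>) sequentially"
  using assms by (real_asymp)+

lemma pair_pmf_prob_bound:
  assumes 1: "measure_pmf.prob A {a. \<not> Q a} \<le> p1" and 2: "\<And>a. a \<in> set_pmf A \<Longrightarrow> Q a \<Longrightarrow> measure_pmf.prob C {b. \<not> E a b} \<le> p2"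
    and p: "0 \<le> p1" "0 \<le> p2"
  shows "measure_pmf.prob (pair_pmf A C) {(a, b). \<not> E a b} \<le> p1 + p2"
proof -
  have "emeasure (pair_pmf A C) {(a, b). \<not> E a b} = (\<integral>\<^sup>+a. emeasure (measure_pmf C) {b. \<not> E a b} \<partial>A)"
    unfolding pair_pmf_def map_pmf_def[symmetric] emeasure_bind_pmf emeasure_map_pmf
    by (simp add: vimage_def)
  also have "\<dots> \<le> (\<integral>\<^sup>+a. ennreal p2 + indicator {a. \<not> Q a} a \<partial>A)"
  proof (rule nn_integral_mono_AE)
    show "AE a in A. emeasure (measure_pmf C) {b. \<not> E a b} \<le> ennreal p2 + indicator {a. \<not> Q a} a"
      unfolding AE_measure_pmf_iff
    proof
      fix a assume a: "a \<in> set_pmf A"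
      show "emeasure (measure_pmf C) {b. \<not> E a b} \<le> ennreal p2 + indicator {a. \<not> Q a} a"
      proof (cases "Q a")
        case True
        then show ?thesis using 2[OF a True] by (simp add: measure_pmf.emeasure_eq_measure ennreal_leI)
      next
        case False
        have "emeasure (measure_pmf C) {b. \<not> E a b} \<le> 1" by (rule measure_pmf.emeasure_le_1)
        also have "\<dots> \<le> ennreal p2 + indicator {a. \<not> Q a} a" using False by simp
        finally show ?thesis .
      qed
    qed
  qed
  also have "\<dots> = ennreal p2 + emeasure (measure_pmf A) {a. \<not> Q a}"
    by (subst nn_integral_add) auto
  also have "\<dots> \<le> ennreal p2 + ennreal p1"
    using 1 by (intro add_left_mono) (simp add: measure_pmf.emeasure_eq_measure ennreal_leI)
  also have "\<dots> = ennreal (p1 + p2)" using p by (simp add: add.commute flip: ennreal_plus)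
  finally show ?thesis using p
    unfolding measure_pmf.emeasure_eq_measure by (subst (asm) ennreal_le_iff) auto
qed

text \<open>In the post-processing the graph is the first component, while the union bound needs the
  partitions fixed first; hence conditioning on the second component.\<close>

lemma pair_pmf_prob_bound':
  assumes "measure_pmf.prob C {b. \<not> Q b} \<le> p1" "\<And>b. b \<in> set_pmf C \<Longrightarrow> Q b \<Longrightarrow> measure_pmf.prob A {a. \<not> E a b} \<le> p2"
    and "0 \<le> p1" "0 \<le> p2"
  shows "measure_pmf.prob (pair_pmf A C) {(a, b). \<not> E a b} \<le> p1 + p2"
proof -
  have "measure_pmf.prob (pair_pmf A C) {(a, b). \<not> E a b} = measure_pmf.prob (pair_pmf C A) {(b, a). \<not> E a b}"
    by (subst pair_commute_pmf) (simp add: vimage_def case_prod_unfold)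
  then show ?thesis using pair_pmf_prob_bound[of C Q p1 A "\<lambda>b a. E a b" p2] assms by simp
qed

lemma prob_Bex_le:
  assumes "finite I" "real (card I) \<le> M" "\<And>i. i \<in> I \<Longrightarrow> measure_pmf.prob p {x. Bad i x} \<le> q" "0 \<le> q"
  shows "measure_pmf.prob p {x. \<exists>i\<in>I. Bad i x} \<le> M * q"
proof -
  have "{x. \<exists>i\<in>I. Bad i x} = (\<Union>i\<in>I. {x. Bad i x})" by auto
  then have "measure_pmf.prob p {x. \<exists>i\<in>I. Bad i x} \<le> (\<Sum>i\<in>I. measure_pmf.prob p {x. Bad i x})"
    using measure_pmf.finite_measure_subadditive_finite[of I "\<lambda>i. {x. Bad i x}" p] assms(1) by simp
  also have "\<dots> \<le> (\<Sum>i\<in>I. q)" by (intro sum_mono assms(3))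
  also have "\<dots> \<le> M * q" using assms(2,4) by (simp add: mult_right_mono)
  finally show ?thesis .
qed

lemma prob_Or_le:
  assumes "measure_pmf.prob p {x. A x} \<le> a" "measure_pmf.prob p {x. B x} \<le> b"
  shows "measure_pmf.prob p {x. A x \<or> B x} \<le> a + b"
proof -
  have "measure_pmf.prob p ({x. A x} \<union> {x. B x}) \<le> measure_pmf.prob p {x. A x} + measure_pmf.prob p {x. B x}"
    by (intro measure_Un_le) auto
  then show ?thesis using assms by (simp add: Collect_disj_eq)
qed

lemma prob_subset_le:
  assumes "\<And>x. A x \<Longrightarrow> B x" "measure_pmf.prob p {x. B x} \<le> b"
  shows "measure_pmf.prob p {x. A x} \<le> b"
proof -
  have "measure_pmf.prob p {x. A x} \<le> measure_pmf.prob p {x. B x}"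
    by (rule measure_pmf.finite_measure_mono) (use assms(1) in auto)
  then show ?thesis using assms(2) by simp
qed

definition graph_ok :: "(real \<Rightarrow> real) \<Rightarrow> nat \<Rightarrow> nat set \<Rightarrow> nat set \<Rightarrow> (nat \<Rightarrow> real) \<Rightarrow> real \<Rightarrow> (nat \<times> nat \<Rightarrow> bool) \<Rightarrow> bool" where
  "graph_ok R N T S a B G \<longleftrightarrow> noise_ok R N T a B G \<and>
     (\<forall>v\<in>S. \<bar>\<Sum>t\<in>{t\<in>T. 95/100 \<le> pos N t}. noise R N G v t * 1\<bar> \<le> B) \<and>
     (\<forall>v\<in>S. \<bar>\<Sum>t\<in>{t\<in>T. pos N t \<le> 5/100}. noise R N G v t * 1\<bar> \<le> B)"

text \<open>Five families of at most N^2 sums, each with tail 2 exp (- B^2 / (2 N)): row sums, sums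
  weighted by \<open>a\<close>, off-diagonal entries of the squared noise, and edge counts into the
  two end blocks.\<close>

lemma (in edge_prob) prob_graph_ok:
  assumes T: "T \<subseteq> {1..N}" and S: "S \<subseteq> {1..N}" and a: "\<And>t. t \<in> T \<Longrightarrow> \<bar>a t\<bar> \<le> 1" and B: "0 \<le> B"
  shows "measure_pmf.prob \<G> {G. \<not> graph_ok R N T S a B G} \<le> 10 * (real N)\<^sup>2 * exp (- B\<^sup>2 / (2 * real N))"
proof -
  define q where "q = 2 * exp (- B\<^sup>2 / (2 * real N))"
  have q: "0 \<le> q" by (simp add: q_def)
  have fT: "finite T" "card T \<le> N" using T card_mono[of "{1..N}" T] by (auto intro: finite_subset)
  have fS: "finite S" "card S \<le> N" using S card_mono[of "{1..N}" S] by (auto intro: finite_subset)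
  have NN: "real N \<le> (real N)\<^sup>2" using N0 by (simp add: power2_eq_square)
  have cTT: "real (card (T \<times> T)) \<le> (real N)\<^sup>2"
    using mult_mono[of "real (card T)" "real N" "real (card T)" "real N"] fT by (simp add: card_cartesian_product power2_eq_square)
  have lin: "measure_pmf.prob \<G> {G. B \<le> \<bar>\<Sum>l\<in>U. noise R N G k l * b l\<bar>} \<le> q" if "k \<in> {1..N}" "U \<subseteq> T" "\<And>l. l \<in> U \<Longrightarrow> \<bar>b l\<bar> \<le> 1" for k U b
    unfolding q_def using that T by (intro linear_noise B) auto
  have p1: "measure_pmf.prob \<G> {G. \<exists>k\<in>T. B \<le> \<bar>\<Sum>l\<in>T. noise R N G k l * 1\<bar>} \<le> (real N)\<^sup>2 * q"
    using fT NN T q by (intro prob_Bex_le lin) auto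
  have p2: "measure_pmf.prob \<G> {G. \<exists>k\<in>T. B \<le> \<bar>\<Sum>l\<in>T. noise R N G k l * a l\<bar>} \<le> (real N)\<^sup>2 * q"
    using fT NN T q a by (intro prob_Bex_le lin) auto
  have p3: "measure_pmf.prob \<G> {G. \<exists>ik\<in>{ik\<in>T \<times> T. fst ik \<noteq> snd ik}. B \<le> \<bar>\<Sum>j\<in>T. noise R N G (fst ik) j * noise R N G j (snd ik)\<bar>} \<le> (real N)\<^sup>2 * q"
  proof (rule prob_Bex_le[OF _ _ _ q])
    have "card {ik\<in>T \<times> T. fst ik \<noteq> snd ik} \<le> card (T \<times> T)" using fT by (intro card_mono) auto
    then show "real (card {ik\<in>T \<times> T. fst ik \<noteq> snd ik}) \<le> (real N)\<^sup>2" using cTT by linarith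
    show "measure_pmf.prob \<G> {G. B \<le> \<bar>\<Sum>j\<in>T. noise R N G (fst ik) j * noise R N G j (snd ik)\<bar>} \<le> q"
      if "ik \<in> {ik\<in>T \<times> T. fst ik \<noteq> snd ik}" for ik
      unfolding q_def using that T by (intro quadratic_noise B) auto
  qed (use fT in auto)
  have p4: "measure_pmf.prob \<G> {G. \<exists>v\<in>S. B \<le> \<bar>\<Sum>t\<in>{t\<in>T. 95/100 \<le> pos N t}. noise R N G v t * 1\<bar>} \<le> (real N)\<^sup>2 * q"
    using fS NN S q by (intro prob_Bex_le lin) auto
  have p5: "measure_pmf.prob \<G> {G. \<exists>v\<in>S. B \<le> \<bar>\<Sum>t\<in>{t\<in>T. pos N t \<le> 5/100}. noise R N G v t * 1\<bar>} \<le> (real N)\<^sup>2 * q"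
    using fS NN S q by (intro prob_Bex_le lin) auto
  have "measure_pmf.prob \<G> {G. \<not> graph_ok R N T S a B G}
      \<le> (real N)\<^sup>2 * q + ((real N)\<^sup>2 * q + ((real N)\<^sup>2 * q + ((real N)\<^sup>2 * q + (real N)\<^sup>2 * q)))"
  proof (rule prob_subset_le[OF _ prob_Or_le[OF p1 prob_Or_le[OF p2 prob_Or_le[OF p3 prob_Or_le[OF p4 p5]]]]], rule ccontr)
    fix G
    assume n: "\<not> graph_ok R N T S a B G"
    assume "\<not> ((\<exists>k\<in>T. B \<le> \<bar>\<Sum>l\<in>T. noise R N G k l * 1\<bar>) \<or> (\<exists>k\<in>T. B \<le> \<bar>\<Sum>l\<in>T. noise R N G k l * a l\<bar>) \<or>
      (\<exists>ik\<in>{ik\<in>T \<times> T. fst ik \<noteq> snd ik}. B \<le> \<bar>\<Sum>j\<in>T. noise R N G (fst ik) j * noise R N G j (snd ik)\<bar>) \<or>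
      (\<exists>v\<in>S. B \<le> \<bar>\<Sum>t\<in>{t\<in>T. 95/100 \<le> pos N t}. noise R N G v t * 1\<bar>) \<or>
      (\<exists>v\<in>S. B \<le> \<bar>\<Sum>t\<in>{t\<in>T. pos N t \<le> 5/100}. noise R N G v t * 1\<bar>))"
    then have h: "\<not> (\<exists>k\<in>T. B \<le> \<bar>\<Sum>l\<in>T. noise R N G k l * 1\<bar>)" "\<not> (\<exists>k\<in>T. B \<le> \<bar>\<Sum>l\<in>T. noise R N G k l * a l\<bar>)"
      "\<not> (\<exists>ik\<in>{ik\<in>T \<times> T. fst ik \<noteq> snd ik}. B \<le> \<bar>\<Sum>j\<in>T. noise R N G (fst ik) j * noise R N G j (snd ik)\<bar>)"
      "\<not> (\<exists>v\<in>S. B \<le> \<bar>\<Sum>t\<in>{t\<in>T. 95/100 \<le> pos N t}. noise R N G v t * 1\<bar>)"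
      "\<not> (\<exists>v\<in>S. B \<le> \<bar>\<Sum>t\<in>{t\<in>T. pos N t \<le> 5/100}. noise R N G v t * 1\<bar>)"
      unfolding de_Morgan_disj by - (elim conjE, assumption)+
    have "\<bar>\<Sum>j\<in>T. noise R N G i j * noise R N G j k\<bar> \<le> B" if "i \<in> T" "k \<in> T" "i \<noteq> k" for i k
    proof -
      have "(i, k) \<in> {ik\<in>T \<times> T. fst ik \<noteq> snd ik}" using that by simp
      then have "\<not> B \<le> \<bar>\<Sum>j\<in>T. noise R N G (fst (i, k)) j * noise R N G j (snd (i, k))\<bar>" using h(3) by blast
      then show ?thesis by simp
    qed
    then have "graph_ok R N T S a B G"
      unfolding graph_ok_def noise_ok_def using h(1,2,4,5) by (meson linear)
    with n show False by simp
  qed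
  then show ?thesis by (simp add: q_def)
qed

definition counts_ok :: "nat \<Rightarrow> real \<Rightarrow> nat set \<Rightarrow> bool" where
  "counts_ok N B S \<longleftrightarrow> (\<forall>m\<le>N. \<bar>real (card (S \<inter> {1..m})) - real m / 3\<bar> \<le> B)"

definition partition_ok :: "nat \<Rightarrow> real \<Rightarrow> nat set \<times> nat set \<times> nat set \<Rightarrow> bool" where
  "partition_ok N B P \<longleftrightarrow> (\<forall>c\<in>{0,1,2}. counts_ok N B (part_set c P))"

text \<open>Provides, for each of the three blocks, the witness \<open>i0\<close> that
  \<open>align_to_near\<close> needs.\<close>

definition overlap_ok :: "nat \<Rightarrow> nat set \<times> nat set \<times> nat set \<Rightarrow> nat set \<times> nat set \<times> nat set \<Rightarrow> bool" where
  "overlap_ok N P P' \<longleftrightarrow> (\<forall>c\<in>{0,1,2}. part_set 1 P' \<inter> (part_set c P \<inter> {1..N div 4}) \<noteq> {})"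

lemma prob_partition_ok:
  assumes N: "N > 0" and B: "0 \<le> B"
  shows "measure_pmf.prob (pmf_of_set (good_partitions N)) {P. \<not> partition_ok N B P}
    \<le> 6 * (real N + 1) ^ 3 * exp (- B\<^sup>2 / (2 * real N))"
proof -
  define q where "q = 2 * (real N + 1)\<^sup>2 * exp (- B\<^sup>2 / (2 * real N))"
  have q: "0 \<le> q" by (simp add: q_def)
  have "measure_pmf.prob (pmf_of_set (good_partitions N))
      {P. \<exists>cm\<in>{0,1,2} \<times> {..N}. B \<le> \<bar>real (card (part_set (fst cm) P \<inter> {1..snd cm})) - real (card {1..snd cm}) / 3\<bar>} \<le> (3 * (real N + 1)) * q"
  proof (rule prob_Bex_le[OF _ _ _ q])
    fix cm :: "nat \<times> nat" assume "cm \<in> {0,1,2} \<times> {..N}"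
    then show "measure_pmf.prob (pmf_of_set (good_partitions N))
      {P. B \<le> \<bar>real (card (part_set (fst cm) P \<inter> {1..snd cm})) - real (card {1..snd cm}) / 3\<bar>} \<le> q"
      unfolding q_def by (intro good_partition_concentration N B) auto
  qed (auto simp: card_cartesian_product)
  then have "measure_pmf.prob (pmf_of_set (good_partitions N)) {P. \<not> partition_ok N B P} \<le> (3 * (real N + 1)) * q"
  proof (rule prob_subset_le[rotated])
    fix P assume "\<not> partition_ok N B P"
    then obtain c m where cm: "c \<in> {0,1,2}" "m \<le> N" "B < \<bar>real (card (part_set c P \<inter> {1..m})) - real m / 3\<bar>"
      unfolding partition_ok_def counts_ok_def by (meson not_le)
    show "\<exists>cm\<in>{0,1,2} \<times> {..N}. B \<le> \<bar>real (card (part_set (fst cm) P \<inter> {1..snd cm})) - real (card {1..snd cm}) / 3\<bar>"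
      by (rule bexI[of _ "(c, m)"]) (use cm in auto)
  qed
  also have "(3 * (real N + 1)) * q = 6 * (real N + 1) ^ 3 * exp (- B\<^sup>2 / (2 * real N))"
    by (simp add: q_def power3_eq_cube power2_eq_square)
  finally show ?thesis .
qed

text \<open>With the first partition fixed, the first quarter of each block is a deterministic set
  of about N/12 \<ge> 3 B vertices. A reference block missing it would deviate from the expected
  third by at least B.\<close>

lemma prob_overlap_ok:
  assumes N: "N \<ge> 100" and B: "0 < B" "B \<le> real N / 100"
    and P: "P \<in> good_partitions N" "partition_ok N B P"
  shows "measure_pmf.prob (pmf_of_set (good_partitions N)) {P'. \<not> overlap_ok N P P'}
    \<le> 6 * (real N + 1)\<^sup>2 * exp (- B\<^sup>2 / (2 * real N))"
proof -
  define q where "q = 2 * (real N + 1)\<^sup>2 * exp (- B\<^sup>2 / (2 * real N))"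
  have q: "0 \<le> q" by (simp add: q_def)
  let ?A = "\<lambda>c. part_set c P \<inter> {1..N div 4}"
  have big: "B \<le> real (card (?A c)) / 3" if "c \<in> {0,1,2}" for c
  proof -
    have "N div 4 \<le> N" by simp
    then have "\<bar>real (card (?A c)) - real (N div 4) / 3\<bar> \<le> B"
      using P(2) that unfolding partition_ok_def counts_ok_def by blast
    moreover have "real N \<le> 4 * real (N div 4) + 3"
    proof -
      have "N \<le> 4 * (N div 4) + 3" by linarith
      then have "real N \<le> real (4 * (N div 4) + 3)" by (simp only: of_nat_le_iff)
      then show ?thesis by simp
    qed
    moreover have "real N \<ge> 100" using N by simp
    ultimately show ?thesis using B by linarith
  qed
  have "measure_pmf.prob (pmf_of_set (good_partitions N))
      {P'. \<exists>c\<in>{0,1,2}. B \<le> \<bar>real (card (part_set 1 P' \<inter> ?A c)) - real (card (?A c)) / 3\<bar>} \<le> 3 * q"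
  proof (rule prob_Bex_le[OF _ _ _ q])
    fix c :: nat assume "c \<in> {0,1,2}"
    show "measure_pmf.prob (pmf_of_set (good_partitions N))
      {P'. B \<le> \<bar>real (card (part_set 1 P' \<inter> ?A c)) - real (card (?A c)) / 3\<bar>} \<le> q"
      unfolding q_def using N B by (intro good_partition_concentration) auto
  qed auto
  then have "measure_pmf.prob (pmf_of_set (good_partitions N)) {P'. \<not> overlap_ok N P P'} \<le> 3 * q"
  proof (rule prob_subset_le[rotated])
    fix P' assume "\<not> overlap_ok N P P'"
    then obtain c where c: "c \<in> {0,1,2}" "part_set 1 P' \<inter> ?A c = {}" unfolding overlap_ok_def by blast
    have "B \<le> \<bar>real (card (part_set 1 P' \<inter> ?A c)) - real (card (?A c)) / 3\<bar>"
      using big[OF c(1)] unfolding c(2) by simp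
    then show "\<exists>c\<in>{0,1,2}. B \<le> \<bar>real (card (part_set 1 P' \<inter> ?A c)) - real (card (?A c)) / 3\<bar>" using c(1) by blast
  qed
  then show ?thesis by (simp add: q_def)
qed

definition partitions_ok :: "nat \<Rightarrow> real \<Rightarrow> (nat set \<times> nat set \<times> nat set) \<times> nat set \<times> nat set \<times> nat set \<Rightarrow> bool" where
  "partitions_ok N B PP \<longleftrightarrow> partition_ok N B (fst PP) \<and> partition_ok N B (snd PP) \<and> overlap_ok N (fst PP) (snd PP)"

lemma prob_partitions_ok:
  assumes N: "N \<ge> 100" and B: "0 < B" "B \<le> real N / 100"
  shows "measure_pmf.prob (pair_pmf (pmf_of_set (good_partitions N)) (pmf_of_set (good_partitions N))) {PP. \<not> partitions_ok N B PP}
    \<le> 18 * (real N + 1) ^ 3 * exp (- B\<^sup>2 / (2 * real N))"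
proof -
  define x where "x = exp (- B\<^sup>2 / (2 * real N))"
  have x: "0 \<le> x" by (simp add: x_def)
  have N0: "N > 0" using N by simp
  have s: "set_pmf (pmf_of_set (good_partitions N)) = good_partitions N"
    by (simp add: good_partitions_ne finite_good_partitions)
  have "measure_pmf.prob (pair_pmf (pmf_of_set (good_partitions N)) (pmf_of_set (good_partitions N)))
      {(P, P'). \<not> partitions_ok N B (P, P')} \<le> 6 * (real N + 1) ^ 3 * x + (6 * (real N + 1) ^ 3 * x + 6 * (real N + 1)\<^sup>2 * x)"
  proof (rule pair_pmf_prob_bound[where Q = "partition_ok N B"])
    show "measure_pmf.prob (pmf_of_set (good_partitions N)) {P. \<not> partition_ok N B P} \<le> 6 * (real N + 1) ^ 3 * x"
      unfolding x_def using N0 B by (intro prob_partition_ok) auto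
    fix P assume P: "P \<in> set_pmf (pmf_of_set (good_partitions N))" "partition_ok N B P"
    have "measure_pmf.prob (pmf_of_set (good_partitions N)) {P'. \<not> partition_ok N B P' \<or> \<not> overlap_ok N P P'}
        \<le> 6 * (real N + 1) ^ 3 * x + 6 * (real N + 1)\<^sup>2 * x"
      unfolding x_def using N0 B P s by (intro prob_Or_le prob_partition_ok prob_overlap_ok N) auto
    then show "measure_pmf.prob (pmf_of_set (good_partitions N)) {P'. \<not> partitions_ok N B (P, P')}
        \<le> 6 * (real N + 1) ^ 3 * x + 6 * (real N + 1)\<^sup>2 * x"
      by (rule prob_subset_le[rotated]) (use P in \<open>auto simp: partitions_ok_def\<close>)
  qed (use x in auto)
  also have "{(P, P'). \<not> partitions_ok N B (P, P')} = {PP. \<not> partitions_ok N B PP}" by auto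
  also have "6 * (real N + 1) ^ 3 * x + (6 * (real N + 1) ^ 3 * x + 6 * (real N + 1)\<^sup>2 * x) \<le> 18 * (real N + 1) ^ 3 * x"
  proof -
    have "(real N + 1)\<^sup>2 * 1 \<le> (real N + 1)\<^sup>2 * (real N + 1)" by (intro mult_left_mono) auto
    then have "(real N + 1)\<^sup>2 \<le> (real N + 1) ^ 3" by (simp add: power3_eq_cube power2_eq_square)
    then have "(real N + 1)\<^sup>2 * x \<le> (real N + 1) ^ 3 * x" using x by (rule mult_right_mono)
    then show ?thesis by (simp only: mult.assoc)
  qed
  finally show ?thesis by (simp add: x_def)
qed

section \<open>Main results\<close>

definition block :: "nat \<Rightarrow> real \<Rightarrow> nat set \<Rightarrow> bool" where
  "block N B S \<longleftrightarrow> S \<subseteq> {1..N} \<and> N div 3 \<le> card S \<and> card S \<le> N div 3 + 1 \<and> counts_ok N B S"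

lemma block_finite: "block N B S \<Longrightarrow> finite S"
  by (auto simp: block_def intro: finite_subset)

lemma block_equid: "block N B S \<Longrightarrow> 6 \<le> N \<Longrightarrow> 1 \<le> B \<Longrightarrow> equid S (pos N) (18 * B / real N)"
  by (rule equid_of_counts) (auto simp: block_def counts_ok_def)

lemma block_card: "block N B S \<Longrightarrow> 6 \<le> N \<Longrightarrow> real N / 6 \<le> real (card S)"
proof -
  assume b: "block N B S" and N: "6 \<le> N"
  have "N \<le> 6 * card S" using b N by (auto simp: block_def)
  then have "real N \<le> real (6 * card S)" by (simp only: of_nat_le_iff)
  then show ?thesis by simp
qed

lemma good_partition_blocks:
  assumes "(S1, S2, S3) \<in> good_partitions N" "partition_ok N B (S1, S2, S3)"
  shows "block N B S1" "block N B S2" "block N B S3"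
proof -
  have "counts_ok N B S1" "counts_ok N B S2" "counts_ok N B S3"
    using assms(2) by (auto simp: partition_ok_def part_set_def)
  then show "block N B S1" "block N B S2" "block N B S3"
    using assms(1) by (auto simp: block_def good_partitions_def)
qed

context profile
begin

text \<open>Disjointness of \<open>T\<close> and \<open>S\<close> excludes diagonal terms, and only
  differences of \<open>y\<close> enter, so both orientations see the same kernel.\<close>

lemma block_noise_sum:
  assumes "T \<inter> S = {}" "v \<in> S" "finite T" "y \<in> oriented N"
    "\<bar>\<Sum>t\<in>{t\<in>T. Q t}. noise R N G v t * 1\<bar> \<le> B"
  shows "\<bar>real (card {t\<in>{t\<in>T. Q t}. adj G t v}) - (\<Sum>t\<in>{t\<in>T. Q t}. R \<bar>y t - y v\<bar>)\<bar> \<le> B"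
proof -
  have "(\<Sum>t\<in>{t\<in>T. Q t}. noise R N G v t * 1) = (\<Sum>t\<in>{t\<in>T. Q t}. of_bool (adj G t v) - R \<bar>y t - y v\<bar>)"
  proof (intro sum.cong refl)
    fix t assume "t \<in> {t\<in>T. Q t}"
    then have "t \<noteq> v" using assms by auto
    moreover have "\<bar>real v / real N - real t / real N\<bar> = \<bar>y t - y v\<bar>"
      using assms(4) by (auto simp: oriented_def pos_def)
    ultimately show "noise R N G v t * 1 = of_bool (adj G t v) - R \<bar>y t - y v\<bar>"
      by (simp add: noise_def adj_def)
  qed
  also have "\<dots> = (\<Sum>t\<in>{t\<in>T. Q t}. of_bool (adj G t v)) - (\<Sum>t\<in>{t\<in>T. Q t}. R \<bar>y t - y v\<bar>)"
    by (rule sum_subtractf)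
  also have "(\<Sum>t\<in>{t\<in>T. Q t}. of_bool (adj G t v)) = real (card {t\<in>{t\<in>T. Q t}. adj G t v})"
    using assms(3) by (simp add: of_bool_def sum.If_cases Int_def)
  finally show ?thesis using assms(5) by simp
qed

text \<open>The orientation \<open>y\<close> is whichever one the spectral step produced on
  \<open>T\<close>; the rest of the subroutine is symmetric under reflection and transports it to
  \<open>S\<close>. The bound K \<ge> 6 is arranged so that later e = K B / N satisfies 1 \<le> e
  |S|.\<close>

theorem subroutine_oriented:
  obtains K \<beta> N1 where "K \<ge> 6" "\<beta> > 0"
    "\<And>N B. N1 \<le> N \<Longrightarrow> 1 \<le> B \<Longrightarrow> B \<le> \<beta> * real N \<Longrightarrow> \<exists>a. (\<forall>T. \<forall>t\<in>T. \<bar>a T t\<bar> \<le> 1) \<and>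
       (\<forall>G T S \<sigma>. block N B T \<longrightarrow> block N B S \<longrightarrow> T \<inter> S = {} \<longrightarrow> graph_ok R N T S (a T) B G \<longrightarrow>
          \<sigma> \<in> subroutine_outputs G T S (5/100) (31/100) \<longrightarrow> (\<exists>y\<in>oriented N. near_order S \<sigma> y (K * B / real N)))"
proof -
  obtain K1 e0 n0 \<beta>0 where K1: "K1 > 0" "e0 > 0" "\<beta>0 > 0" and spec:
    "\<And>N T e. N > 0 \<Longrightarrow> T \<subseteq> {1..N} \<Longrightarrow> equid T (pos N) e \<Longrightarrow> 0 \<le> e \<Longrightarrow> e \<le> e0 \<Longrightarrow> n0 \<le> card T \<Longrightarrow>
      \<exists>a. (\<forall>t\<in>T. \<bar>a t\<bar> \<le> 1) \<and> (\<forall>G B \<sigma>. 1 \<le> B \<longrightarrow> B \<le> \<beta>0 * real (card T) \<longrightarrow>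
         noise_ok R N T a B G \<longrightarrow>
         \<sigma> \<in> spectral_outputs G T \<longrightarrow>
         (\<exists>y\<in>oriented N. near_order T \<sigma> y (K1 * B / real (card T) + e)))"
  proof (rule spectral_near_order, goal_cases)
    case 1
    show thesis by (rule 1(1)[OF 1(2-5)])
  qed
  obtain K2 e1 where K2: "K2 > 0" "e1 > 0" and sub:
    "\<And>T S G y e \<sigma>T \<sigma>. finite T \<Longrightarrow> T \<noteq> {} \<Longrightarrow> finite S \<Longrightarrow> S \<noteq> {} \<Longrightarrow> equid T y e \<Longrightarrow> equid S y e \<Longrightarrow> 0 < e \<Longrightarrow> e \<le> e1 \<Longrightarrow>
       (\<And>t. t \<in> T \<union> S \<Longrightarrow> 0 \<le> y t \<and> y t \<le> 1) \<Longrightarrow> near_order T \<sigma>T y e \<Longrightarrow>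
       edge_counts_near R G T S (\<lambda>t. 95/100 \<le> y t) y e \<Longrightarrow>
       edge_counts_near R G T S (\<lambda>t. y t \<le> 5/100) y e \<Longrightarrow>
       \<sigma> \<in> rank_orderings S (\<lambda>v. real_of_int (fhat G T S (5/100) (31/100) \<sigma>T v)) \<Longrightarrow> near_order S \<sigma> y (K2 * e)"
  proof (rule subroutine_near_order, goal_cases)
    case 1
    show thesis by (rule 1(1)[OF 1(2-4)])
  qed
  \<comment> \<open>|T| \<ge> N/6 turns K1 B / |T| into 6 K1 B / N, and 18 comes from the
    discrepancy of the blocks.\<close>
  define C where "C = 6 * K1 + 18"
  have C: "C > 0" using K1 by (simp add: C_def)
  define K where "K = max 6 (K2 * C)"
  define \<beta> where "\<beta> = min (\<beta>0 / 6) (min (e0 / 18) (e1 / C))"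
  have \<beta>: "\<beta> > 0" "\<beta> \<le> \<beta>0 / 6" "\<beta> \<le> e0 / 18" "\<beta> \<le> e1 / C"
    using K1 K2 C unfolding \<beta>_def by (simp, linarith+)
  show thesis
  proof (rule that[of K \<beta> "6 * n0 + 6"])
    show "K \<ge> 6" "\<beta> > 0" using \<beta> by (auto simp: K_def)
    fix N :: nat and B :: real assume N: "6 * n0 + 6 \<le> N" and B: "1 \<le> B" "B \<le> \<beta> * real N"
    have N6: "6 \<le> N" "N > 0" using N by auto
    have rN: "real N > 0" using N6 by simp
    define e where "e = 18 * B / real N"
    have Bq: "B \<le> q * real N" if "\<beta> \<le> q" for q using B(2) mult_right_mono[OF that, of "real N"] by simp
    have e: "0 < e" "e \<le> e0" using Bq[OF \<beta>(3)] B rN by (auto simp: e_def field_simps)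
    define good where "good T a \<longleftrightarrow> (\<forall>t\<in>T. \<bar>a t\<bar> \<le> 1) \<and> (\<forall>G \<sigma>.
         noise_ok R N T a B G \<longrightarrow>
         \<sigma> \<in> spectral_outputs G T \<longrightarrow> (\<exists>y\<in>oriented N. near_order T \<sigma> y (C * B / real N)))" for T a
    have ex: "\<exists>a. good T a" if T: "block N B T" for T
    proof -
      have cT: "real N / 6 \<le> real (card T)" by (rule block_card[OF T N6(1)])
      have "n0 \<le> card T"
      proof -
        have "real (6 * n0) \<le> real N" using N by (simp only: of_nat_le_iff)
        then show ?thesis using cT by simp
      qed
      then obtain a where a: "\<forall>t\<in>T. \<bar>a t\<bar> \<le> 1" and near: "\<forall>G B \<sigma>. 1 \<le> B \<longrightarrow> B \<le> \<beta>0 * real (card T) \<longrightarrow>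
         noise_ok R N T a B G \<longrightarrow>
         \<sigma> \<in> spectral_outputs G T \<longrightarrow>
         (\<exists>y\<in>oriented N. near_order T \<sigma> y (K1 * B / real (card T) + e))"
        using spec[OF N6(2) _ block_equid[OF T N6(1) B(1), folded e_def] less_imp_le[OF e(1)] e(2)] T
        unfolding block_def by blast
      have BT: "B \<le> \<beta>0 * real (card T)"
      proof -
        have "B \<le> \<beta>0 / 6 * real N" by (rule Bq[OF \<beta>(2)])
        also have "\<dots> = \<beta>0 * (real N / 6)" by simp
        also have "\<dots> \<le> \<beta>0 * real (card T)" using cT K1 by (intro mult_left_mono) auto
        finally show ?thesis .
      qed
      have le: "K1 * B / real (card T) + e \<le> C * B / real N"
      proof -
        have "K1 * B / real (card T) \<le> K1 * B / (real N / 6)"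
          using cT rN K1 B by (intro divide_left_mono mult_pos_pos) auto
        also have "\<dots> = 6 * K1 * B / real N" by simp
        finally show ?thesis by (simp add: e_def C_def add_divide_distrib algebra_simps)
      qed
      have "good T a" unfolding good_def
      proof (intro conjI a allI impI)
        fix G \<sigma>
        assume h: "noise_ok R N T a B G" "\<sigma> \<in> spectral_outputs G T"
        from near[rule_format, OF B(1) BT h]
        have "\<exists>y\<in>oriented N. near_order T \<sigma> y (K1 * B / real (card T) + e)" .
        then show "\<exists>y\<in>oriented N. near_order T \<sigma> y (C * B / real N)"
          using near_order_mono[OF _ le] by blast
      qed
      then show ?thesis by blast
    qed
    \<comment> \<open>Weight vectors are chosen for all admissible \<open>T\<close> at once,
      independently of the graph, so that \<open>T\<close> may afterwards be random. The value 0 on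
      other sets keeps the bound by 1.\<close>
    define a where "a T = (if block N B T then SOME f. good T f else (\<lambda>_. 0))" for T
    have ga: "good T (a T)" if "block N B T" for T
      using someI_ex[OF ex[OF that]] that by (simp add: a_def)
    have a1: "\<forall>T. \<forall>t\<in>T. \<bar>a T t\<bar> \<le> 1"
      using ga unfolding good_def by (metis a_def abs_zero zero_le_one)
    have "\<exists>y\<in>oriented N. near_order S \<sigma> y (K * B / real N)"
      if T: "block N B T" and S: "block N B S" and TS: "T \<inter> S = {}" and G: "graph_ok R N T S (a T) B G"
        and \<sigma>: "\<sigma> \<in> subroutine_outputs G T S (5/100) (31/100)" for G T S \<sigma>
    proof -
      obtain \<sigma>T where \<sigma>T: "\<sigma>T \<in> spectral_outputs G T" "\<sigma> \<in> rank_orderings S (\<lambda>v. real_of_int (fhat G T S (5/100) (31/100) \<sigma>T v))"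
        using \<sigma> by (auto simp: subroutine_outputs_def)
      obtain y where y: "y \<in> oriented N" "near_order T \<sigma>T y (C * B / real N)"
        using ga[OF T] G \<sigma>T(1) unfolding good_def graph_ok_def by blast
      define e' where "e' = C * B / real N"
      have e': "0 < e'" "e' \<le> e1" using Bq[OF \<beta>(4)] B rN C by (auto simp: e'_def field_simps)
      have ee': "e \<le> e'" using K1 B rN by (simp add: e_def e'_def C_def divide_right_mono)
      have fin: "finite T" "finite S" using T S by (auto intro: block_finite)
      have cT: "real N / 6 \<le> real (card T)" "real N / 6 \<le> real (card S)" using block_card T S N6 by auto
      then have ne: "T \<noteq> {}" "S \<noteq> {}" using rN by auto
      have eq: "equid U y e'" if U: "block N B U" for U
      proof -
        have "equid U (pos N) e'" by (rule equid_mono[OF block_equid[OF U N6(1) B(1), folded e_def] ee'])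
        then show ?thesis using y(1) equid_flip[OF block_finite[OF U]] by (auto simp: oriented_def)
      qed
      have BeT: "B \<le> e' * real (card T)"
      proof -
        have "B = e' * (real N / 6) * (6 / C)" using rN C by (simp add: e'_def)
        also have "\<dots> \<le> e' * (real N / 6) * 1" using e' rN K1 by (intro mult_left_mono) (auto simp: C_def)
        also have "\<dots> \<le> e' * real (card T)" using cT e' by simp
        finally show ?thesis .
      qed
      have y01: "0 \<le> y t \<and> y t \<le> 1" if "t \<in> T \<union> S" for t
      proof -
        have "t \<in> {1..N}" using that T S by (auto simp: block_def)
        then show ?thesis using y(1) rN by (auto simp: oriented_def pos_def divide_le_eq)
      qed
      have hi: "\<bar>\<Sum>t\<in>{t\<in>T. 95/100 \<le> y t}. noise R N G v t * 1\<bar> \<le> B" and lo: "\<bar>\<Sum>t\<in>{t\<in>T. y t \<le> 5/100}. noise R N G v t * 1\<bar> \<le> B"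
        if v: "v \<in> S" for v
      proof -
        have h: "\<bar>\<Sum>t\<in>{t\<in>T. 95/100 \<le> pos N t}. noise R N G v t * 1\<bar> \<le> B" "\<bar>\<Sum>t\<in>{t\<in>T. pos N t \<le> 5/100}. noise R N G v t * 1\<bar> \<le> B"
          using G v unfolding graph_ok_def by blast+
        \<comment> \<open>Reflection exchanges the two end blocks, so conditions stated for
          \<open>pos N\<close> cover both orientations.\<close>
        have "{t\<in>T. 95/100 \<le> 1 - pos N t} = {t\<in>T. pos N t \<le> 5/100}" "{t\<in>T. 1 - pos N t \<le> 5/100} = {t\<in>T. 95/100 \<le> pos N t}" by auto
        then show "\<bar>\<Sum>t\<in>{t\<in>T. 95/100 \<le> y t}. noise R N G v t * 1\<bar> \<le> B" "\<bar>\<Sum>t\<in>{t\<in>T. y t \<le> 5/100}. noise R N G v t * 1\<bar> \<le> B"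
          using y(1) h unfolding oriented_def by auto
      qed
      have "near_order S \<sigma> y (K2 * e')"
      proof (rule sub[OF fin(1) ne(1) fin(2) ne(2) eq[OF T] eq[OF S] e' y01 _ _ _ \<sigma>T(2)])
        show "near_order T \<sigma>T y e'" using y(2) by (simp add: e'_def)
        show "edge_counts_near R G T S (\<lambda>t. 95/100 \<le> y t) y e'"
          unfolding edge_counts_near_def using block_noise_sum[OF TS _ fin(1) y(1) hi] BeT by (meson order_trans)
        show "edge_counts_near R G T S (\<lambda>t. y t \<le> 5/100) y e'"
          unfolding edge_counts_near_def using block_noise_sum[OF TS _ fin(1) y(1) lo] BeT by (meson order_trans)
      qed
      moreover have "K2 * e' \<le> K * B / real N"
      proof -
        have "K2 * e' = (K2 * C) * (B / real N)" by (simp add: e'_def)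
        also have "\<dots> \<le> K * (B / real N)" using B rN by (intro mult_right_mono) (auto simp: K_def)
        finally show ?thesis by simp
      qed
      ultimately show ?thesis using y(1) near_order_mono by blast
    qed
    then show "\<exists>a. (\<forall>T. \<forall>t\<in>T. \<bar>a T t\<bar> \<le> 1) \<and>
       (\<forall>G T S \<sigma>. block N B T \<longrightarrow> block N B S \<longrightarrow> T \<inter> S = {} \<longrightarrow> graph_ok R N T S (a T) B G \<longrightarrow>
          \<sigma> \<in> subroutine_outputs G T S (5/100) (31/100) \<longrightarrow> (\<exists>y\<in>oriented N. near_order S \<sigma> y (K * B / real N)))"
      using a1 by blast
  qed
qed

end

text \<open>All parts follow from the mean value theorem. R' may vanish at 0 and 1, so a positive
  lower bound for - R' exists only on [\<theta>, 1 - \<theta>], where it is an attained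
  minimum.\<close>

lemma profile_of_C1:
  fixes R R' :: "real \<Rightarrow> real"
  assumes range: "\<And>x. x \<in> {0..1} \<Longrightarrow> 0 < R x \<and> R x \<le> 1"
    and deriv: "\<And>x. x \<in> {0..1} \<Longrightarrow> (R has_real_derivative R' x) (at x within {0..1})"
    and cont: "continuous_on {0..1} R'" and neg: "\<And>x. x \<in> {0<..<1} \<Longrightarrow> R' x < 0"
  shows "\<exists>C1. profile R C1"
proof -
  have mvt: "\<exists>x\<in>{a<..<b}. R a - R b = - R' x * (b - a)" if "0 \<le> a" "a < b" "b \<le> 1" for a b
  proof -
    have "\<exists>x\<in>{a<..<b}. R b - R a = R' x * (b - a)"
    proof (rule mvt_simple[OF that(2)])
      fix x assume "a \<le> x" "x \<le> b"
      then have "(R has_real_derivative R' x) (at x within {a..b})"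
        using that by (intro DERIV_subset[OF deriv]) auto
      then show "(R has_derivative (*) (R' x)) (at x within {a..b})"
        by (simp add: has_field_derivative_def)
    qed
    then obtain x where "x \<in> {a<..<b}" "R b - R a = R' x * (b - a)" by blast
    then show ?thesis by (intro bexI[of _ x]) auto
  qed
  have "\<exists>x\<in>{0..1}. \<forall>y\<in>{0..1}. \<bar>R' y\<bar> \<le> \<bar>R' x\<bar>"
    by (rule continuous_attains_sup) (use cont in \<open>auto intro: continuous_on_rabs\<close>)
  then obtain M where M: "\<And>y. y \<in> {0..1} \<Longrightarrow> \<bar>R' y\<bar> \<le> M" by blast
  define C1 where "C1 = \<bar>M\<bar> + 1"
  have "profile R C1"
  proof
    show "0 < R t" "R t \<le> 1" if "0 \<le> t" "t \<le> 1" for t using range[of t] that by auto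
    show "0 < C1" by (simp add: C1_def)
    show "R b < R a" if ab: "0 \<le> a" "a < b" "b \<le> 1" for a b
    proof -
      obtain x where x: "x \<in> {a<..<b}" "R a - R b = - R' x * (b - a)" using mvt[OF ab] by blast
      have "0 < - R' x * (b - a)" using neg[of x] x ab by (intro mult_pos_pos) auto
      then show ?thesis using x by simp
    qed
    show "R a - R b \<le> C1 * (b - a)" if ab: "0 \<le> a" "a \<le> b" "b \<le> 1" for a b
    proof (cases "a = b")
      case False
      then obtain x where x: "x \<in> {a<..<b}" "R a - R b = - R' x * (b - a)" using mvt[of a b] ab by auto
      have "- R' x \<le> C1" using M[of x] x ab by (auto simp: C1_def)
      then show ?thesis unfolding x(2) using ab by (intro mult_right_mono) auto
    qed simp
    show "\<exists>m>0. \<forall>a b. \<theta> \<le> a \<and> a \<le> b \<and> b \<le> 1 - \<theta> \<longrightarrow> m * (b - a) \<le> R a - R b" if \<theta>: "0 < \<theta>" for \<theta>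
    proof (cases "\<theta> \<le> 1 - \<theta>")
      case True
      have "\<exists>x\<in>{\<theta>..1-\<theta>}. \<forall>y\<in>{\<theta>..1-\<theta>}. - R' x \<le> - R' y"
        by (rule continuous_attains_inf) (use cont True \<theta> in \<open>auto intro!: continuous_on_minus intro: continuous_on_subset\<close>)
      then obtain x0 where x0: "x0 \<in> {\<theta>..1-\<theta>}" "\<And>y. y \<in> {\<theta>..1-\<theta>} \<Longrightarrow> - R' x0 \<le> - R' y" by blast
      show ?thesis
      proof (intro exI[of _ "- R' x0"] conjI allI impI)
        show "0 < - R' x0" using neg[of x0] x0 \<theta> by auto
        fix a b assume ab: "\<theta> \<le> a \<and> a \<le> b \<and> b \<le> 1 - \<theta>"
        show "- R' x0 * (b - a) \<le> R a - R b"
        proof (cases "a = b")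
          case False
          then obtain x where x: "x \<in> {a<..<b}" "R a - R b = - R' x * (b - a)" using mvt[of a b] ab \<theta> by auto
          have "- R' x0 \<le> - R' x" using x ab by (intro x0(2)) auto
          then show ?thesis unfolding x(2) using ab by (intro mult_right_mono) auto
        qed simp
      qed
    next
      case False
      then show ?thesis by (intro exI[of _ 1]) auto
    qed
  qed
  then show ?thesis ..
qed

lemma prob_gt_of_complement:
  assumes "measure_pmf.prob p {x. \<not> A x} \<le> q" "q < r" "\<And>x. A x \<Longrightarrow> x \<in> X"
  shows "1 - r < measure_pmf.prob p X"
proof -
  have "1 - measure_pmf.prob p X = measure_pmf.prob p (- X)"
    using measure_pmf.prob_compl[of X p] by (simp add: Compl_eq_Diff_UNIV)
  also have "\<dots> \<le> measure_pmf.prob p {x. \<not> A x}"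
    by (rule measure_pmf.finite_measure_mono) (use assms(3) in auto)
  finally show ?thesis using assms(1,2) by linarith
qed

lemma scaled_exponent:
  assumes "N \<ge> 1" "c > 0"
  shows "(c * sqrt (real N * ln (real N) powr g))\<^sup>2 / (2 * real N) = c\<^sup>2 / 2 * ln (real N) powr g"
  using assms by (simp add: power_mult_distrib)

context profile
begin

lemma edge_prob: "N > 0 \<Longrightarrow> edge_prob R N"
  by unfold_locales (auto intro: R_le_1 less_imp_le[OF R_pos])

text \<open>The uniform error O(B) per vertex is summed over all vertices; a genuinely l1 argument
  is not involved.\<close>

theorem spectral_l1_error:
  fixes \<epsilon> \<eta> :: real
  assumes \<epsilon>: "0 < \<epsilon>" and \<eta>: "\<eta> < 1/3"
  shows "\<exists>N0. \<forall>N\<ge>N0. measure_pmf.prob (graph_pmf (\<lambda>x y. R \<bar>x - y\<bar>) N)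
      {G. \<forall>\<sigma>\<in>spectral_outputs G {1..N}. dist1 N \<sigma> \<le> real N powr (2 - \<eta>)} > 1 - \<epsilon>"
proof -
  obtain K e0 n0 \<beta> where K: "K > 0" "e0 > 0" "\<beta> > 0" and spec:
    "\<And>N T e. N > 0 \<Longrightarrow> T \<subseteq> {1..N} \<Longrightarrow> equid T (pos N) e \<Longrightarrow> 0 \<le> e \<Longrightarrow> e \<le> e0 \<Longrightarrow> n0 \<le> card T \<Longrightarrow>
      \<exists>a. (\<forall>t\<in>T. \<bar>a t\<bar> \<le> 1) \<and> (\<forall>G B \<sigma>. 1 \<le> B \<longrightarrow> B \<le> \<beta> * real (card T) \<longrightarrow>
         noise_ok R N T a B G \<longrightarrow>
         \<sigma> \<in> spectral_outputs G T \<longrightarrow>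
         (\<exists>y\<in>oriented N. near_order T \<sigma> y (K * B / real (card T) + e)))"
  proof (rule spectral_near_order, goal_cases)
    case 1
    show thesis by (rule 1(1)[OF 1(2-5)])
  qed
  \<comment> \<open>The exponent 2 of the logarithm is one choice above 1, which suffices here since
    only a fixed failure probability is demanded.\<close>
  define B where "B N = 1 * sqrt (real N * ln (real N) powr 2)" for N
  have "eventually (\<lambda>N. 1 \<le> B N \<and> B N \<le> \<beta> * real N \<and> real N * (K * B N + 3) \<le> real N powr (2 - \<eta>) \<and>
      10 * (real N)\<^sup>2 * exp (- (1/2) * ln (real N) powr 2) < \<epsilon> \<and> n0 \<le> N \<and> 1 / e0 \<le> real N \<and> 1 \<le> N) sequentially"
    unfolding B_def
    by (intro eventually_conj scale_ge_1 scale_small eventually_ge_at_top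
        filterlim_at_top[THEN iffD1, OF filterlim_real_sequentially, rule_format])
      (use first_part_asymp[OF \<eta> K(1) \<epsilon>] K in auto)
  then obtain N0 where N0: "\<And>N. N \<ge> N0 \<Longrightarrow> 1 \<le> B N \<and> B N \<le> \<beta> * real N \<and> real N * (K * B N + 3) \<le> real N powr (2 - \<eta>) \<and>
      10 * (real N)\<^sup>2 * exp (- (1/2) * ln (real N) powr 2) < \<epsilon> \<and> n0 \<le> N \<and> 1 / e0 \<le> real N \<and> 1 \<le> N"
    unfolding eventually_sequentially by blast
  show ?thesis
  proof (intro exI[of _ N0] allI impI)
    fix N assume "N0 \<le> N"
    note h = N0[OF this]
    have N: "N > 0" using h by simp
    have e: "1 / real N \<le> e0" using h K N by (simp add: field_simps)
    have "n0 \<le> card {1..N}" using h by simp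
    then obtain a where a: "\<forall>t\<in>{1..N}. \<bar>a t\<bar> \<le> 1" and near: "\<forall>G B \<sigma>. 1 \<le> B \<longrightarrow> B \<le> \<beta> * real (card {1..N}) \<longrightarrow>
         noise_ok R N {1..N} a B G \<longrightarrow>
         \<sigma> \<in> spectral_outputs G {1..N} \<longrightarrow>
         (\<exists>y\<in>oriented N. near_order {1..N} \<sigma> y (K * B / real (card {1..N}) + 1 / real N))"
      using spec[OF N subset_refl equid_full[OF N] _ e] by force
    interpret edge_prob R N using edge_prob[OF N] .
    \<comment> \<open>With \<open>S\<close> empty the end-block conditions are vacuous and
      \<open>graph_ok\<close> reduces to the noise conditions on the full vertex set.\<close>
    have "measure_pmf.prob \<G> {G. \<not> graph_ok R N {1..N} {} a (B N) G} \<le> 10 * (real N)\<^sup>2 * exp (- (B N)\<^sup>2 / (2 * real N))"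
      using a h by (intro prob_graph_ok) auto
    also have "- (B N)\<^sup>2 / (2 * real N) = - (1/2) * ln (real N) powr 2"
      using scaled_exponent[of N 1 2] h unfolding B_def by simp
    finally have p: "measure_pmf.prob \<G> {G. \<not> graph_ok R N {1..N} {} a (B N) G} \<le> 10 * (real N)\<^sup>2 * exp (- (1/2) * ln (real N) powr 2)" .
    show "1 - \<epsilon> < measure_pmf.prob \<G> {G. \<forall>\<sigma>\<in>spectral_outputs G {1..N}. dist1 N \<sigma> \<le> real N powr (2 - \<eta>)}"
    proof (rule prob_gt_of_complement[OF p])
      show "10 * (real N)\<^sup>2 * exp (- (1/2) * ln (real N) powr 2) < \<epsilon>" using h by blast
      fix G assume G: "graph_ok R N {1..N} {} a (B N) G"
      have "dist1 N \<sigma> \<le> real N powr (2 - \<eta>)" if \<sigma>: "\<sigma> \<in> spectral_outputs G {1..N}" for \<sigma>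
      proof -
        have BN: "1 \<le> B N" "B N \<le> \<beta> * real (card {1..N})" using h by auto
        have "noise_ok R N {1..N} a (B N) G" using G by (simp add: graph_ok_def)
        from near[rule_format, OF BN this \<sigma>]
        obtain y where y: "y \<in> oriented N" "near_order {1..N} \<sigma> y (K * B N / real N + 1 / real N)" by auto
        have "\<sigma> ` {1..N} \<subseteq> {1..N}"
          using \<sigma> by (auto simp: spectral_outputs_def rank_orderings_def bij_betw_def)
        from dist1_near[OF N y this] have "dist1 N \<sigma> \<le> real N * ((K * B N / real N + 1 / real N) * real N + 1)" .
        also have "(K * B N / real N + 1 / real N) * real N + 1 = K * B N + 2" using N by (simp add: field_simps)
        also have "real N * (K * B N + 2) \<le> real N * (K * B N + 3)" by (intro mult_left_mono) auto
        finally show ?thesis using h by linarith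
      qed
      then show "G \<in> {G. \<forall>\<sigma>\<in>spectral_outputs G {1..N}. dist1 N \<sigma> \<le> real N powr (2 - \<eta>)}" by blast
    qed
  qed
qed

lemma subroutine_range: "\<sigma> \<in> subroutine_outputs G T S \<alpha> \<beta> \<Longrightarrow> \<sigma> ` S \<subseteq> {1..card S}"
  by (auto simp: subroutine_outputs_def rank_orderings_def bij_betw_def)

text \<open>On the good event all four runs are within e = K b / N of one of the two orientations.
  Alignment moves the three blocks to the orientation of the reference run and at most doubles e;
  merging adds at most 7.\<close>

theorem post_processing_linf_error:
  fixes \<epsilon> \<gamma> :: real
  assumes \<gamma>: "1 < \<gamma>" and \<epsilon>: "0 < \<epsilon>"
  shows "\<exists>\<delta>>0. \<exists>N0. \<forall>N\<ge>N0.
       measure_pmf.prob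
         (pair_pmf (graph_pmf (\<lambda>x y. R \<bar>x - y\<bar>) N)
                   (pair_pmf (pmf_of_set (good_partitions N)) (pmf_of_set (good_partitions N))))
         {(G, P, P'). \<forall>\<sigma>\<in>pp_outputs G (5/100) (31/100) P P'.
              distinf N \<sigma> \<le> \<epsilon> * sqrt (real N * ln (real N) powr \<gamma>)}
       > 1 - eps_gamma \<gamma> N powr \<delta>"
proof -
  obtain K \<beta> N1 where K: "K \<ge> 6" "\<beta> > 0" and sub:
    "\<And>N B. N1 \<le> N \<Longrightarrow> 1 \<le> B \<Longrightarrow> B \<le> \<beta> * real N \<Longrightarrow> \<exists>a. (\<forall>T. \<forall>t\<in>T. \<bar>a T t\<bar> \<le> 1) \<and>
       (\<forall>G T S \<sigma>. block N B T \<longrightarrow> block N B S \<longrightarrow> T \<inter> S = {} \<longrightarrow> graph_ok R N T S (a T) B G \<longrightarrow>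
          \<sigma> \<in> subroutine_outputs G T S (5/100) (31/100) \<longrightarrow> (\<exists>y\<in>oriented N. near_order S \<sigma> y (K * B / real N)))"
  proof (rule subroutine_oriented, goal_cases)
    case 1
    show thesis by (rule 1(1)[OF 1(2-4)])
  qed
  \<comment> \<open>1/100 is what the overlap estimate asks for, and 1 / (11 K) makes K b / N
    smaller than 1/10 for the alignment.\<close>
  define \<beta>' where "\<beta>' = min \<beta> (min (1/100) (1 / (11 * K)))"
  have \<beta>': "\<beta>' > 0" "\<beta>' \<le> \<beta>" "\<beta>' \<le> 1/100" "\<beta>' \<le> 1 / (11 * K)" using K unfolding \<beta>'_def by (simp, linarith+)
  \<comment> \<open>The final error is 6 K b + 7 \<le> (6 K + 7) b, and this \<kappa> turns it into
    the prescribed bound.\<close>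
  define \<kappa> where "\<kappa> = \<epsilon> / (6 * K + 7)"
  have \<kappa>: "\<kappa> > 0" using \<epsilon> K by (simp add: \<kappa>_def)
  \<comment> \<open>The tail exp (- b^2 / (2 N)) equals exp (- 2 c (ln N)^\<gamma>); half of this
    exponent survives as \<delta> = c.\<close>
  define c where "c = \<kappa>\<^sup>2 / 4"
  have c: "c > 0" using \<kappa> by (simp add: c_def)
  define B where "B N = \<kappa> * sqrt (real N * ln (real N) powr \<gamma>)" for N
  have "eventually (\<lambda>N. 1 \<le> B N \<and> B N \<le> \<beta>' * real N \<and>
      58 * (real N + 1) ^ 3 * exp (- 2 * c * ln (real N) powr \<gamma>) < exp (- c * ln (real N) powr \<gamma>) \<and> N1 \<le> N \<and> 100 \<le> N) sequentially"
    unfolding B_def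
    by (intro eventually_conj scale_ge_1[OF \<gamma> \<kappa>] scale_small[OF \<gamma> \<kappa> \<beta>'(1)] log_dominated[OF \<gamma> c] eventually_ge_at_top)
  then obtain N0 where N0: "\<And>N. N \<ge> N0 \<Longrightarrow> 1 \<le> B N \<and> B N \<le> \<beta>' * real N \<and>
      58 * (real N + 1) ^ 3 * exp (- 2 * c * ln (real N) powr \<gamma>) < exp (- c * ln (real N) powr \<gamma>) \<and> N1 \<le> N \<and> 100 \<le> N"
    unfolding eventually_sequentially by blast
  show ?thesis
  proof (intro exI[of _ c] conjI exI[of _ N0] allI impI c)
    fix N assume "N0 \<le> N"
    note h = N0[OF this]
    define b where "b = B N"
    have b: "1 \<le> b" "b \<le> \<beta>' * real N" using h by (auto simp: b_def)
    have N: "N > 0" "6 \<le> N" "100 \<le> N" "N1 \<le> N" "real N > 0" using h by auto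
    have bq: "b \<le> q * real N" if "\<beta>' \<le> q" for q using b(2) mult_right_mono[OF that, of "real N"] by simp
    interpret edge_prob R N using edge_prob[OF N(1)] .
    obtain a where a: "\<forall>T. \<forall>t\<in>T. \<bar>a T t\<bar> \<le> 1" and near:
       "\<forall>G T S \<sigma>. block N b T \<longrightarrow> block N b S \<longrightarrow> T \<inter> S = {} \<longrightarrow> graph_ok R N T S (a T) b G \<longrightarrow>
          \<sigma> \<in> subroutine_outputs G T S (5/100) (31/100) \<longrightarrow> (\<exists>y\<in>oriented N. near_order S \<sigma> y (K * b / real N))"
      using sub[OF N(4) b(1) bq[OF \<beta>'(2)]] by blast
    define q where "q = exp (- b\<^sup>2 / (2 * real N))"
    have q: "q = exp (- 2 * c * ln (real N) powr \<gamma>)"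
      using scaled_exponent[of N \<kappa> \<gamma>] \<kappa> N unfolding q_def b_def B_def c_def by simp
    let ?U = "pmf_of_set (good_partitions N)"
    let ?V = "pair_pmf ?U ?U"
    have sU: "set_pmf ?U = good_partitions N" by (simp add: good_partitions_ne finite_good_partitions)
    define Q where "Q PP \<longleftrightarrow> partitions_ok N b PP \<and> fst PP \<in> good_partitions N \<and> snd PP \<in> good_partitions N" for PP
    define graphs where "graphs G PP \<longleftrightarrow> (case PP of ((S1, S2, S3), (S1', S2', S3')) \<Rightarrow>
       graph_ok R N S3 S1 (a S3) b G \<and> graph_ok R N S1 S2 (a S1) b G \<and> graph_ok R N S2 S3 (a S2) b G \<and> graph_ok R N S1' S2' (a S1') b G)"
      for G and PP :: "(nat set \<times> nat set \<times> nat set) \<times> nat set \<times> nat set \<times> nat set"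
    have pQ: "measure_pmf.prob ?V {PP. \<not> Q PP} \<le> 18 * (real N + 1) ^ 3 * q"
    proof -
      have "measure_pmf.prob ?V {PP. \<not> Q PP} \<le> measure_pmf.prob ?V {PP. \<not> partitions_ok N b PP}"
      proof (rule measure_pmf.finite_measure_mono_AE)
        show "AE PP in ?V. PP \<in> {PP. \<not> Q PP} \<longrightarrow> PP \<in> {PP. \<not> partitions_ok N b PP}"
          unfolding AE_measure_pmf_iff using sU by (auto simp: Q_def)
      qed simp
      also have "\<dots> \<le> 18 * (real N + 1) ^ 3 * q"
        unfolding q_def using b bq[OF \<beta>'(3)] by (intro prob_partitions_ok N) auto
      finally show ?thesis .
    qed
    have pG: "measure_pmf.prob \<G> {G. \<not> (Q PP \<and> graphs G PP)} \<le> 40 * (real N)\<^sup>2 * q" if Q: "Q PP" for PP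
    proof -
      obtain S1 S2 S3 S1' S2' S3' where PP: "PP = ((S1, S2, S3), (S1', S2', S3'))" by (metis prod.exhaust)
      have sub: "S1 \<subseteq> {1..N}" "S2 \<subseteq> {1..N}" "S3 \<subseteq> {1..N}" "S1' \<subseteq> {1..N}" "S2' \<subseteq> {1..N}"
        using Q unfolding Q_def PP good_partitions_def by auto
      have one: "measure_pmf.prob \<G> {G. \<not> graph_ok R N T S (a T) b G} \<le> 10 * (real N)\<^sup>2 * q"
        if "T \<subseteq> {1..N}" "S \<subseteq> {1..N}" for T S
        unfolding q_def using that a b by (intro prob_graph_ok) auto
      have "measure_pmf.prob \<G> {G. \<not> graph_ok R N S3 S1 (a S3) b G \<or> \<not> graph_ok R N S1 S2 (a S1) b G \<or>
          \<not> graph_ok R N S2 S3 (a S2) b G \<or> \<not> graph_ok R N S1' S2' (a S1') b G}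
         \<le> 10 * (real N)\<^sup>2 * q + (10 * (real N)\<^sup>2 * q + (10 * (real N)\<^sup>2 * q + 10 * (real N)\<^sup>2 * q))"
        by (intro prob_Or_le one sub)
      then have "measure_pmf.prob \<G> {G. \<not> (Q PP \<and> graphs G PP)} \<le> 10 * (real N)\<^sup>2 * q + (10 * (real N)\<^sup>2 * q + (10 * (real N)\<^sup>2 * q + 10 * (real N)\<^sup>2 * q))"
        by (rule prob_subset_le[rotated]) (use Q in \<open>auto simp: graphs_def PP\<close>)
      also have "\<dots> = 40 * (real N)\<^sup>2 * q" by simp
      finally show ?thesis .
    qed
    have q0: "0 \<le> q" by (simp add: q_def)
    \<comment> \<open>Once the partitions are fixed, the training sets of the four runs and their
      weight vectors \<open>a\<close> are deterministic.\<close>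
    have p: "measure_pmf.prob (pair_pmf \<G> ?V) {(G, PP). \<not> (Q PP \<and> graphs G PP)} \<le> 18 * (real N + 1) ^ 3 * q + 40 * (real N)\<^sup>2 * q"
      by (rule pair_pmf_prob_bound'[where Q = Q, OF pQ pG]) (use q0 in auto)
    have lt: "18 * (real N + 1) ^ 3 * q + 40 * (real N)\<^sup>2 * q < eps_gamma \<gamma> N powr c"
    proof -
      have "(real N)\<^sup>2 \<le> (real N + 1) ^ 3"
      proof -
        have "(real N)\<^sup>2 * 1 \<le> (real N + 1)\<^sup>2 * (real N + 1)" by (intro mult_mono power_mono) auto
        then show ?thesis by (simp add: power3_eq_cube power2_eq_square)
      qed
      then have "(real N)\<^sup>2 * q \<le> (real N + 1) ^ 3 * q" using q0 by (rule mult_right_mono)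
      then have "18 * (real N + 1) ^ 3 * q + 40 * (real N)\<^sup>2 * q \<le> 58 * (real N + 1) ^ 3 * q" by (simp only: mult.assoc)
      also have "\<dots> < exp (- c * ln (real N) powr \<gamma>)" using h unfolding q by blast
      also have "\<dots> = eps_gamma \<gamma> N powr c" by (simp add: eps_gamma_def powr_def)
      finally show ?thesis .
    qed
    have det: "distinf N \<sigma> \<le> \<epsilon> * sqrt (real N * ln (real N) powr \<gamma>)"
      if Q: "Q (P, P')" and G: "graphs G (P, P')" and \<sigma>: "\<sigma> \<in> pp_outputs G (5/100) (31/100) P P'" for G P P' \<sigma>
    proof -
      obtain S1 S2 S3 where P: "P = (S1, S2, S3)" by (metis prod.exhaust)
      obtain S1' S2' S3' where P': "P' = (S1', S2', S3')" by (metis prod.exhaust)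
      have good: "(S1, S2, S3) \<in> good_partitions N" "(S1', S2', S3') \<in> good_partitions N"
        and ok: "partition_ok N b (S1, S2, S3)" "partition_ok N b (S1', S2', S3')" "overlap_ok N (S1, S2, S3) (S1', S2', S3')"
        using Q by (auto simp: Q_def partitions_ok_def P P')
      note blk = good_partition_blocks[OF good(1) ok(1)] and blk' = good_partition_blocks[OF good(2) ok(2)]
      have dj: "S3 \<inter> S1 = {}" "S1 \<inter> S2 = {}" "S2 \<inter> S3 = {}" "S1' \<inter> S2' = {}"
        using good by (auto simp: good_partitions_def)
      have gr: "graph_ok R N S3 S1 (a S3) b G" "graph_ok R N S1 S2 (a S1) b G" "graph_ok R N S2 S3 (a S2) b G" "graph_ok R N S1' S2' (a S1') b G"
        using G by (auto simp: graphs_def P P')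
      obtain \<sigma>1 \<sigma>2 \<sigma>3 \<sigma>r where \<sigma>s: "\<sigma>1 \<in> subroutine_outputs G S3 S1 (5/100) (31/100)" "\<sigma>2 \<in> subroutine_outputs G S1 S2 (5/100) (31/100)"
          "\<sigma>3 \<in> subroutine_outputs G S2 S3 (5/100) (31/100)" "\<sigma>r \<in> subroutine_outputs G S1' S2' (5/100) (31/100)"
        and \<sigma>e: "\<sigma> = merged S1 S2 S3 (align_to S1 \<sigma>1 S2' \<sigma>r) (align_to S2 \<sigma>2 S2' \<sigma>r) (align_to S3 \<sigma>3 S2' \<sigma>r)"
        using \<sigma> unfolding pp_outputs_def P P' by auto
      define e where "e = K * b / real N"
      have e: "e < 1/10"
      proof -
        have "b \<le> 1 / (11 * K) * real N" by (rule bq[OF \<beta>'(4)])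
        then have "K * b \<le> real N / 11" using K by (simp add: field_simps)
        then show ?thesis using N by (simp add: e_def field_simps)
      qed
      have e1: "1 \<le> e * real (card S)" if "block N b S" for S
      proof -
        have "1 * 6 \<le> b * K" using b K by (intro mult_mono) auto
        then have "1 \<le> e * (real N / 6)" using N by (simp add: e_def mult.commute)
        also have "\<dots> \<le> e * real (card S)" using block_card[OF that N(2)] K b by (intro mult_left_mono) (auto simp: e_def)
        finally show ?thesis .
      qed
      obtain y1 where y1: "y1 \<in> oriented N" "near_order S1 \<sigma>1 y1 e"
        using near[rule_format, OF blk(3) blk(1) dj(1) gr(1) \<sigma>s(1)] by (auto simp: e_def)
      obtain y2 where y2: "y2 \<in> oriented N" "near_order S2 \<sigma>2 y2 e"
        using near[rule_format, OF blk(1) blk(2) dj(2) gr(2) \<sigma>s(2)] by (auto simp: e_def)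
      obtain y3 where y3: "y3 \<in> oriented N" "near_order S3 \<sigma>3 y3 e"
        using near[rule_format, OF blk(2) blk(3) dj(3) gr(3) \<sigma>s(3)] by (auto simp: e_def)
      obtain yr where yr: "yr \<in> oriented N" "near_order S2' \<sigma>r yr e"
        using near[rule_format, OF blk'(1) blk'(2) dj(4) gr(4) \<sigma>s(4)] by (auto simp: e_def)
      have common: "\<exists>i0\<in>S \<inter> S2'. pos N i0 \<le> 1/4" if "S = S1 \<or> S = S2 \<or> S = S3" for S
      proof -
        have "part_set c (S1, S2, S3) = S" if "c = (if S = S1 then 0 else if S = S2 then 1 else 2)" for c
          using \<open>S = S1 \<or> S = S2 \<or> S = S3\<close> that by (auto simp: part_set_def)
        moreover have "(if S = S1 then 0 else if S = S2 then 1 else 2) \<in> {0, 1, 2::nat}" by simp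
        ultimately have "part_set 1 (S1', S2', S3') \<inter> (S \<inter> {1..N div 4}) \<noteq> {}"
          using ok(3) unfolding overlap_ok_def by blast
        moreover have "part_set 1 (S1', S2', S3') = S2'" by (simp add: part_set_def)
        ultimately obtain i0 where i0: "i0 \<in> S \<inter> S2'" "i0 \<in> {1..N div 4}" by blast
        then have "4 * i0 \<le> N" by auto
        then have "real (4 * i0) \<le> real N" by (simp only: of_nat_le_iff)
        then have "pos N i0 \<le> 1/4" using N by (simp add: pos_def field_simps)
        then show ?thesis using i0 by blast
      qed
      have al: "near_order S (align_to S \<tau> S2' \<sigma>r) yr (2 * e) \<and> align_to S \<tau> S2' \<sigma>r ` S \<subseteq> {1..card S}"
        if S: "S = S1 \<or> S = S2 \<or> S = S3" and blS: "block N b S" and y: "y \<in> oriented N" "near_order S \<tau> y e" and r: "\<tau> ` S \<subseteq> {1..card S}" for S \<tau> y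
      proof -
        obtain i0 where i0: "i0 \<in> S \<inter> S2'" "pos N i0 \<le> 1/4" using common[OF S] by blast
        note A = align_to_near[OF block_finite[OF blS] block_finite[OF blk'(2)] y(2,1) r e1[OF blS] yr(2,1) i0 e]
        show ?thesis using A by blast
      qed
      have a1: "near_order S1 (align_to S1 \<sigma>1 S2' \<sigma>r) yr (2 * e) \<and> align_to S1 \<sigma>1 S2' \<sigma>r ` S1 \<subseteq> {1..card S1}"
        by (rule al[OF _ blk(1) y1 subroutine_range[OF \<sigma>s(1)]]) simp
      have a2: "near_order S2 (align_to S2 \<sigma>2 S2' \<sigma>r) yr (2 * e) \<and> align_to S2 \<sigma>2 S2' \<sigma>r ` S2 \<subseteq> {1..card S2}"
        by (rule al[OF _ blk(2) y2 subroutine_range[OF \<sigma>s(2)]]) simp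
      have a3: "near_order S3 (align_to S3 \<sigma>3 S2' \<sigma>r) yr (2 * e) \<and> align_to S3 \<sigma>3 S2' \<sigma>r ` S3 \<subseteq> {1..card S3}"
        by (rule al[OF _ blk(3) y3 subroutine_range[OF \<sigma>s(3)]]) simp
      have "distinf N \<sigma> \<le> 3 * (2 * e) * real N + 7"
        unfolding \<sigma>e using a1 a2 a3 by (intro distinf_merged[OF N(1) good(1) yr(1)]) auto
      also have "\<dots> = 6 * K * b + 7" using N by (simp add: e_def)
      also have "\<dots> \<le> (6 * K + 7) * b" using b by (simp add: algebra_simps)
      also have "\<dots> = \<epsilon> * sqrt (real N * ln (real N) powr \<gamma>)"
        using K by (simp add: b_def B_def \<kappa>_def)
      finally show ?thesis .
    qed
    show "1 - eps_gamma \<gamma> N powr c < measure_pmf.prob (pair_pmf \<G> ?V)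
         {(G, P, P'). \<forall>\<sigma>\<in>pp_outputs G (5/100) (31/100) P P'. distinf N \<sigma> \<le> \<epsilon> * sqrt (real N * ln (real N) powr \<gamma>)}"
    proof (rule prob_gt_of_complement[where A = "\<lambda>(G, PP). Q PP \<and> graphs G PP", OF _ lt])
      show "measure_pmf.prob (pair_pmf \<G> ?V) {x. \<not> (case x of (G, PP) \<Rightarrow> Q PP \<and> graphs G PP)}
          \<le> 18 * (real N + 1) ^ 3 * q + 40 * (real N)\<^sup>2 * q"
        using p by (simp add: case_prod_unfold)
    qed (use det in auto)
  qed
qed

end

theorem theorem1:
  fixes R :: "real \<Rightarrow> real"
  assumes R_range: "\<forall>x\<in>{0..1}. 0 < R x \<and> R x \<le> 1"
    and R_C1: "\<exists>R'. (\<forall>x\<in>{0..1}. (R has_real_derivative R' x) (at x within {0..1}))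
                 \<and> continuous_on {0..1} R' \<and> (\<forall>x\<in>{0<..<1}. R' x < 0)"
  shows
   "(\<exists>C>0. \<forall>\<epsilon>::real\<in>{0<..<1}. \<forall>\<eta>::real\<in>{0<..<1/3}. \<exists>N0. \<forall>N\<ge>N0.
       measure_pmf.prob (graph_pmf (\<lambda>x y. R \<bar>x - y\<bar>) N)
         {G. \<forall>\<sigma>\<in>spectral_outputs G {1..N}. dist1 N \<sigma> \<le> C * real N powr (2 - \<eta>)} > 1 - \<epsilon>)
    \<and> (\<forall>\<gamma>>1. \<forall>\<epsilon>>0. \<exists>\<delta>>0. \<exists>N0. \<forall>N\<ge>N0.
       measure_pmf.prob
         (pair_pmf (graph_pmf (\<lambda>x y. R \<bar>x - y\<bar>) N)
                   (pair_pmf (pmf_of_set (good_partitions N)) (pmf_of_set (good_partitions N))))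
         {(G, P, P'). \<forall>\<sigma>\<in>pp_outputs G 0.05 0.31 P P'.
              distinf N \<sigma> \<le> \<epsilon> * sqrt (real N * ln (real N) powr \<gamma>)}
       > 1 - eps_gamma \<gamma> N powr \<delta>)"
proof -
  obtain C1 where "profile R C1"
    using profile_of_C1[of R] R_range R_C1 by blast
  then interpret profile R C1 .
  have num: "(0.05::real) = 5/100" "(0.31::real) = 31/100" by simp_all
  show ?thesis
    unfolding num
  proof (intro conjI)
    \<comment> \<open>The power of N leaves enough room for C = 1, whatever R is.\<close>
    have l1: "\<exists>N0. \<forall>N\<ge>N0. 1 - \<epsilon> < measure_pmf.prob (graph_pmf (\<lambda>x y. R \<bar>x - y\<bar>) N)
         {G. \<forall>\<sigma>\<in>spectral_outputs G {1..N}. dist1 N \<sigma> \<le> 1 * real N powr (2 - \<eta>)}"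
      if "\<epsilon> \<in> {0<..<1}" "\<eta> \<in> {0<..<1/3}" for \<epsilon> \<eta> :: real
      using spectral_l1_error[of \<epsilon> \<eta>] that by simp
    show "\<exists>C>0. \<forall>\<epsilon>::real\<in>{0<..<1}. \<forall>\<eta>::real\<in>{0<..<1/3}. \<exists>N0. \<forall>N\<ge>N0.
       1 - \<epsilon> < measure_pmf.prob (graph_pmf (\<lambda>x y. R \<bar>x - y\<bar>) N)
         {G. \<forall>\<sigma>\<in>spectral_outputs G {1..N}. dist1 N \<sigma> \<le> C * real N powr (2 - \<eta>)}"
      by (rule exI[of _ "1::real"], rule conjI, simp, intro ballI, rule l1)
  qed (intro allI impI post_processing_linf_error)
qed

end
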